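(* Let $d\ge2$, $\varepsilon\in(0,\tfrac12]$, and let $M$ be a Riemannian manifold isometric to $\mathbb{S}^d/\Gamma$, $\mathbb{E}^d/\Gamma$ or $\mathbb{H}^d/\Gamma$ for some finite group $\Gamma$ of isometries. For any set $P$ of $n$ points of $M$ there is a Steiner $(1+\varepsilon)$-spanner for $P$ (with respect to the geodesic distance of $M$) with $d^{O(d)}\,\varepsilon^{(1-d)/2}\log\frac1\varepsilon\cdot n|\Gamma|$ edges.
   Context: A Steiner $t$-spanner for finite $P$ in a metric space is a geometric graph (edges weighted by the distance between endpoints) on $P\cup S$ for a finite set $S$ of further points of the space, with shortest-path distance at most $t$ times the true distance for every pair of points of $P$. $O(\cdot)$ constants absolute. *)

theory Defs
  imports "HOL-Analysis.Analysis" "HOL-Library.FuncSet"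
begin

text \<open>Points of the model spaces are represented as functions nat => real
  with finitely many (explicitly bounded) nonzero coordinates, since the
  dimension d is quantified inside the statement.\<close>

datatype geom = Sph | Euc | Hyp

text \<open>Carrier of the model space:
  Euc: E^d = R^d (coordinates 0..d-1);
  Sph: unit sphere S^d in R^(d+1);
  Hyp: hyperboloid model of H^d in R^(d,1), coordinate d is the time coordinate.\<close>
fun model_carrier :: "geom \<Rightarrow> nat \<Rightarrow> (nat \<Rightarrow> real) set" where
  "model_carrier Euc d = {x. \<forall>i\<ge>d. x i = 0}"
| "model_carrier Sph d = {x. (\<forall>i\<ge>Suc d. x i = 0) \<and> (\<Sum>i<Suc d. (x i)\<^sup>2) = 1}"
| "model_carrier Hyp d = {x. (\<forall>i\<ge>Suc d. x i = 0) \<and> x d > 0 \<and>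
                              (\<Sum>i<d. (x i)\<^sup>2) - (x d)\<^sup>2 = -1}"

fun model_dist :: "geom \<Rightarrow> nat \<Rightarrow> (nat \<Rightarrow> real) \<Rightarrow> (nat \<Rightarrow> real) \<Rightarrow> real" where
  "model_dist Euc d x y = sqrt (\<Sum>i<d. (x i - y i)\<^sup>2)"
| "model_dist Sph d x y = arccos (\<Sum>i<Suc d. x i * y i)"
| "model_dist Hyp d x y = arcosh (x d * y d - (\<Sum>i<d. x i * y i))"

definition fin_isom_group :: "geom \<Rightarrow> nat \<Rightarrow> ((nat \<Rightarrow> real) \<Rightarrow> (nat \<Rightarrow> real)) set \<Rightarrow> bool" where
  "fin_isom_group k d G \<longleftrightarrow>
     (let X = model_carrier k d in
      finite G \<and> G \<subseteq> (X \<rightarrow>\<^sub>E X) \<and>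
      restrict id X \<in> G \<and>
      (\<forall>g\<in>G. \<forall>h\<in>G. compose X g h \<in> G) \<and>
      (\<forall>g\<in>G. bij_betw g X X \<and>
          (\<forall>x\<in>X. \<forall>y\<in>X. model_dist k d (g x) (g y) = model_dist k d x y)))"

text \<open>The action is free (needed for X/G to be a manifold).\<close>
definition acts_freely :: "geom \<Rightarrow> nat \<Rightarrow> ((nat \<Rightarrow> real) \<Rightarrow> (nat \<Rightarrow> real)) set \<Rightarrow> bool" where
  "acts_freely k d G \<longleftrightarrow>
     (\<forall>g\<in>G. \<forall>x\<in>model_carrier k d. g x = x \<longrightarrow> g = restrict id (model_carrier k d))"

definition orbit :: "('a \<Rightarrow> 'a) set \<Rightarrow> 'a \<Rightarrow> 'a set" where
  "orbit G x = (\<lambda>g. g x) ` G"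

text \<open>The quotient space X/G: its points are the G-orbits; its geodesic
  distance is the quotient metric (minimal distance between orbit representatives).\<close>
definition quot_carrier :: "geom \<Rightarrow> nat \<Rightarrow> ((nat \<Rightarrow> real) \<Rightarrow> (nat \<Rightarrow> real)) set \<Rightarrow> (nat \<Rightarrow> real) set set" where
  "quot_carrier k d G = orbit G ` model_carrier k d"

definition quot_dist :: "geom \<Rightarrow> nat \<Rightarrow> (nat \<Rightarrow> real) set \<Rightarrow> (nat \<Rightarrow> real) set \<Rightarrow> real" where
  "quot_dist k d A B = Min ((\<lambda>(a, b). model_dist k d a b) ` (A \<times> B))"

fun walk_weight :: "('a \<Rightarrow> 'a \<Rightarrow> real) \<Rightarrow> 'a list \<Rightarrow> real" where
  "walk_weight \<delta> (x # y # xs) = \<delta> x y + walk_weight \<delta> (y # xs)"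
| "walk_weight \<delta> _ = 0"

definition is_walk :: "'a set set \<Rightarrow> 'a list \<Rightarrow> 'a \<Rightarrow> 'a \<Rightarrow> bool" where
  "is_walk E xs p q \<longleftrightarrow> xs \<noteq> [] \<and> hd xs = p \<and> last xs = q \<and>
     (\<forall>i. Suc i < length xs \<longrightarrow> {xs ! i, xs ! Suc i} \<in> E)"

definition steiner_spanner :: "'a set \<Rightarrow> ('a \<Rightarrow> 'a \<Rightarrow> real) \<Rightarrow> real \<Rightarrow> 'a set \<Rightarrow> 'a set \<Rightarrow> 'a set set \<Rightarrow> bool" where
  "steiner_spanner M \<delta> t P V E \<longleftrightarrow>
     finite V \<and> P \<subseteq> V \<and> V \<subseteq> M \<and>
     E \<subseteq> {{u, v} | u v. u \<in> V \<and> v \<in> V \<and> u \<noteq> v} \<and>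
     (\<forall>p\<in>P. \<forall>q\<in>P. \<exists>xs. is_walk E xs p q \<and> walk_weight \<delta> xs \<le> t * \<delta> p q)"

end

theory Submission
  imports Defs
begin

text \<open>A spanner of all lifts of \<open>P\<close> in the model space projects to a spanner of \<open>P\<close>, since projecting
  does not increase distances; so it suffices to treat finite subsets of the three model spaces.
  There, cut space by boundedly many shifted dyadic grids such that any two points lie in a common cube of one of
  them whose side \<open>w\<close> is comparable to their coordinate distance. The geodesic between them crosses a wall of that
  cube far from both ends, and by Stewart's theorem a detour through a point of a net of mesh of order \<open>\<surd>\<epsilon> w\<close> on the
  walls costs only a factor \<open>1 + O(\<epsilon>)\<close>; the walls have dimension \<open>d - 1\<close>, whence \<open>\<epsilon>\<close> to the power \<open>(1 - d) / 2\<close>.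
  Each net point is joined to one representative of every nonempty subcube \<open>O(log (1 / \<epsilon>))\<close> levels down, and
  the remaining gap is closed by induction on the distance. Only cubes that separate points of \<open>P\<close> matter, and a
  telescoping sum over the levels bounds the number of cube-subcube pairs by \<open>O(n log (1 / \<epsilon>))\<close>.

  Hyperbolic space is treated in the half-space model with the same Euclidean grids. A subcube near the
  boundary at infinity has infinite diameter, so its representative is replaced by an anchor point
  above it; nested anchors are joined in a chain, each hop of which is nearly vertical and costs a factor
  \<open>1 + O(\<epsilon>)\<close>.\<close>

section \<open>Weighted connectivity\<close>

text \<open>The exponent (1 - d) / 2 instead of 1 - d rests on a second-order effect: moving the
  crossing point by t costs only O(t^2 / w) if both ends are at distance of order w from it. Hence a
  wall must be met in the middle third of the way, and every cube carries 25 parallel walls in each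
  direction, not just its faces. The spread of P is unbounded, so the number of dyadic levels must
  not enter the edge count; this forces the restriction to separating cubes and the telescoping
  count. A net point sees only a representative of a subcube. The remaining gap is a multiple
  O(\<epsilon>) of the distance to be approximated, so even a factor 1 + \<epsilon> on it is
  affordable; this fixes the depth O(log (1 / \<epsilon>)). In the half-space this fails for a
  subcube that reaches down to heights below its side: the points in it may be arbitrarily far
  apart. There the cost is measured by the logarithm of the height, a potential whose differences
  telescope along chains of any length.\<close>

inductive rpath :: "('a \<Rightarrow> 'a \<Rightarrow> real) \<Rightarrow> ('a \<times> 'a) set \<Rightarrow> 'a \<Rightarrow> 'a \<Rightarrow> real \<Rightarrow> bool"
  for \<delta> R where
  rpath_refl: "rpath \<delta> R x x 0"
| rpath_step: "(x, y) \<in> R \<or> (y, x) \<in> R \<Longrightarrow> rpath \<delta> R y z r \<Longrightarrow> rpath \<delta> R x z (\<delta> x y + r)"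

definition conn :: "('a \<Rightarrow> 'a \<Rightarrow> real) \<Rightarrow> ('a \<times> 'a) set \<Rightarrow> 'a \<Rightarrow> 'a \<Rightarrow> real \<Rightarrow> bool" where
  "conn \<delta> R x y t \<longleftrightarrow> (\<exists>r\<le>t. rpath \<delta> R x y r)"

lemma rpath_trans: "rpath \<delta> R x y r \<Longrightarrow> rpath \<delta> R y z r' \<Longrightarrow> rpath \<delta> R x z (r + r')"
proof (induction rule: rpath.induct)
  case (rpath_step x y z r)
  then show ?case using rpath.rpath_step[of x y R \<delta>] by (simp add: add.assoc)
qed simp

lemma rpath_sym:
  assumes sym: "\<And>x y. \<delta> x y = \<delta> y x" and "rpath \<delta> R x y r"
  shows "rpath \<delta> R y x r"
  using assms(2)
proof (induction rule: rpath.induct)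
  case (rpath_step x y z r)
  have "rpath \<delta> R y x (\<delta> y x + 0)"
    using rpath_step.hyps(1) by (intro rpath.rpath_step rpath.rpath_refl) blast
  from rpath_trans[OF rpath_step.IH this] show ?case by (simp add: sym[of y x] add.commute)
qed (rule rpath_refl)

lemma conn_refl: "0 \<le> t \<Longrightarrow> conn \<delta> R x x t"
  unfolding conn_def using rpath_refl by metis

lemma conn_trans: "conn \<delta> R x y s \<Longrightarrow> conn \<delta> R y z t \<Longrightarrow> conn \<delta> R x z (s + t)"
  unfolding conn_def using rpath_trans add_mono by metis

lemma conn_edge: "(x, y) \<in> R \<Longrightarrow> \<delta> x y \<le> t \<Longrightarrow> conn \<delta> R x y t"
  unfolding conn_def using rpath_step[OF _ rpath_refl, of x y R \<delta>] by auto

lemma conn_sym: "(\<And>x y. \<delta> x y = \<delta> y x) \<Longrightarrow> conn \<delta> R x y t \<Longrightarrow> conn \<delta> R y x t"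
  unfolding conn_def using rpath_sym by metis

lemma conn_mono: "conn \<delta> R x y s \<Longrightarrow> s \<le> t \<Longrightarrow> conn \<delta> R x y t"
  unfolding conn_def using order_trans by blast

lemma conn_trans_le: "conn \<delta> R x y s \<Longrightarrow> conn \<delta> R y z t \<Longrightarrow> s + t \<le> u \<Longrightarrow> conn \<delta> R x z u"
  using conn_trans conn_mono by fast

section \<open>Counting in a nested family of partitions\<close>

text \<open>The 3 matches \<open>dyadic_pair\<close>: a pair treated at level \<open>l\<close>
  shares a cell of side w and differs by more than w / 6 in some coordinate, so cells of side w / 8
  separate it.\<close>

definition branching :: "(nat \<Rightarrow> 'a \<Rightarrow> 'c) \<Rightarrow> 'a set \<Rightarrow> nat \<Rightarrow> 'a \<Rightarrow> bool" where
  "branching cell P l p \<longleftrightarrow>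
     (\<exists>q\<in>P. \<exists>q'\<in>P. cell l q = cell l p \<and> cell l q' = cell l p \<and> cell (l + 3) q \<noteq> cell (l + 3) q')"

text \<open>These stand for pairs of a branching cube and a nonempty subcube \<open>m\<close> levels
  down. By nestedness the subcube and \<open>l\<close> determine the cube, so the cube is not
  stored.\<close>

definition branch_cells :: "(nat \<Rightarrow> 'a \<Rightarrow> 'c) \<Rightarrow> 'a set \<Rightarrow> nat \<Rightarrow> (nat \<times> 'c) set" where
  "branch_cells cell P m = {(l, cell (l + m) p) | l p. p \<in> P \<and> branching cell P l p}"

text \<open>Shifting the window by one exchanges one term for another, and each term is at most
  \<open>n\<close>.\<close>

lemma sum_shift_le:
  fixes N :: "nat \<Rightarrow> nat"
  assumes "\<And>l. N l \<le> n"
  shows "(\<Sum>l<L. N (l + m)) \<le> (\<Sum>l<L. N l) + m * n"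
proof (induction m)
  case (Suc m)
  have "(\<Sum>l<L. N (l + Suc m)) + N m = (\<Sum>l<L. N (l + m)) + N (L + m)"
    by (induction L) auto
  then show ?case using Suc assms[of "L + m"] by simp
qed simp

lemma card_image_factor:
  assumes "finite A" and "\<And>x y. x \<in> A \<Longrightarrow> y \<in> A \<Longrightarrow> g x = g y \<Longrightarrow> f x = f y"
  shows "card (f ` A) \<le> card (g ` A)"
proof -
  have "f ` A = (\<lambda>c. f (SOME x. x \<in> A \<and> g x = c)) ` (g ` A)"
  proof -
    have "f x = f (SOME y. y \<in> A \<and> g y = g x)" if "x \<in> A" for x
    proof -
      have "(SOME y. y \<in> A \<and> g y = g x) \<in> A \<and> g (SOME y. y \<in> A \<and> g y = g x) = g x"
        by (rule someI[of _ x]) (use that in auto)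
      then show ?thesis using assms(2) that by metis
    qed
    then show ?thesis by (auto simp: image_image)
  qed
  then show ?thesis using assms(1) by (metis card_image_le finite_imageI)
qed

lemma card_image_ge_double:
  assumes "finite A" and "\<And>x y. x \<in> A \<Longrightarrow> y \<in> A \<Longrightarrow> g x = g y \<Longrightarrow> f x = f y"
    and two: "\<And>x. x \<in> A \<Longrightarrow> \<exists>y\<in>A. \<exists>z\<in>A. f y = f x \<and> f z = f x \<and> g y \<noteq> g z"
  shows "2 * card (f ` A) \<le> card (g ` A)"
proof -
  have "card (g ` A) = card (\<Union>c\<in>f ` A. g ` {x\<in>A. f x = c})"
    by (rule arg_cong[of _ _ card]) auto
  also have "\<dots> = (\<Sum>c\<in>f ` A. card (g ` {x\<in>A. f x = c}))"
  proof (rule card_UN_disjoint)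
    show "\<forall>i\<in>f ` A. \<forall>j\<in>f ` A. i \<noteq> j \<longrightarrow> g ` {x \<in> A. f x = i} \<inter> g ` {x \<in> A. f x = j} = {}"
      using assms(2) by blast
  qed (use assms(1) in auto)
  also have "\<dots> \<ge> (\<Sum>c\<in>f ` A. 2)"
  proof (rule sum_mono)
    fix c assume "c \<in> f ` A"
    then obtain y z where "y \<in> A" "z \<in> A" "f y = c" "f z = c" "g y \<noteq> g z" using two by blast
    then have "{g y, g z} \<subseteq> g ` {x\<in>A. f x = c}" and "card {g y, g z} = 2" by auto
    then show "2 \<le> card (g ` {x\<in>A. f x = c})"
      using card_mono[of "g ` {x\<in>A. f x = c}" "{g y, g z}"] assms(1) by simp
  qed
  finally show ?thesis by (simp add: mult.commute)
qed

text \<open>Let level \<open>l\<close> have b branching and u other nonempty cells, so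
  \<open>N l\<close> = b + u. Three levels down each branching cell has split, giving 2 b + u at
  most \<open>N (l + 3)\<close>; \<open>m\<close> levels down the subcells of branching cells
  together with u are at most \<open>N (l + m)\<close>. Adding gives \<open>key\<close>; summed over
  \<open>l\<close>, everything cancels up to \<open>m + 3\<close> boundary terms. \<open>L\<close>
  only makes the sum finite and drops out, so the bound is independent of the spread of
  \<open>P\<close>.\<close>

lemma card_branch_cells:
  fixes cell :: "nat \<Rightarrow> 'a \<Rightarrow> 'c"
  assumes fin: "finite P"
    and nest: "\<And>l l' p q. p \<in> P \<Longrightarrow> q \<in> P \<Longrightarrow> l \<le> l' \<Longrightarrow> cell l' p = cell l' q \<Longrightarrow> cell l p = cell l q"
    and inj: "\<And>l. L \<le> l \<Longrightarrow> inj_on (cell l) P"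
  shows "finite (branch_cells cell P m)" and "card (branch_cells cell P m) \<le> (m + 3) * card P"
proof -
  define B where "B l = {p\<in>P. branching cell P l p}" for l
  define N where "N l = card (cell l ` P)" for l
  have finB: "finite (B l)" for l using fin by (simp add: B_def)
  have Bemp: "B l = {}" if "L \<le> l" for l
    using inj[OF that] unfolding B_def branching_def inj_on_def by blast
  have Beq: "B l = {p\<in>P. cell l p \<in> cell l ` B l}" for l
    unfolding B_def branching_def by (auto; metis)
  have split: "card (cell l' ` P) = card (cell l' ` B l) + card (cell l' ` (P - B l))" if "l \<le> l'" for l l'
  proof -
    have "cell l' ` P = cell l' ` B l \<union> cell l' ` (P - B l)" using B_def by auto
    moreover have "cell l' ` B l \<inter> cell l' ` (P - B l) = {}"
    proof (rule ccontr)
      assume "\<not> ?thesis"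
      then obtain p q where pq: "p \<in> B l" "q \<in> P" "q \<notin> B l" "cell l' p = cell l' q" by blast
      then have "cell l p = cell l q" using nest[OF _ _ that, of p q] B_def by blast
      then have "cell l q \<in> cell l ` B l" using pq(1) by (metis imageI)
      then show False using pq Beq[of l] by blast
    qed
    ultimately show ?thesis using fin finB by (simp add: card_Un_disjoint)
  qed
  have key: "card (cell (l + m) ` B l) + 2 * N l \<le> N (l + m) + N (l + 3)" for l
  proof -
    have "card (cell l ` (P - B l)) \<le> card (cell l' ` (P - B l))" if "l \<le> l'" for l'
      using fin nest[OF _ _ that] by (intro card_image_factor) auto
    from this[of "l + m"] this[of "l + 3"] have
      c: "card (cell l ` (P - B l)) \<le> card (cell (l + m) ` (P - B l))"
         "card (cell l ` (P - B l)) \<le> card (cell (l + 3) ` (P - B l))" by auto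
    have "2 * card (cell l ` B l) \<le> card (cell (l + 3) ` B l)"
    proof (rule card_image_ge_double[OF finB])
      fix x assume x: "x \<in> B l"
      then obtain q q' where "q \<in> P" "q' \<in> P" "cell l q = cell l x" "cell l q' = cell l x"
        "cell (l + 3) q \<noteq> cell (l + 3) q'" unfolding B_def branching_def by blast
      moreover have "y \<in> B l" if "y \<in> P" "cell l y = cell l x" for y
        using that x Beq[of l] by auto
      ultimately show "\<exists>y\<in>B l. \<exists>z\<in>B l. cell l y = cell l x \<and> cell l z = cell l x \<and> cell (l + 3) y \<noteq> cell (l + 3) z"
        by blast
    next
      fix x y assume "x \<in> B l" "y \<in> B l" "cell (l + 3) x = cell (l + 3) y"
      then show "cell l x = cell l y" using nest[of x y l "l + 3"] B_def by auto
    qed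
    then show ?thesis using c split[of l l] split[of l "l + m"] split[of l "l + 3"]
      unfolding N_def by linarith
  qed
  have eq: "branch_cells cell P m = (\<Union>l<L. Pair l ` cell (l + m) ` B l)"
    (is "_ = ?U")
  proof
    show "branch_cells cell P m \<subseteq> ?U"
    proof
      fix x assume "x \<in> branch_cells cell P m"
      then obtain l p where p: "p \<in> B l" "x = (l, cell (l + m) p)"
        unfolding branch_cells_def B_def by blast
      then have "l < L" using Bemp[of l] by (cases "L \<le> l") auto
      then show "x \<in> ?U" using p by auto
    qed
    show "?U \<subseteq> branch_cells cell P m" unfolding branch_cells_def B_def by auto
  qed
  show "finite (branch_cells cell P m)" unfolding eq using finB by auto
  have Nle: "N l \<le> card P" for l unfolding N_def using fin card_image_le by blast
  have "card (branch_cells cell P m) \<le> (\<Sum>l<L. card (Pair l ` cell (l + m) ` B l))"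
    unfolding eq by (rule card_UN_le) simp
  also have "\<dots> \<le> (\<Sum>l<L. card (cell (l + m) ` B l))"
    by (rule sum_mono) (use finB card_image_le in blast)
  finally have "card (branch_cells cell P m) + 2 * (\<Sum>l<L. N l)
      \<le> (\<Sum>l<L. card (cell (l + m) ` B l) + 2 * N l)"
    by (simp add: sum.distrib sum_distrib_left)
  also have "\<dots> \<le> (\<Sum>l<L. N (l + m) + N (l + 3))" by (rule sum_mono) (rule key)
  also have "\<dots> \<le> ((\<Sum>l<L. N l) + m * card P) + ((\<Sum>l<L. N l) + 3 * card P)"
    unfolding sum.distrib by (intro add_mono sum_shift_le Nle)
  finally show "card (branch_cells cell P m) \<le> (m + 3) * card P" by (simp add: algebra_simps)
qed

section \<open>Spanners from nested partitions\<close>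

lemma real_card_UN_le:
  assumes "finite I" "\<And>i. i \<in> I \<Longrightarrow> real (card (A i)) \<le> K"
  shows "real (card (\<Union>i\<in>I. A i)) \<le> K * real (card I)"
proof -
  have "real (card (\<Union>i\<in>I. A i)) \<le> real (\<Sum>i\<in>I. card (A i))"
    using card_UN_le[OF assms(1)] of_nat_le_iff by blast
  also have "\<dots> \<le> (\<Sum>i\<in>I. K)" unfolding of_nat_sum by (rule sum_mono) (rule assms(2))
  finally show ?thesis by (simp add: mult.commute)
qed

text \<open>Combinatorial core common to the three geometries. Cells marked \<open>low\<close> are
  entered through anchors \<open>m\<close> levels down, the others through representatives
  \<open>M\<close> levels down. \<open>chain\<close> and \<open>chain_end\<close> bound hops by
  differences of a potential (\<open>H\<close> on levels, \<open>h\<close> on points), so a descent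
  has the same total bound whichever levels it skips.\<close>

locale cell_hierarchy =
  fixes X :: "'a set" and \<delta> :: "'a \<Rightarrow> 'a \<Rightarrow> real" and P :: "'a set"
    and Sg :: "'s set" and cell :: "'s \<Rightarrow> nat \<Rightarrow> 'a \<Rightarrow> 'c"
    and S :: "'s \<Rightarrow> nat \<Rightarrow> 'c \<Rightarrow> 'a set"
    and low :: "'s \<Rightarrow> nat \<Rightarrow> 'c \<Rightarrow> bool" and anchor :: "'s \<Rightarrow> nat \<Rightarrow> 'c \<Rightarrow> 'a"
    and H :: "nat \<Rightarrow> real" and h :: "'a \<Rightarrow> real" and m M L :: nat and K \<epsilon> :: real
  assumes fin: "finite P" and PX: "P \<subseteq> X" and finSg: "finite Sg"
    and sym: "\<And>x y. \<delta> x y = \<delta> y x"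
    and nonneg: "\<And>x y. x \<in> X \<Longrightarrow> y \<in> X \<Longrightarrow> 0 \<le> \<delta> x y"
    and nest: "\<And>\<sigma> l l' p q. \<sigma> \<in> Sg \<Longrightarrow> p \<in> P \<Longrightarrow> q \<in> P \<Longrightarrow> l \<le> l' \<Longrightarrow>
        cell \<sigma> l' p = cell \<sigma> l' q \<Longrightarrow> cell \<sigma> l p = cell \<sigma> l q"
    and inj: "\<And>\<sigma> l. \<sigma> \<in> Sg \<Longrightarrow> L \<le> l \<Longrightarrow> inj_on (cell \<sigma> l) P"
    and SX: "\<And>\<sigma> l p. \<sigma> \<in> Sg \<Longrightarrow> p \<in> P \<Longrightarrow> S \<sigma> l (cell \<sigma> l p) \<subseteq> X"
    and finS: "\<And>\<sigma> l p. \<sigma> \<in> Sg \<Longrightarrow> p \<in> P \<Longrightarrow> finite (S \<sigma> l (cell \<sigma> l p))"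
    and cardS: "\<And>\<sigma> l p. \<sigma> \<in> Sg \<Longrightarrow> p \<in> P \<Longrightarrow> real (card (S \<sigma> l (cell \<sigma> l p))) \<le> K"
    and K1: "1 \<le> K" and mM: "m \<le> M" and eps: "0 \<le> \<epsilon>"
    and anchorX: "\<And>\<sigma> l c. anchor \<sigma> l c \<in> X"
    and chain: "\<And>\<sigma> l l' p. \<sigma> \<in> Sg \<Longrightarrow> p \<in> P \<Longrightarrow> l < l' \<Longrightarrow> low \<sigma> l' (cell \<sigma> l' p) \<Longrightarrow>
        \<delta> (anchor \<sigma> l (cell \<sigma> l p)) (anchor \<sigma> l' (cell \<sigma> l' p)) \<le> H l - H l'"
    and chain_end: "\<And>\<sigma> l p. \<sigma> \<in> Sg \<Longrightarrow> p \<in> P \<Longrightarrow> low \<sigma> l (cell \<sigma> l p) \<Longrightarrow>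
        \<delta> (anchor \<sigma> l (cell \<sigma> l p)) p \<le> H l - h p"
begin

text \<open>The cost of travelling from a Steiner point \<open>s\<close> of the level \<open>l\<close> cell of \<open>p\<close> to \<open>p\<close>: either down
  the chain of anchors, or through the representative of the level \<open>l + M\<close> cell.\<close>
definition leg :: "'s \<Rightarrow> nat \<Rightarrow> 'a \<Rightarrow> 'a \<Rightarrow> real \<Rightarrow> real \<Rightarrow> bool" where
  "leg \<sigma> l s p D A \<longleftrightarrow>
     (low \<sigma> (l + m) (cell \<sigma> (l + m) p) \<and>
        \<delta> s (anchor \<sigma> (l + m) (cell \<sigma> (l + m) p)) + (H (l + m) - h p) \<le> A) \<or>
     (\<forall>p'\<in>P. cell \<sigma> (l + M) p' = cell \<sigma> (l + M) p \<longrightarrow>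
        \<delta> s p' + (1 + \<epsilon>) * \<delta> p' p \<le> A \<and> \<delta> p' p < D)"

definition rep :: "'s \<Rightarrow> nat \<Rightarrow> 'c \<Rightarrow> 'a" where
  "rep \<sigma> l c = (SOME p. p \<in> P \<and> cell \<sigma> l p = c)"

text \<open>The levels at which the anchor chain of \<open>p\<close> can be entered from a net
  point. Using no other levels keeps the number of chain links below the number of branch
  cells.\<close>

definition levels :: "'s \<Rightarrow> 'a \<Rightarrow> nat set" where
  "levels \<sigma> p = {l'. \<exists>l. l' = l + m \<and> branching (cell \<sigma>) P l p \<and> low \<sigma> l' (cell \<sigma> l' p)}"

abbreviation "J \<sigma> k \<equiv> branch_cells (cell \<sigma>) P k"

text \<open>Links an anchor to the next coarser one of the same chain. At the top of a chain
  \<open>Max {}\<close> is an unspecified number; the resulting pair still lies in \<open>X\<close>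
  and merely counts as one edge.\<close>

definition "up_edge \<sigma> l c = (let p = rep \<sigma> l c; l' = Max {k \<in> levels \<sigma> p. k < l}
   in (anchor \<sigma> l' (cell \<sigma> l' p), anchor \<sigma> l c))"

text \<open>\<open>R1\<close> and \<open>R2\<close> serve the second and the first alternative of
  \<open>leg\<close>; \<open>R3\<close> and \<open>R4\<close> are the inner links and the final hop
  of the anchor chains.\<close>

definition "R1 \<sigma> = (\<Union>(l, c)\<in>J \<sigma> M. S \<sigma> l (cell \<sigma> l (rep \<sigma> (l + M) c)) \<times> {rep \<sigma> (l + M) c})"
definition "R2 \<sigma> = (\<Union>(l, c)\<in>J \<sigma> m. S \<sigma> l (cell \<sigma> l (rep \<sigma> (l + m) c)) \<times> {anchor \<sigma> (l + m) c})"
definition "R3 \<sigma> = (\<lambda>(l, c). up_edge \<sigma> (l + m) c) ` J \<sigma> m"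
definition "R4 \<sigma> = (\<lambda>p. (anchor \<sigma> (Max (levels \<sigma> p)) (cell \<sigma> (Max (levels \<sigma> p)) p), p)) ` P"
definition "R = (\<Union>\<sigma>\<in>Sg. R1 \<sigma> \<union> R2 \<sigma> \<union> R3 \<sigma> \<union> R4 \<sigma>)"

lemma rep: "p \<in> P \<Longrightarrow> rep \<sigma> l (cell \<sigma> l p) \<in> P \<and> cell \<sigma> l (rep \<sigma> l (cell \<sigma> l p)) = cell \<sigma> l p"
  unfolding rep_def by (rule someI[of _ p]) auto

lemma J_cases:
  assumes "(l, c) \<in> J \<sigma> k"
  obtains p where "p \<in> P" "c = cell \<sigma> (l + k) p" "branching (cell \<sigma>) P l p"
  using assms unfolding branch_cells_def by blast

lemma finJ: "\<sigma> \<in> Sg \<Longrightarrow> finite (J \<sigma> k)" and cardJ: "\<sigma> \<in> Sg \<Longrightarrow> card (J \<sigma> k) \<le> (k + 3) * card P"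
  using card_branch_cells[OF fin, of "cell \<sigma>" L] nest inj by blast+

lemma card_star:
  assumes \<sigma>: "\<sigma> \<in> Sg"
  shows "finite (\<Union>(l, c)\<in>J \<sigma> k. S \<sigma> l (cell \<sigma> l (rep \<sigma> (l + k) c)) \<times> {f l c})" (is "finite ?U")
    and "real (card (\<Union>(l, c)\<in>J \<sigma> k. S \<sigma> l (cell \<sigma> l (rep \<sigma> (l + k) c)) \<times> {f l c}))
      \<le> K * (real (k + 3) * real (card P))"
proof -
  have one: "finite (S \<sigma> l (cell \<sigma> l (rep \<sigma> (l + k) c)))"
    "real (card (S \<sigma> l (cell \<sigma> l (rep \<sigma> (l + k) c)))) \<le> K" if "(l, c) \<in> J \<sigma> k" for l c
    using that rep[of _ \<sigma> "l + k"] finS[OF \<sigma>] cardS[OF \<sigma>] by (auto elim!: J_cases)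
  show "finite ?U" using one finJ[OF \<sigma>] by (intro finite_UN_I) auto
  have "real (card ?U) \<le> K * real (card (J \<sigma> k))"
    by (rule real_card_UN_le[OF finJ[OF \<sigma>]]) (use one in \<open>auto simp: card_cartesian_product\<close>)
  also have "\<dots> \<le> K * (real (k + 3) * real (card P))"
    using of_nat_mono[OF cardJ[OF \<sigma>, of k], where 'a = real] K1 by (intro mult_left_mono) simp_all
  finally show "real (card ?U) \<le> K * (real (k + 3) * real (card P))" .
qed

lemma finite_R: "finite R" and card_R: "real (card R) \<le> real (card Sg) * (4 * K * real (M + 3) * real (card P))"
proof -
  let ?Q = "\<lambda>\<sigma>. R1 \<sigma> \<union> R2 \<sigma> \<union> R3 \<sigma> \<union> R4 \<sigma>"
  have 1: "finite (R1 \<sigma>)" "finite (R2 \<sigma>)" "finite (R3 \<sigma>)" "finite (R4 \<sigma>)" if "\<sigma> \<in> Sg" for \<sigma>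
    unfolding R1_def R2_def R3_def R4_def by (intro card_star(1)[OF that] finite_imageI finJ[OF that] fin)+
  then show "finite R" unfolding R_def using finSg by auto
  have 2: "real (card (?Q \<sigma>)) \<le> 4 * K * real (M + 3) * real (card P)" if s: "\<sigma> \<in> Sg" for \<sigma>
  proof -
    let ?n = "real (card P)"
    have a: "real (card (R1 \<sigma>)) \<le> K * (real (M + 3) * ?n)"
      unfolding R1_def by (rule card_star(2)[OF s])
    have "real (card (R2 \<sigma>)) \<le> K * (real (m + 3) * ?n)"
      unfolding R2_def by (rule card_star(2)[OF s])
    also have "\<dots> \<le> K * (real (M + 3) * ?n)"
      using mM K1 by (intro mult_left_mono mult_right_mono) auto
    finally have b: "real (card (R2 \<sigma>)) \<le> K * (real (M + 3) * ?n)" .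
    have "card (R3 \<sigma>) \<le> (m + 3) * card P"
      unfolding R3_def using cardJ[OF s, of m] card_image_le[OF finJ[OF s]] order_trans by blast
    also have "\<dots> \<le> (M + 3) * card P" using mM by simp
    finally have "real (card (R3 \<sigma>)) \<le> 1 * (real (M + 3) * ?n)"
      using of_nat_mono[of "card (R3 \<sigma>)" _, where 'a = real] by fastforce
    also have "\<dots> \<le> K * (real (M + 3) * ?n)" using K1 by (intro mult_right_mono) auto
    finally have c: "real (card (R3 \<sigma>)) \<le> K * (real (M + 3) * ?n)" .
    have "real (card (R4 \<sigma>)) \<le> 1 * (1 * ?n)"
      unfolding R4_def using card_image_le[OF fin] by simp
    also have "\<dots> \<le> K * (real (M + 3) * ?n)" using K1 by (intro mult_mono) auto
    finally have d: "real (card (R4 \<sigma>)) \<le> K * (real (M + 3) * ?n)" .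
    have "card (?Q \<sigma>) \<le> card (R1 \<sigma>) + card (R2 \<sigma>) + card (R3 \<sigma>) + card (R4 \<sigma>)"
      by (meson add_mono card_Un_le le_refl order_trans)
    then show ?thesis using a b c d by simp
  qed
  have "real (card R) \<le> (4 * K * real (M + 3) * real (card P)) * real (card Sg)"
    unfolding R_def by (rule real_card_UN_le[OF finSg 2])
  then show "real (card R) \<le> real (card Sg) * (4 * K * real (M + 3) * real (card P))" by (simp only: mult.commute)
qed

lemma R_subset: "R \<subseteq> X \<times> X"
proof -
  have st: "S \<sigma> l (cell \<sigma> l (rep \<sigma> (l + k) c)) \<subseteq> X" "rep \<sigma> (l + k) c \<in> X"
    if "\<sigma> \<in> Sg" "(l, c) \<in> J \<sigma> k" for \<sigma> k l c
    using that rep[of _ \<sigma> "l + k"] SX[OF that(1)] PX by (auto elim!: J_cases)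
  have "R1 \<sigma> \<subseteq> X \<times> X" "R2 \<sigma> \<subseteq> X \<times> X" if "\<sigma> \<in> Sg" for \<sigma>
    unfolding R1_def R2_def using st[OF that] anchorX by blast+
  moreover have "R3 \<sigma> \<subseteq> X \<times> X" "R4 \<sigma> \<subseteq> X \<times> X" for \<sigma>
    unfolding R3_def R4_def up_edge_def Let_def using anchorX PX by auto
  ultimately show ?thesis unfolding R_def by blast
qed

lemma finite_levels: "\<sigma> \<in> Sg \<Longrightarrow> p \<in> P \<Longrightarrow> finite (levels \<sigma> p)"
proof -
  assume s: "\<sigma> \<in> Sg" "p \<in> P"
  have "levels \<sigma> p \<subseteq> (\<lambda>(l, c). l + m) ` J \<sigma> m"
    unfolding levels_def branch_cells_def using s(2) by force
  then show ?thesis using finJ[OF s(1)] finite_surj by blast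
qed

text \<open>Makes \<open>up_edge\<close> independent of the representative: all points of a cell
  agree on the chain levels down to that cell.\<close>

lemma levels_cong:
  assumes "\<sigma> \<in> Sg" "p \<in> P" "q \<in> P" "cell \<sigma> l p = cell \<sigma> l q" "k \<le> l"
  shows "k \<in> levels \<sigma> p \<longleftrightarrow> k \<in> levels \<sigma> q"
proof -
  have "cell \<sigma> j p = cell \<sigma> j q" if "j \<le> l" for j using nest[OF assms(1-3) that assms(4)] .
  then have "cell \<sigma> k p = cell \<sigma> k q" and "k = i + m \<Longrightarrow> cell \<sigma> i p = cell \<sigma> i q" for i
    using assms(5) by auto
  then have "low \<sigma> k (cell \<sigma> k p) = low \<sigma> k (cell \<sigma> k q)"
    and "k = i + m \<Longrightarrow> branching (cell \<sigma>) P i p = branching (cell \<sigma>) P i q" for i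
    unfolding branching_def by metis+
  then show ?thesis unfolding levels_def by blast
qed

text \<open>Descend from each chain level to the next finer one; the bounds \<open>H l - H k\<close>
  and \<open>H k - h p\<close> telescope. The last level is served by \<open>R4\<close>.\<close>

lemma conn_anchor:
  assumes \<sigma>: "\<sigma> \<in> Sg" and p: "p \<in> P"
  shows "l \<in> levels \<sigma> p \<Longrightarrow> conn \<delta> R (anchor \<sigma> l (cell \<sigma> l p)) p (H l - h p)"
proof (induction "Max (levels \<sigma> p) - l" arbitrary: l rule: less_induct)
  case less
  let ?L = "levels \<sigma> p"
  have lowl: "low \<sigma> k (cell \<sigma> k p)" if "k \<in> ?L" for k using that levels_def by auto
  have le: "l \<le> Max ?L" using less.prems finite_levels[OF \<sigma> p] by simp
  show ?case
  proof (cases "l = Max ?L")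
    case True
    then have "(anchor \<sigma> l (cell \<sigma> l p), p) \<in> R4 \<sigma>" unfolding R4_def using p by auto
    then have "(anchor \<sigma> l (cell \<sigma> l p), p) \<in> R" unfolding R_def using \<sigma> by blast
    then show ?thesis using chain_end[OF \<sigma> p] lowl[OF less.prems] conn_edge by metis
  next
    case False
    let ?U = "{k\<in>?L. l < k}"
    have finU: "finite ?U" using finite_levels[OF \<sigma> p] by simp
    have "Max ?L \<in> ?U" using False le less.prems Max_in[OF finite_levels[OF \<sigma> p]] by fastforce
    then have neU: "?U \<noteq> {}" by blast
    define k where "k = Min ?U"
    have kU: "k \<in> ?U" unfolding k_def using finU neU by (rule Min_in)
    have kmin: "k \<le> j" if "j \<in> ?L" "l < j" for j unfolding k_def using that finU by simp
    let ?q = "rep \<sigma> k (cell \<sigma> k p)"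
    have q: "?q \<in> P" "cell \<sigma> k ?q = cell \<sigma> k p" using rep[OF p] by auto
    have ql: "cell \<sigma> l ?q = cell \<sigma> l p" using nest[OF \<sigma> q(1) p _ q(2)] kU by simp
    \<comment> \<open>\<open>up_edge\<close> looks upwards from the representative of the level
      \<open>k\<close> cell. It sees the same coarser levels as \<open>p\<close>, and
      \<open>l\<close> is the last of them because \<open>k\<close> is the next one after
      \<open>l\<close>.\<close>
    have eq: "{j \<in> levels \<sigma> ?q. j < k} = {j \<in> ?L. j < k}"
      using levels_cong[OF \<sigma> q(1) p q(2)] by auto
    have mx: "Max {j \<in> levels \<sigma> ?q. j < k} = l"
    proof (rule Max_eqI)
      show "finite {j \<in> levels \<sigma> ?q. j < k}" by simp
      show "j \<le> l" if "j \<in> {j \<in> levels \<sigma> ?q. j < k}" for j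
        using that kmin[of j] unfolding eq by (cases "l < j") auto
      show "l \<in> {j \<in> levels \<sigma> ?q. j < k}" unfolding eq using less.prems kU by simp
    qed
    have "up_edge \<sigma> k (cell \<sigma> k p) = (anchor \<sigma> l (cell \<sigma> l p), anchor \<sigma> k (cell \<sigma> k p))"
      unfolding up_edge_def Let_def mx ql ..
    moreover obtain i where i: "k = i + m" "branching (cell \<sigma>) P i p"
      using kU unfolding levels_def by blast
    then have "(i, cell \<sigma> (i + m) p) \<in> J \<sigma> m" unfolding branch_cells_def using p by blast
    then have "up_edge \<sigma> k (cell \<sigma> k p) \<in> R3 \<sigma>" unfolding R3_def i(1) by force
    ultimately have "(anchor \<sigma> l (cell \<sigma> l p), anchor \<sigma> k (cell \<sigma> k p)) \<in> R"
      unfolding R_def using \<sigma> by auto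
    then have "conn \<delta> R (anchor \<sigma> l (cell \<sigma> l p)) (anchor \<sigma> k (cell \<sigma> k p)) (H l - H k)"
      using chain[OF \<sigma> p, of l k] lowl[of k] kU by (intro conn_edge) auto
    moreover have "conn \<delta> R (anchor \<sigma> k (cell \<sigma> k p)) p (H k - h p)"
    proof (rule less.hyps)
      have "k \<le> Max ?L" using kU finite_levels[OF \<sigma> p] by simp
      then show "Max ?L - k < Max ?L - l" using kU by auto
      show "k \<in> ?L" using kU by simp
    qed
    ultimately show ?thesis using conn_trans by fastforce
  qed
qed

text \<open>\<open>IH\<close> is the induction hypothesis of \<open>conn_pairs\<close>; it is needed
  only for the gap between \<open>p\<close> and the representative of its subcell, which
  \<open>leg\<close> guarantees to be shorter than \<open>D\<close>.\<close>

lemma conn_leg: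
  assumes \<sigma>: "\<sigma> \<in> Sg" and p: "p \<in> P" and br: "branching (cell \<sigma>) P l p"
    and s: "s \<in> S \<sigma> l (cell \<sigma> l p)" and lg: "leg \<sigma> l s p D A"
    and IH: "\<And>p'. p' \<in> P \<Longrightarrow> \<delta> p' p < D \<Longrightarrow> conn \<delta> R p' p ((1 + \<epsilon>) * \<delta> p' p)"
  shows "conn \<delta> R s p A"
proof -
  have star: "(l, cell \<sigma> (l + k) p) \<in> J \<sigma> k" "cell \<sigma> l (rep \<sigma> (l + k) (cell \<sigma> (l + k) p)) = cell \<sigma> l p" for k
    using p br rep[OF p, of \<sigma> "l + k"] nest[OF \<sigma> _ p, of "rep \<sigma> (l + k) (cell \<sigma> (l + k) p)" l "l + k"]
    unfolding branch_cells_def by (blast, simp)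
  from lg show ?thesis unfolding leg_def
  proof
    let ?z = "anchor \<sigma> (l + m) (cell \<sigma> (l + m) p)"
    assume a: "low \<sigma> (l + m) (cell \<sigma> (l + m) p) \<and> \<delta> s ?z + (H (l + m) - h p) \<le> A"
    have "(s, ?z) \<in> R2 \<sigma>" unfolding R2_def using star[of m] s by force
    then have "conn \<delta> R s ?z (\<delta> s ?z)" unfolding R_def using \<sigma> by (intro conn_edge) auto
    moreover have "l + m \<in> levels \<sigma> p" unfolding levels_def using a br by blast
    ultimately show ?thesis using conn_trans_le[OF _ conn_anchor[OF \<sigma> p]] a by blast
  next
    let ?p = "rep \<sigma> (l + M) (cell \<sigma> (l + M) p)"
    assume a: "\<forall>p'\<in>P. cell \<sigma> (l + M) p' = cell \<sigma> (l + M) p \<longrightarrow>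
        \<delta> s p' + (1 + \<epsilon>) * \<delta> p' p \<le> A \<and> \<delta> p' p < D"
    have "(s, ?p) \<in> R1 \<sigma>" unfolding R1_def using star[of M] s by force
    then have "conn \<delta> R s ?p (\<delta> s ?p)" unfolding R_def using \<sigma> by (intro conn_edge) auto
    moreover have "\<delta> s ?p + (1 + \<epsilon>) * \<delta> ?p p \<le> A" "\<delta> ?p p < D" "?p \<in> P"
      using a rep[OF p, of \<sigma> "l + M"] by blast+
    ultimately show ?thesis using conn_trans_le[OF _ IH] by blast
  qed
qed

text \<open>Induction on a real distance is made well-founded by ranking a pair by the number of
  pairs of \<open>P\<close> that are strictly closer.\<close>

lemma conn_pairs:
  assumes pair: "\<And>p q. p \<in> P \<Longrightarrow> q \<in> P \<Longrightarrow> p \<noteq> q \<Longrightarrow>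
      \<exists>\<sigma>\<in>Sg. \<exists>l. \<exists>s\<in>S \<sigma> l (cell \<sigma> l p). \<exists>A B. cell \<sigma> l p = cell \<sigma> l q \<and> cell \<sigma> (l + 3) p \<noteq> cell \<sigma> (l + 3) q \<and>
        leg \<sigma> l s p (\<delta> p q) A \<and> leg \<sigma> l s q (\<delta> p q) B \<and> A + B \<le> (1 + \<epsilon>) * \<delta> p q"
  shows "p \<in> P \<Longrightarrow> q \<in> P \<Longrightarrow> conn \<delta> R p q ((1 + \<epsilon>) * \<delta> p q)"
proof (induction "card {(x, y) \<in> P \<times> P. \<delta> x y < \<delta> p q}" arbitrary: p q rule: less_induct)
  case less
  show ?case
  proof (cases "p = q")
    case True
    have "0 \<le> \<delta> p q" using nonneg less.prems PX by blast
    then show ?thesis unfolding True using eps by (intro conn_refl) simp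
  next
    case False
    have IH: "conn \<delta> R x y ((1 + \<epsilon>) * \<delta> x y)" if "x \<in> P" "y \<in> P" "\<delta> x y < \<delta> p q" for x y
    proof (rule less.hyps)
      show "card {(x', y') \<in> P \<times> P. \<delta> x' y' < \<delta> x y} < card {(x, y) \<in> P \<times> P. \<delta> x y < \<delta> p q}"
      proof (rule psubset_card_mono)
        show "finite {(x, y) \<in> P \<times> P. \<delta> x y < \<delta> p q}"
          by (rule finite_subset[of _ "P \<times> P"]) (use fin in auto)
        have "(x, y) \<in> {(x, y) \<in> P \<times> P. \<delta> x y < \<delta> p q}" using that by simp
        moreover have "(x, y) \<notin> {(x', y') \<in> P \<times> P. \<delta> x' y' < \<delta> x y}" by simp
        moreover have "{(x', y') \<in> P \<times> P. \<delta> x' y' < \<delta> x y} \<subseteq> {(x, y) \<in> P \<times> P. \<delta> x y < \<delta> p q}"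
          using that(3) by auto
        ultimately show "{(x', y') \<in> P \<times> P. \<delta> x' y' < \<delta> x y} \<subset> {(x, y) \<in> P \<times> P. \<delta> x y < \<delta> p q}" by blast
      qed
    qed (use that in auto)
    obtain \<sigma> l s A B where o: "\<sigma> \<in> Sg" "s \<in> S \<sigma> l (cell \<sigma> l p)" "cell \<sigma> l p = cell \<sigma> l q"
      "cell \<sigma> (l + 3) p \<noteq> cell \<sigma> (l + 3) q" "leg \<sigma> l s p (\<delta> p q) A" "leg \<sigma> l s q (\<delta> p q) B"
      "A + B \<le> (1 + \<epsilon>) * \<delta> p q" using pair[OF less.prems False] by blast
    have br: "branching (cell \<sigma>) P l x" if "cell \<sigma> l p = cell \<sigma> l x" for x
    proof -
      have "cell \<sigma> l p = cell \<sigma> l x \<and> cell \<sigma> l q = cell \<sigma> l x \<and> cell \<sigma> (l + 3) p \<noteq> cell \<sigma> (l + 3) q"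
        using that o(3,4) by simp
      then show ?thesis unfolding branching_def using less.prems by blast
    qed
    have "conn \<delta> R s p A"
      by (rule conn_leg[OF o(1) less.prems(1) br[OF refl] o(2,5) IH]) (use less.prems in auto)
    then have "conn \<delta> R p s A" by (rule conn_sym[OF sym])
    moreover have "conn \<delta> R s q B"
      by (rule conn_leg[OF o(1) less.prems(2) br[OF o(3)] _ o(6) IH]) (use less.prems o(2,3) in auto)
    ultimately show ?thesis using o(7) by (rule conn_trans_le)
  qed
qed

end

section \<open>Shifted dyadic cubes\<close>

text \<open>\<open>\<sigma>\<close> is the set of coordinates whose grid is shifted by
  \<open>W\<close> / 3. The shift is the same at all levels, which keeps cells nested. Entries from
  \<open>N\<close> on are 0 so that equality of cells is equality of functions.\<close>

definition dyadic_cell :: "nat \<Rightarrow> real \<Rightarrow> nat set \<Rightarrow> nat \<Rightarrow> (nat \<Rightarrow> real) \<Rightarrow> (nat \<Rightarrow> int)" where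
  "dyadic_cell N W \<sigma> l p =
     (\<lambda>i. if i < N then \<lfloor>2 ^ l * (p i / W + (if i \<in> \<sigma> then 1 / 3 else 0))\<rfloor> else 0)"

definition corner :: "real \<Rightarrow> nat set \<Rightarrow> nat \<Rightarrow> (nat \<Rightarrow> int) \<Rightarrow> (nat \<Rightarrow> real)" where
  "corner W \<sigma> l c = (\<lambda>i. W / 2 ^ l * of_int (c i) - (if i \<in> \<sigma> then W / 3 else 0))"

lemma corner_bounds:
  assumes "0 < W" "i < N"
  shows "corner W \<sigma> l (dyadic_cell N W \<sigma> l p) i \<le> p i"
    and "p i < corner W \<sigma> l (dyadic_cell N W \<sigma> l p) i + W / 2 ^ l"
proof -
  define sh :: real where "sh = (if i \<in> \<sigma> then 1 / 3 else 0)"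
  define k where "k = \<lfloor>2 ^ l * (p i / W + sh)\<rfloor>"
  have c: "corner W \<sigma> l (dyadic_cell N W \<sigma> l p) i = W / 2 ^ l * of_int k - W * sh"
    unfolding corner_def dyadic_cell_def k_def sh_def using assms(2) by simp
  have w: "0 < W / 2 ^ l" using assms(1) by simp
  have e: "W / 2 ^ l * (2 ^ l * (p i / W + sh)) = p i + W * sh"
    using assms(1) by (simp add: field_simps)
  have "of_int k \<le> 2 ^ l * (p i / W + sh)" "2 ^ l * (p i / W + sh) < of_int k + 1"
    unfolding k_def by linarith+
  from mult_left_mono[OF this(1) less_imp_le[OF w]] mult_strict_left_mono[OF this(2) w]
  show "corner W \<sigma> l (dyadic_cell N W \<sigma> l p) i \<le> p i"
    "p i < corner W \<sigma> l (dyadic_cell N W \<sigma> l p) i + W / 2 ^ l"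
    unfolding c e by (simp_all add: distrib_left)
qed

definition in_box :: "nat \<Rightarrow> (nat \<Rightarrow> real) \<Rightarrow> real \<Rightarrow> (nat \<Rightarrow> real) \<Rightarrow> bool" where
  "in_box N o' w p \<longleftrightarrow> (\<forall>j<N. o' j \<le> p j \<and> p j < o' j + w)"

lemma in_box_corner: "0 < W \<Longrightarrow> in_box N (corner W \<sigma> l (dyadic_cell N W \<sigma> l p)) (W / 2 ^ l) p"
  unfolding in_box_def using corner_bounds by blast

lemma dyadic_cell_close:
  assumes "0 < W" "i < N" "dyadic_cell N W \<sigma> l p = dyadic_cell N W \<sigma> l q"
  shows "\<bar>p i - q i\<bar> < W / 2 ^ l"
  using corner_bounds[OF assms(1,2), where \<sigma> = \<sigma> and l = l and p = p]
    corner_bounds[OF assms(1,2), where \<sigma> = \<sigma> and l = l and p = q] assms(3) by simp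

lemma floor_dyadic:
  fixes x :: real
  shows "\<lfloor>2 ^ l * x\<rfloor> = \<lfloor>2 ^ (l + k) * x\<rfloor> div 2 ^ k"
proof -
  have "2 ^ l * x = 2 ^ (l + k) * x / real_of_int (2 ^ k)" by (simp add: power_add)
  then show ?thesis by (simp only: floor_divide_real_eq_div[of "2 ^ k"] zero_le_power zero_le_numeral)
qed

lemma dyadic_cell_nested:
  assumes "l \<le> l'" "dyadic_cell N W \<sigma> l' p = dyadic_cell N W \<sigma> l' q"
  shows "dyadic_cell N W \<sigma> l p = dyadic_cell N W \<sigma> l q"
proof
  fix i
  obtain k where k: "l' = l + k" using assms(1) le_Suc_ex by blast
  show "dyadic_cell N W \<sigma> l p i = dyadic_cell N W \<sigma> l q i"
    using fun_cong[OF assms(2), of i] unfolding dyadic_cell_def k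
    by (auto simp: floor_dyadic[of l _ k])
qed

lemma dyadic_cell_differ:
  assumes "0 < W" "i < N" "W / 2 ^ l \<le> \<bar>p i - q i\<bar>"
  shows "dyadic_cell N W \<sigma> l p \<noteq> dyadic_cell N W \<sigma> l q"
  using dyadic_cell_close[OF assms(1,2), of \<sigma> l p q] assms(3) by fastforce

lemma pow2_mod_3: "\<exists>k::int. (2::real) ^ l / 3 = of_int k + 1 / 3 \<or> (2::real) ^ l / 3 = of_int k + 2 / 3"
proof (induction l)
  case 0
  show ?case by (rule exI[of _ 0]) simp
next
  case (Suc l)
  then obtain k :: int where "(2::real) ^ l / 3 = of_int k + 1 / 3 \<or> (2::real) ^ l / 3 = of_int k + 2 / 3" by blast
  then have "(2::real) ^ Suc l / 3 = of_int (2 * k) + 2 / 3 \<or> (2::real) ^ Suc l / 3 = of_int (2 * k + 1) + 1 / 3"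
    by auto
  then show ?case by blast
qed

text \<open>If an integer separates two numbers that differ by at most 1 / 3, a shift by 1 / 3 or 2
  / 3 modulo 1 brings both into one unit interval. As 3 does not divide a power of 2, the fixed
  shift 1 / 3, scaled to any level, is of this kind; so two offsets per coordinate suffice for all
  levels.\<close>

lemma floor_third_shift:
  fixes a b :: real
  assumes "\<bar>a - b\<bar> \<le> 1 / 3"
  shows "\<lfloor>a\<rfloor> = \<lfloor>b\<rfloor> \<or> \<lfloor>a + 2 ^ l / 3\<rfloor> = \<lfloor>b + 2 ^ l / 3\<rfloor>"
proof -
  obtain k :: int where k: "(2::real) ^ l / 3 = of_int k + 1 / 3 \<or> (2::real) ^ l / 3 = of_int k + 2 / 3"
    using pow2_mod_3 by blast
  have *: "\<lfloor>a\<rfloor> = \<lfloor>b\<rfloor> \<or> \<lfloor>a + t\<rfloor> = \<lfloor>b + t\<rfloor>"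
    if ab: "a \<le> b" "b - a \<le> 1 / 3" and t: "t = of_int k + 1 / 3 \<or> t = of_int k + 2 / 3" for a b t :: real
  proof (cases "\<lfloor>a\<rfloor> = \<lfloor>b\<rfloor>")
    case False
    let ?n = "\<lfloor>b\<rfloor>"
    have "\<lfloor>a\<rfloor> < ?n" using False ab(1) floor_mono[of a b] by linarith
    then have "a < of_int ?n" by (simp add: floor_less_iff)
    moreover have "of_int ?n \<le> b" by (rule of_int_floor_le)
    ultimately have "of_int (?n + k) \<le> a + t" "a + t < of_int (?n + k) + 1"
      "of_int (?n + k) \<le> b + t" "b + t < of_int (?n + k) + 1"
      unfolding of_int_add using ab t by argo+
    then have "\<lfloor>a + t\<rfloor> = ?n + k" "\<lfloor>b + t\<rfloor> = ?n + k"
      unfolding floor_eq_iff by simp_all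
    then show ?thesis by simp
  qed simp
  show ?thesis using *[of a b] *[of b a] k assms by (cases "a \<le> b") fastforce+
qed

text \<open>Take the least level at which some difference exceeds a sixth of the side. Failure at
  the preceding level, whose side is twice as long, is the upper bound by a third; at level 0 that
  bound is the hypothesis \<open>le\<close>.\<close>

lemma dyadic_scale:
  fixes W :: real
  assumes W: "0 < W" and ne: "\<exists>i<N. p i \<noteq> q i" and le: "\<And>i. i < N \<Longrightarrow> \<bar>p i - q i\<bar> \<le> W / 3"
  obtains l :: nat where "\<And>i. i < N \<Longrightarrow> \<bar>p i - q i\<bar> \<le> W / 2 ^ l / 3"
    and "\<exists>i<N. W / 2 ^ l / 6 < \<bar>p i - q i\<bar>"
proof -
  obtain i where i: "i < N" "p i \<noteq> q i" using ne by blast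
  let ?Q = "\<lambda>l. \<exists>i<N. W / 2 ^ l / 6 < \<bar>p i - q i\<bar>"
  have "?Q (LEAST l. ?Q l)"
  proof (rule LeastI_ex)
    have "0 < \<bar>p i - q i\<bar> / W" using i W by (intro divide_pos_pos) simp_all
    then obtain l where "(1 / 2 :: real) ^ l < \<bar>p i - q i\<bar> / W" using real_arch_pow_inv[of _ "1/2"] by auto
    then have "W / 2 ^ l < \<bar>p i - q i\<bar>" using W by (simp add: field_simps power_one_over)
    moreover have "W / 2 ^ l / 6 \<le> W / 2 ^ l" using W by (simp add: field_simps)
    ultimately show "\<exists>l. ?Q l" using i(1) by (meson le_less_trans)
  qed
  moreover have "\<bar>p j - q j\<bar> \<le> W / 2 ^ (LEAST l. ?Q l) / 3" if "j < N" for j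
  proof (cases "LEAST l. ?Q l")
    case 0
    then show ?thesis using le[OF that] by simp
  next
    case (Suc k)
    then have "\<not> ?Q k" using not_less_Least[of k ?Q] by simp
    then have "\<bar>p j - q j\<bar> \<le> W / 2 ^ k / 6" using that by (meson not_less)
    then show ?thesis unfolding Suc by simp
  qed
  ultimately show thesis using that by blast
qed

lemma dyadic_pair:
  assumes W: "0 < W" and ne: "\<exists>i<N. p i \<noteq> q i" and le: "\<forall>i<N. \<bar>p i - q i\<bar> \<le> W / 3"
  obtains \<sigma> l where "\<sigma> \<subseteq> {..<N}" "dyadic_cell N W \<sigma> l p = dyadic_cell N W \<sigma> l q"
    "dyadic_cell N W \<sigma> (l + 3) p \<noteq> dyadic_cell N W \<sigma> (l + 3) q"
    "\<forall>i<N. \<bar>p i - q i\<bar> \<le> W / 2 ^ l / 3" "\<exists>i<N. W / 2 ^ l / 6 < \<bar>p i - q i\<bar>"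
proof -
  obtain l where l: "\<And>i. i < N \<Longrightarrow> \<bar>p i - q i\<bar> \<le> W / 2 ^ l / 3" "\<exists>i<N. W / 2 ^ l / 6 < \<bar>p i - q i\<bar>"
    using dyadic_scale[OF W ne] le by blast
  \<comment> \<open>The coordinates are independent: shift exactly those in which the unshifted grid
    separates the two points.\<close>
  define \<sigma> where "\<sigma> = {i. i < N \<and> \<lfloor>2 ^ l * (p i / W)\<rfloor> \<noteq> \<lfloor>2 ^ l * (q i / W)\<rfloor>}"
  have "dyadic_cell N W \<sigma> l p i = dyadic_cell N W \<sigma> l q i" for i
  proof (cases "i < N")
    case True
    have "\<bar>2 ^ l * (p i / W) - 2 ^ l * (q i / W)\<bar> = 2 ^ l / W * \<bar>p i - q i\<bar>"
      using W by (simp add: abs_mult flip: right_diff_distrib diff_divide_distrib)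
    also have "\<dots> \<le> 2 ^ l / W * (W / 2 ^ l / 3)" using W by (intro mult_left_mono l True) simp
    also have "\<dots> = 1 / 3" using W by simp
    finally show ?thesis using True floor_third_shift[of "2 ^ l * (p i / W)" "2 ^ l * (q i / W)" l]
      unfolding dyadic_cell_def \<sigma>_def by (auto simp: distrib_left)
  qed (simp add: dyadic_cell_def)
  moreover have "dyadic_cell N W \<sigma> (l + 3) p \<noteq> dyadic_cell N W \<sigma> (l + 3) q"
  proof -
    obtain i where i: "i < N" "W / 2 ^ l / 6 < \<bar>p i - q i\<bar>" using l(2) by blast
    have "W / 2 ^ (l + 3) \<le> W / 2 ^ l / 6" using W by (simp add: power_add field_simps)
    then show ?thesis using i W by (intro dyadic_cell_differ[of W i]) auto
  qed
  moreover have "\<sigma> \<subseteq> {..<N}" unfolding \<sigma>_def by auto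
  ultimately show thesis using that l by blast
qed

lemma dyadic_cell_inj:
  assumes W: "0 < W" and fin: "finite P" and sep: "\<And>p q. p \<in> P \<Longrightarrow> q \<in> P \<Longrightarrow> p \<noteq> q \<Longrightarrow> \<exists>i<N. p i \<noteq> q i"
  obtains L where "\<And>l \<sigma>. L \<le> l \<Longrightarrow> inj_on (dyadic_cell N W \<sigma> l) P"
proof -
  have ev: "eventually (\<lambda>l. p \<noteq> q \<longrightarrow> (\<forall>\<sigma>. dyadic_cell N W \<sigma> l p \<noteq> dyadic_cell N W \<sigma> l q)) sequentially"
    if pq: "p \<in> P" "q \<in> P" for p q
  proof (cases "p = q")
    case False
    obtain i where i: "i < N" "p i \<noteq> q i" using sep[OF pq False] by blast
    have "(\<lambda>l. W * (1 / 2) ^ l) \<longlonglongrightarrow> W * 0" by (intro tendsto_intros LIMSEQ_power_zero) simp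
    then have "eventually (\<lambda>l. W * (1 / 2) ^ l < \<bar>p i - q i\<bar>) sequentially"
      by (rule order_tendstoD) (use i in simp)
    then show ?thesis
    proof eventually_elim
      case (elim l)
      then have "W / 2 ^ l \<le> \<bar>p i - q i\<bar>" by (simp add: power_one_over field_simps)
      then show ?case using dyadic_cell_differ[OF W i(1)] by blast
    qed
  qed simp
  have "eventually (\<lambda>l. \<forall>p\<in>P. \<forall>q\<in>P. p \<noteq> q \<longrightarrow> (\<forall>\<sigma>. dyadic_cell N W \<sigma> l p \<noteq> dyadic_cell N W \<sigma> l q)) sequentially"
    by (intro eventually_ball_finite ballI fin ev)
  then obtain L where "\<And>l p q \<sigma>. L \<le> l \<Longrightarrow> p \<in> P \<Longrightarrow> q \<in> P \<Longrightarrow> p \<noteq> q \<Longrightarrow>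
      dyadic_cell N W \<sigma> l p \<noteq> dyadic_cell N W \<sigma> l q"
    unfolding eventually_sequentially by blast
  then have "\<And>l \<sigma>. L \<le> l \<Longrightarrow> inj_on (dyadic_cell N W \<sigma> l) P" unfolding inj_on_def by blast
  then show thesis using that by blast
qed

lemma finite_coordinate_bound:
  fixes P :: "(nat \<Rightarrow> real) set"
  assumes "finite P"
  obtains W where "0 < W" "\<And>p q i. p \<in> P \<Longrightarrow> q \<in> P \<Longrightarrow> i < N \<Longrightarrow> \<bar>p i - q i\<bar> \<le> W / 3"
proof -
  have "finite ((\<lambda>(p, q, i). \<bar>p i - q i\<bar>) ` (P \<times> P \<times> {..<N}))" using assms by simp
  then obtain B where B: "\<forall>x\<in>(\<lambda>(p, q, i). \<bar>p i - q i\<bar>) ` (P \<times> P \<times> {..<N}). x \<le> B"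
    using bdd_above_finite unfolding bdd_above_def by blast
  have "\<bar>p i - q i\<bar> \<le> (3 * \<bar>B\<bar> + 1) / 3" if "p \<in> P" "q \<in> P" "i < N" for p q i
  proof -
    have "\<bar>p i - q i\<bar> \<in> (\<lambda>(p, q, i). \<bar>p i - q i\<bar>) ` (P \<times> P \<times> {..<N})" using that by force
    then have "\<bar>p i - q i\<bar> \<le> B" using B by blast
    then show ?thesis by simp
  qed
  then show thesis using that[of "3 * \<bar>B\<bar> + 1"] by fastforce
qed

text \<open>The Steiner points are implicit, as endpoints occurring in \<open>R\<close>. The bound
  is linear in \<open>card P\<close> with one \<open>B\<close> for all \<open>P\<close>, so that it
  can later be applied to the set of all lifts.\<close>

definition has_spanners :: "'a set \<Rightarrow> ('a \<Rightarrow> 'a \<Rightarrow> real) \<Rightarrow> real \<Rightarrow> real \<Rightarrow> bool" where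
  "has_spanners X \<delta> t B \<longleftrightarrow> (\<forall>P. finite P \<longrightarrow> P \<subseteq> X \<longrightarrow>
     (\<exists>R. finite R \<and> R \<subseteq> X \<times> X \<and> real (card R) \<le> B * real (card P) \<and>
       (\<forall>p\<in>P. \<forall>q\<in>P. conn \<delta> R p q (t * \<delta> p q))))"

section \<open>Spaces comparable to an ambient Euclidean space\<close>

text \<open>\<open>lower\<close> and \<open>upper\<close> make \<delta> comparable to the maximum
  norm of \<open>N\<close> ambient coordinates, so a small cell has small diameter everywhere. Error
  budget: \<epsilon> / 4 for the net point and 3 \<epsilon> / 16 at each end, together 5 \<epsilon>
  / 8.\<close>

lemma chordal_has_spanners:
  fixes X :: "(nat \<Rightarrow> real) set" and \<delta> :: "(nat \<Rightarrow> real) \<Rightarrow> (nat \<Rightarrow> real) \<Rightarrow> real"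
  assumes sym: "\<And>x y. \<delta> x y = \<delta> y x"
    and tri: "\<And>x y z. x \<in> X \<Longrightarrow> y \<in> X \<Longrightarrow> z \<in> X \<Longrightarrow> \<delta> x z \<le> \<delta> x y + \<delta> y z"
    and nonneg: "\<And>x y. x \<in> X \<Longrightarrow> y \<in> X \<Longrightarrow> 0 \<le> \<delta> x y"
    and sep: "\<And>x y. x \<in> X \<Longrightarrow> y \<in> X \<Longrightarrow> x \<noteq> y \<Longrightarrow> \<exists>i<N. x i \<noteq> y i"
    and lower: "\<And>x y i. x \<in> X \<Longrightarrow> y \<in> X \<Longrightarrow> i < N \<Longrightarrow> \<bar>x i - y i\<bar> \<le> \<delta> x y"
    and upper: "\<And>x y r. x \<in> X \<Longrightarrow> y \<in> X \<Longrightarrow> (\<And>i. i < N \<Longrightarrow> \<bar>x i - y i\<bar> \<le> r) \<Longrightarrow> \<delta> x y \<le> 2 * real N * r"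
    and net: "\<And>w o'. 0 < w \<Longrightarrow> \<exists>S\<subseteq>X. finite S \<and> real (card S) \<le> K \<and>
       (\<forall>p\<in>X. \<forall>q\<in>X. in_box N o' w p \<longrightarrow> in_box N o' w q \<longrightarrow>
          (\<exists>i<N. w / 6 < \<bar>p i - q i\<bar>) \<longrightarrow> (\<exists>s\<in>S. \<delta> p s + \<delta> s q \<le> (1 + \<epsilon> / 4) * \<delta> p q))"
    and K: "1 \<le> K" and ep: "0 < \<epsilon>" "\<epsilon> \<le> 1" and M: "192 * real N / \<epsilon> \<le> 2 ^ M"
  shows "has_spanners X \<delta> (1 + \<epsilon>) (2 ^ N * (4 * K * real (M + 3)))"
  unfolding has_spanners_def
proof (intro allI impI)
  fix P assume P: "finite P" "P \<subseteq> X"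
  obtain net where net: "\<And>w o'. 0 < w \<Longrightarrow> net w o' \<subseteq> X \<and> finite (net w o') \<and> real (card (net w o')) \<le> K \<and>
       (\<forall>p\<in>X. \<forall>q\<in>X. in_box N o' w p \<longrightarrow> in_box N o' w q \<longrightarrow>
          (\<exists>i<N. w / 6 < \<bar>p i - q i\<bar>) \<longrightarrow> (\<exists>s\<in>net w o'. \<delta> p s + \<delta> s q \<le> (1 + \<epsilon> / 4) * \<delta> p q))"
    using net by metis
  obtain W where W: "0 < W" "\<And>p q i. p \<in> P \<Longrightarrow> q \<in> P \<Longrightarrow> i < N \<Longrightarrow> \<bar>p i - q i\<bar> \<le> W / 3"
    using finite_coordinate_bound[OF P(1)] by blast
  have sepP: "\<exists>i<N. p i \<noteq> q i" if "p \<in> P" "q \<in> P" "p \<noteq> q" for p q using sep that P(2) by blast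
  obtain L where L: "\<And>l \<sigma>. L \<le> l \<Longrightarrow> inj_on (dyadic_cell N W \<sigma> l) P"
    using dyadic_cell_inj[OF W(1) P(1) sepP] by blast
  define S where "S \<sigma> l c = net (W / 2 ^ l) (corner W \<sigma> l c)" for \<sigma> l c
  have wpos: "0 < W / 2 ^ l" for l using W(1) by simp
  show "\<exists>R. finite R \<and> R \<subseteq> X \<times> X \<and> real (card R) \<le> 2 ^ N * (4 * K * real (M + 3)) * real (card P) \<and>
       (\<forall>p\<in>P. \<forall>q\<in>P. conn \<delta> R p q ((1 + \<epsilon>) * \<delta> p q))"
  proof (cases "P = {}")
    case True
    then show ?thesis by (intro exI[of _ "{}"]) simp
  next
    case False
    then obtain x0 where x0: "x0 \<in> X" using P(2) by blast
    have SS: "S \<sigma> l c \<subseteq> X" "finite (S \<sigma> l c)" "real (card (S \<sigma> l c)) \<le> K" for \<sigma> l c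
      unfolding S_def using net[OF wpos] by blast+
    \<comment> \<open>No cell is low, so every leg ends at a representative; \<open>x0\<close> and
      the zero potentials are fillers for the anchor data.\<close>
    interpret cell_hierarchy X \<delta> P "Pow {..<N}" "dyadic_cell N W" S "\<lambda>_ _ _. False" "\<lambda>_ _ _. x0"
      "\<lambda>_. 0" "\<lambda>_. 0" M M L K \<epsilon>
      by (unfold_locales, rule P(1), rule P(2), simp, rule sym, erule (1) nonneg, erule (1) dyadic_cell_nested,
          erule L, rule SS, rule SS, rule SS, rule K, rule le_refl, rule less_imp_le[OF ep(1)], rule x0)
        simp_all
    have "conn \<delta> R p q ((1 + \<epsilon>) * \<delta> p q)" if "p \<in> P" "q \<in> P" for p q
    proof (rule conn_pairs[OF _ that])
      fix p q assume pq: "p \<in> P" "q \<in> P" "p \<noteq> q"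
      obtain \<sigma> l where \<sigma>: "\<sigma> \<subseteq> {..<N}" "dyadic_cell N W \<sigma> l p = dyadic_cell N W \<sigma> l q"
        "dyadic_cell N W \<sigma> (l + 3) p \<noteq> dyadic_cell N W \<sigma> (l + 3) q"
        "\<forall>i<N. \<bar>p i - q i\<bar> \<le> W / 2 ^ l / 3"
        and far: "\<exists>i<N. W / 2 ^ l / 6 < \<bar>p i - q i\<bar>"
        using dyadic_pair[OF W(1) sepP[OF pq]] W(2)[OF pq(1,2)] by metis
      let ?w = "W / 2 ^ l" and ?D = "\<delta> p q"
      have X: "p \<in> X" "q \<in> X" using pq P(2) by auto
      obtain s where s: "s \<in> S \<sigma> l (dyadic_cell N W \<sigma> l p)" "\<delta> p s + \<delta> s q \<le> (1 + \<epsilon> / 4) * ?D"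
        using net[OF wpos, of l "corner W \<sigma> l (dyadic_cell N W \<sigma> l p)"] X far
          in_box_corner[OF W(1), of N \<sigma> l p] in_box_corner[OF W(1), of N \<sigma> l q] \<sigma>(2)
        unfolding S_def by metis
      have sX: "s \<in> X" using s(1) SX[of \<sigma> p l] \<sigma>(1) pq(1) by blast
      have Dw: "?w / 6 < ?D" using far lower[OF X] by (meson less_le_trans)
      have Dpos: "0 < ?D" using Dw W(1) by (intro less_trans[OF _ Dw]) simp
      \<comment> \<open>A subcell has diameter at most 2 N w / 2^M, which is at most \<epsilon> w /
        96 by the choice of \<open>M\<close>; and 96 = 16 * 6 since w < 6 D.\<close>
      have near: "\<delta> x' x \<le> \<epsilon> / 16 * ?D" if "x' \<in> P" "x \<in> P" "dyadic_cell N W \<sigma> (l + M) x' = dyadic_cell N W \<sigma> (l + M) x" for x x'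
      proof -
        have "\<delta> x' x \<le> 2 * real N * (W / 2 ^ (l + M))"
          using dyadic_cell_close[OF W(1) _ that(3)] that P(2) by (intro upper) fastforce+
        also have "\<dots> = 2 * real N / 2 ^ M * ?w" by (simp add: power_add)
        also have "2 * real N / 2 ^ M \<le> \<epsilon> / 96" using M ep by (simp add: field_simps)
        then have "2 * real N / 2 ^ M * ?w \<le> \<epsilon> / 96 * ?w" using wpos[of l] by (intro mult_right_mono) auto
        also have "\<dots> = \<epsilon> / 16 * (?w / 6)" by simp
        also have "\<dots> \<le> \<epsilon> / 16 * ?D" using Dw ep by (intro mult_left_mono) auto
        finally show ?thesis .
      qed
      \<comment> \<open>The gap is paid once for aiming at x' instead of x and, as 1 + \<epsilon> is
        at most 2, at most twice for coming back.\<close>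
      have leg: "leg \<sigma> l s x ?D (\<delta> s x + 3 * \<epsilon> / 16 * ?D)" if x: "x \<in> P" for x
        unfolding leg_def
      proof (intro disjI2 ballI impI conjI)
        fix x' assume x': "x' \<in> P" "dyadic_cell N W \<sigma> (l + M) x' = dyadic_cell N W \<sigma> (l + M) x"
        note n = near[OF x'(1) x x'(2)]
        have xX: "x \<in> X" "x' \<in> X" using x x' P(2) by auto
        have "\<delta> s x' \<le> \<delta> s x + \<delta> x' x" using tri[OF sX xX] sym[of x x'] by simp
        moreover have "(1 + \<epsilon>) * \<delta> x' x \<le> 2 * \<delta> x' x"
          using ep nonneg[OF xX(2,1)] by (intro mult_right_mono) auto
        ultimately show "\<delta> s x' + (1 + \<epsilon>) * \<delta> x' x \<le> \<delta> s x + 3 * \<epsilon> / 16 * ?D" using n by linarith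
        have "\<epsilon> / 16 * ?D < 1 * ?D" using ep Dpos by (intro mult_strict_right_mono) auto
        then show "\<delta> x' x < ?D" using n by linarith
      qed
      have "(\<delta> s p + 3 * \<epsilon> / 16 * ?D) + (\<delta> s q + 3 * \<epsilon> / 16 * ?D) \<le> (1 + 5 * \<epsilon> / 8) * ?D"
        using s(2) sym[of p s] by (simp add: algebra_simps)
      also have "\<dots> \<le> (1 + \<epsilon>) * ?D" using ep Dpos by (intro mult_right_mono) auto
      finally have "(\<delta> s p + 3 * \<epsilon> / 16 * ?D) + (\<delta> s q + 3 * \<epsilon> / 16 * ?D) \<le> (1 + \<epsilon>) * ?D" .
      then show "\<exists>\<sigma>\<in>Pow {..<N}. \<exists>l. \<exists>s\<in>S \<sigma> l (dyadic_cell N W \<sigma> l p). \<exists>A B.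
           dyadic_cell N W \<sigma> l p = dyadic_cell N W \<sigma> l q \<and>
           dyadic_cell N W \<sigma> (l + 3) p \<noteq> dyadic_cell N W \<sigma> (l + 3) q \<and>
           leg \<sigma> l s p (\<delta> p q) A \<and> leg \<sigma> l s q (\<delta> p q) B \<and> A + B \<le> (1 + \<epsilon>) * \<delta> p q"
        using s(1) \<sigma> leg[OF pq(1)] leg[OF pq(2)] by blast
    qed
    then show ?thesis using finite_R card_R R_subset by (intro exI[of _ R]) (auto simp: card_Pow)
  qed
qed

section \<open>Nets on walls\<close>

text \<open>Sort \<open>Y\<close> into buckets by rounding the coordinates in \<open>J\<close> and
  keep one point of each nonempty bucket. The net thus lies in \<open>Y\<close> itself and inherits
  every constraint put into \<open>Y\<close>: membership in the space, the wall, a height bound, a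
  sign. Along one coordinate there are at most 2 r / \<theta> + 2 buckets.\<close>

lemma grid_net:
  fixes Y :: "(nat \<Rightarrow> real) set" and \<theta> r :: real
  assumes J: "finite J" and \<theta>: "0 < \<theta>" and bd: "\<And>y j. y \<in> Y \<Longrightarrow> j \<in> J \<Longrightarrow> \<bar>y j - o' j\<bar> \<le> r"
    and r: "0 \<le> r"
  shows "\<exists>S\<subseteq>Y. finite S \<and> real (card S) \<le> (2 * r / \<theta> + 2) ^ card J \<and>
    (\<forall>y\<in>Y. \<exists>s\<in>S. \<forall>j\<in>J. \<bar>y j - s j\<bar> \<le> \<theta>)"
proof -
  define g where "g y = restrict (\<lambda>j. \<lfloor>(y j - o' j) / \<theta>\<rfloor>) J" for y
  define I where "I = {\<lfloor>- (r / \<theta>)\<rfloor>..\<lfloor>r / \<theta>\<rfloor>}"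
  define f where "f c = (SOME y. y \<in> Y \<and> g y = c)" for c
  have sub: "g ` Y \<subseteq> PiE J (\<lambda>_. I)"
  proof
    fix c assume "c \<in> g ` Y"
    then obtain y where y: "y \<in> Y" "c = g y" by blast
    have "\<lfloor>(y j - o' j) / \<theta>\<rfloor> \<in> I" if "j \<in> J" for j
    proof -
      have "- r \<le> y j - o' j" "y j - o' j \<le> r" using bd[OF y(1) that] by auto
      then have "- (r / \<theta>) \<le> (y j - o' j) / \<theta>" "(y j - o' j) / \<theta> \<le> r / \<theta>"
        unfolding minus_divide_left using \<theta> by (intro divide_right_mono; simp)+
      then show ?thesis unfolding I_def by (simp add: floor_mono)
    qed
    then show "c \<in> PiE J (\<lambda>_. I)" unfolding y(2) g_def by auto
  qed
  have finP: "finite (PiE J (\<lambda>_. I))" using J unfolding I_def by (intro finite_PiE) auto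
  have f: "f (g y) \<in> Y \<and> g (f (g y)) = g y" if "y \<in> Y" for y
    unfolding f_def by (rule someI[of _ y]) (use that in simp)
  have "card (f ` g ` Y) \<le> card (PiE J (\<lambda>_. I))"
    using card_mono[OF finP sub] card_image_le[OF finite_subset[OF sub finP]] order_trans by blast
  also have "\<dots> = card I ^ card J" using card_PiE[OF J, of "\<lambda>_. I"] by simp
  finally have "real (card (f ` g ` Y)) \<le> real (card I) ^ card J"
    by (metis of_nat_le_iff of_nat_power)
  also have "\<dots> \<le> (2 * r / \<theta> + 2) ^ card J"
  proof (rule power_mono)
    have "real (card I) = max 0 (of_int (\<lfloor>r / \<theta>\<rfloor> - \<lfloor>- (r / \<theta>)\<rfloor> + 1))"
      unfolding I_def by simp
    also have "\<dots> \<le> 2 * (r / \<theta>) + 2"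
    proof (rule max.boundedI)
      show "0 \<le> 2 * (r / \<theta>) + 2" using r \<theta> by simp
      have "of_int \<lfloor>r / \<theta>\<rfloor> \<le> r / \<theta>" "- (r / \<theta>) < of_int \<lfloor>- (r / \<theta>)\<rfloor> + 1" by linarith+
      then show "real_of_int (\<lfloor>r / \<theta>\<rfloor> - \<lfloor>- (r / \<theta>)\<rfloor> + 1) \<le> 2 * (r / \<theta>) + 2"
        unfolding of_int_add of_int_diff of_int_1 by argo
    qed
    finally show "real (card I) \<le> 2 * r / \<theta> + 2" by simp
  qed simp
  finally have c: "real (card (f ` g ` Y)) \<le> (2 * r / \<theta> + 2) ^ card J" .
  show ?thesis
  proof (intro exI[of _ "f ` g ` Y"] conjI ballI)
    show "f ` g ` Y \<subseteq> Y" using f by blast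
    show "finite (f ` g ` Y)" using finite_subset[OF sub finP] by simp
    show "real (card (f ` g ` Y)) \<le> (2 * r / \<theta> + 2) ^ card J" by (rule c)
    fix y assume y: "y \<in> Y"
    show "\<exists>s\<in>f ` g ` Y. \<forall>j\<in>J. \<bar>y j - s j\<bar> \<le> \<theta>"
    proof (intro bexI[of _ "f (g y)"] ballI)
      fix j assume j: "j \<in> J"
      let ?a = "(y j - o' j) / \<theta>" and ?b = "(f (g y) j - o' j) / \<theta>"
      have "g (f (g y)) j = g y j" using f[OF y] by simp
      then have "\<lfloor>?a\<rfloor> = \<lfloor>?b\<rfloor>" unfolding g_def using j by simp
      then have "\<bar>?a - ?b\<bar> \<le> 1" by linarith
      moreover have "?a - ?b = (y j - f (g y) j) / \<theta>" by (simp add: diff_divide_distrib)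
      ultimately show "\<bar>y j - f (g y) j\<bar> \<le> \<theta>" using \<theta> by (simp add: abs_le_iff field_simps)
    qed (use y in blast)
  qed
qed

text \<open>The middle third of the interval between \<open>a\<close> and \<open>b\<close> is longer
  than w / 18, hence contains one of the walls spaced by w / 24. Choosing it there keeps the
  crossing away from both ends.\<close>

lemma wall_between:
  fixes o' a b w :: real
  assumes "0 < w" "o' \<le> a" "a < o' + w" "o' \<le> b" "b < o' + w" "w / 6 < \<bar>a - b\<bar>"
  obtains k :: nat and u where "k \<le> 24" "1 / 3 \<le> u" "u \<le> 2 / 3" "o' + real k * w / 24 = a + u * (b - a)"
proof -
  define lo hi where "lo = min a b" and "hi = max a b"
  have lh: "w / 6 < hi - lo" "o' \<le> lo" "hi < o' + w" unfolding lo_def hi_def using assms by (auto simp: min_def max_def)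
  \<comment> \<open>The first wall at or beyond the lower end of the middle third.\<close>
  define k where "k = \<lceil>(lo + (hi - lo) / 3 - o') * 24 / w\<rceil>"
  have "0 \<le> lo + (hi - lo) / 3 - o'" using lh assms(1) by argo
  then have "0 \<le> (lo + (hi - lo) / 3 - o') * 24 / w" using assms(1) by (intro divide_nonneg_pos mult_nonneg_nonneg) simp_all
  then have k0: "0 \<le> k" unfolding k_def by linarith
  have k1: "(lo + (hi - lo) / 3 - o') * 24 / w \<le> of_int k" "of_int k < (lo + (hi - lo) / 3 - o') * 24 / w + 1"
    unfolding k_def by linarith+
  have k2: "lo + (hi - lo) / 3 - o' \<le> of_int k * w / 24" using k1(1) assms(1) by (simp add: field_simps)
  have "of_int k * w < (lo + (hi - lo) / 3 - o') * 24 + w" using k1(2) assms(1) by (simp add: field_simps)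
  then have k3: "of_int k * w / 24 \<le> lo + 2 * (hi - lo) / 3 - o'" using lh(1) assms(1) by argo
  have "of_int k * w / 24 < w" using k3 lh assms(1) by argo
  then have "real_of_int k < 24" using assms(1) by simp
  then have k24: "nat k \<le> 24" by simp
  have rk: "real (nat k) = of_int k" using k0 by simp
  let ?c = "o' + real (nat k) * w / 24"
  define u where "u = (?c - a) / (b - a)"
  have ne: "b - a \<noteq> 0" using assms(1,6) by auto
  have eq: "?c = a + u * (b - a)" unfolding u_def using ne by simp
  have third: "1 / 3 \<le> e / f \<and> e / f \<le> 2 / 3" if "0 < f" "f / 3 \<le> e" "e \<le> 2 * f / 3" for e f :: real
    using that by (simp add: field_simps)
  have "1 / 3 \<le> u \<and> u \<le> 2 / 3"
  proof (cases "a < b")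
    case True
    then have "lo = a" "hi = b" unfolding lo_def hi_def by auto
    then have "(b - a) / 3 \<le> ?c - a" "?c - a \<le> 2 * (b - a) / 3" using k2 k3 unfolding rk by argo+
    then show ?thesis unfolding u_def using True by (intro third) auto
  next
    case False
    then have lt: "b < a" "lo = b" "hi = a" unfolding lo_def hi_def using ne by auto
    then have "(a - b) / 3 \<le> a - ?c" "a - ?c \<le> 2 * (a - b) / 3" using k2 k3 unfolding rk by argo+
    moreover have "u = (a - ?c) / (a - b)" unfolding u_def by (metis minus_diff_eq minus_divide_divide)
    ultimately show ?thesis using lt(1) third[of "a - b" "a - ?c"] by simp
  qed
  then show thesis using that[OF k24 _ _ eq] by blast
qed

section \<open>Euclidean space\<close>

lemma coordinate_le_sqrt:
  fixes p q :: "nat \<Rightarrow> real"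
  assumes "i < d"
  shows "\<bar>p i - q i\<bar> \<le> sqrt (\<Sum>j<d. (p j - q j)\<^sup>2)"
proof (rule real_le_rsqrt)
  have "(p i - q i)\<^sup>2 \<le> (\<Sum>j<d. (p j - q j)\<^sup>2)"
    by (rule member_le_sum[of i "{..<d}" "\<lambda>j. (p j - q j)\<^sup>2"]) (use assms in auto)
  then show "\<bar>p i - q i\<bar>\<^sup>2 \<le> (\<Sum>j<d. (p j - q j)\<^sup>2)" by simp
qed

lemma stewart_euclid:
  fixes p q s y :: "nat \<Rightarrow> real"
  assumes y: "\<And>j. y j = p j + u * (q j - p j)"
  shows "(1 - u) * (\<Sum>j<d. (p j - s j)\<^sup>2) + u * (\<Sum>j<d. (s j - q j)\<^sup>2)
     = (\<Sum>j<d. (y j - s j)\<^sup>2) + u * (1 - u) * (\<Sum>j<d. (p j - q j)\<^sup>2)"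
proof -
  have "(1 - u) * (p j - s j)\<^sup>2 + u * (s j - q j)\<^sup>2 = (y j - s j)\<^sup>2 + u * (1 - u) * (p j - q j)\<^sup>2" for j
    unfolding y by algebra
  then have "(\<Sum>j<d. (1 - u) * (p j - s j)\<^sup>2 + u * (s j - q j)\<^sup>2) =
      (\<Sum>j<d. (y j - s j)\<^sup>2 + u * (1 - u) * (p j - q j)\<^sup>2)" by simp
  then show ?thesis by (simp add: sum.distrib sum_distrib_left)
qed

text \<open>For the exact crossing the legs are u D and (1 - u) D. The weighted squares of the
  deviations from these values are nonnegative, and by Stewart's identity their sum is t - 2 u (1 -
  u) D (a + b - D). In the middle third u (1 - u) is at least 2 / 9, whence 9 / 4.\<close>

lemma stewart_excess:
  fixes a b D t u :: real
  assumes "(1 - u) * a\<^sup>2 + u * b\<^sup>2 = t + u * (1 - u) * D\<^sup>2" "1 / 3 \<le> u" "u \<le> 2 / 3" "0 < D" "0 \<le> t"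
  shows "a + b \<le> D + 9 / 4 * t / D"
proof -
  have "0 \<le> (1 - u) * (a - u * D)\<^sup>2 + u * (b - (1 - u) * D)\<^sup>2" using assms by simp
  also have "\<dots> = ((1 - u) * a\<^sup>2 + u * b\<^sup>2) - 2 * (u * (1 - u)) * D * (a + b) + u * (1 - u) * D\<^sup>2"
    by algebra
  also have "\<dots> = t - 2 * (u * (1 - u)) * (D * (a + b - D))" unfolding assms(1) by algebra
  finally have le: "2 * (u * (1 - u)) * (D * (a + b - D)) \<le> t" by simp
  show ?thesis
  proof (cases "a + b \<le> D")
    case True
    then show ?thesis using assms by (smt (verit) divide_nonneg_pos mult_nonneg_nonneg)
  next
    case False
    have "0 \<le> (u - 1 / 3) * (2 / 3 - u)" using assms by simp
    also have "\<dots> = u * (1 - u) - 2 / 9" by algebra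
    finally have "4 / 9 \<le> 2 * (u * (1 - u))" by simp
    then have "4 / 9 * (D * (a + b - D)) \<le> 2 * (u * (1 - u)) * (D * (a + b - D))"
      using False assms by (intro mult_right_mono) auto
    then have "D * (a + b - D) \<le> 9 / 4 * t" using le by linarith
    then have "a + b - D \<le> 9 / 4 * t / D" using assms(4) by (simp add: field_simps)
    then show ?thesis by simp
  qed
qed

lemma euc_net:
  assumes d: "2 \<le> d" and e: "0 < \<epsilon>" "\<epsilon> \<le> 1" and w: "0 < w"
  shows "\<exists>S\<subseteq>model_carrier Euc d. finite S \<and>
     real (card S) \<le> 25 * real d * (400 * real d / sqrt \<epsilon> + 2) ^ (d - 1) \<and>
     (\<forall>p\<in>model_carrier Euc d. \<forall>q\<in>model_carrier Euc d. in_box d o' w p \<longrightarrow> in_box d o' w q \<longrightarrow>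
        (\<exists>i<d. w / 6 < \<bar>p i - q i\<bar>) \<longrightarrow>
        (\<exists>s\<in>S. model_dist Euc d p s + model_dist Euc d s q \<le> (1 + \<epsilon> / 4) * model_dist Euc d p q))"
proof -
  let ?X = "model_carrier Euc d" and ?\<delta> = "model_dist Euc d"
  \<comment> \<open>With D at least w / 6, a mesh of order \<surd>\<epsilon> w / \<surd>d would
    already do. The cruder factor d only affects the d^O(d) part of the bound.\<close>
  define \<theta> where "\<theta> = sqrt \<epsilon> * w / (200 * real d)"
  have \<theta>: "0 < \<theta>" unfolding \<theta>_def using e w d by simp
  define Y where "Y ik = {y\<in>?X. y (fst ik) = o' (fst ik) + real (snd ik) * w / 24 \<and> (\<forall>j<d. \<bar>y j - o' j\<bar> \<le> w)}" for ik :: "nat \<times> nat"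
  have "\<exists>S\<subseteq>Y ik. finite S \<and> real (card S) \<le> (2 * w / \<theta> + 2) ^ card ({..<d} - {fst ik}) \<and>
    (\<forall>y\<in>Y ik. \<exists>s\<in>S. \<forall>j\<in>{..<d} - {fst ik}. \<bar>y j - s j\<bar> \<le> \<theta>)" for ik
    by (rule grid_net[where o' = o']) (use \<theta> w in \<open>auto simp: Y_def\<close>)
  then obtain N where N: "\<And>ik. N ik \<subseteq> Y ik \<and> finite (N ik) \<and> real (card (N ik)) \<le> (2 * w / \<theta> + 2) ^ card ({..<d} - {fst ik}) \<and>
    (\<forall>y\<in>Y ik. \<exists>s\<in>N ik. \<forall>j\<in>{..<d} - {fst ik}. \<bar>y j - s j\<bar> \<le> \<theta>)" by metis
  define I where "I = {..<d} \<times> {..24::nat}"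
  define S where "S = (\<Union>ik\<in>I. N ik)"
  have ratio: "2 * w / \<theta> = 400 * real d / sqrt \<epsilon>" unfolding \<theta>_def using w d e by (simp add: field_simps)
  have "real (card (N ik)) \<le> (400 * real d / sqrt \<epsilon> + 2) ^ (d - 1)" if "ik \<in> I" for ik
  proof -
    have "card ({..<d} - {fst ik}) = d - 1" using that unfolding I_def by auto
    then show ?thesis using N[of ik] unfolding ratio by simp
  qed
  then have "real (card S) \<le> (400 * real d / sqrt \<epsilon> + 2) ^ (d - 1) * real (card I)"
    unfolding S_def by (intro real_card_UN_le) (auto simp: I_def)
  also have "real (card I) = 25 * real d" unfolding I_def by simp
  finally have cS: "real (card S) \<le> 25 * real d * (400 * real d / sqrt \<epsilon> + 2) ^ (d - 1)"
    by (simp only: mult.commute)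
  have main: "\<exists>s\<in>S. ?\<delta> p s + ?\<delta> s q \<le> (1 + \<epsilon> / 4) * ?\<delta> p q"
    if p: "p \<in> ?X" "in_box d o' w p" and q: "q \<in> ?X" "in_box d o' w q" and i: "i < d" "w / 6 < \<bar>p i - q i\<bar>" for p q i
  proof -
    obtain k u where k: "k \<le> 24" and u: "1 / 3 \<le> u" "u \<le> 2 / 3" "o' i + real k * w / 24 = p i + u * (q i - p i)"
      by (rule wall_between[OF w, of "o' i" "p i" "q i"]) (use p q i in \<open>auto simp: in_box_def\<close>)
    define y where "y j = p j + u * (q j - p j)" for j
    have "y \<in> Y (i, k)"
    proof -
      have "\<bar>y j - o' j\<bar> \<le> w" if j: "j < d" for j
      proof -
        have b: "0 \<le> p j - o' j" "p j - o' j \<le> w" "0 \<le> q j - o' j" "q j - o' j \<le> w"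
          using p q j by (force simp: in_box_def)+
        have y': "y j - o' j = (1 - u) * (p j - o' j) + u * (q j - o' j)" unfolding y_def by algebra
        have "0 \<le> y j - o' j" unfolding y' using b u by simp
        moreover have "y j - o' j \<le> (1 - u) * w + u * w" unfolding y'
          using b u by (intro add_mono mult_left_mono) auto
        ultimately show ?thesis by (simp add: algebra_simps)
      qed
      then show ?thesis unfolding Y_def using p q u(3) by (auto simp: y_def)
    qed
    then obtain s where s: "s \<in> N (i, k)" "\<forall>j\<in>{..<d} - {i}. \<bar>y j - s j\<bar> \<le> \<theta>" using N[of "(i, k)"] by auto
    have sY: "s \<in> Y (i, k)" using s(1) N[of "(i, k)"] by blast
    have near: "\<bar>y j - s j\<bar> \<le> \<theta>" if "j < d" for j
      using that s(2) sY \<open>y \<in> Y (i, k)\<close> \<theta> by (cases "j = i") (auto simp: Y_def)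
    let ?D = "?\<delta> p q"
    have "\<bar>p i - q i\<bar> \<le> ?D" using coordinate_le_sqrt[OF i(1), of p q] by simp
    then have D: "w / 6 \<le> ?D" "0 < ?D" using i(2) w by linarith+
    define t where "t = (\<Sum>j<d. (y j - s j)\<^sup>2)"
    have t0: "0 \<le> t" unfolding t_def by (simp add: sum_nonneg)
    have "?\<delta> p s + ?\<delta> s q \<le> ?D + 9 / 4 * t / ?D"
    proof (rule stewart_excess[OF _ u(1,2) D(2) t0])
      show "(1 - u) * (?\<delta> p s)\<^sup>2 + u * (?\<delta> s q)\<^sup>2 = t + u * (1 - u) * ?D\<^sup>2"
        using stewart_euclid[of y p u q, OF y_def, where d = d and s = s] unfolding t_def by (simp add: sum_nonneg)
    qed
    also have "9 / 4 * t / ?D \<le> \<epsilon> / 4 * ?D"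
    proof -
      have "(y j - s j)\<^sup>2 \<le> \<theta>\<^sup>2" if "j < d" for j
        using near[OF that] \<theta> by (metis abs_ge_zero power2_abs power_mono)
      then have "t \<le> real d * \<theta>\<^sup>2" unfolding t_def using sum_bounded_above[of "{..<d}" "\<lambda>j. (y j - s j)\<^sup>2" "\<theta>\<^sup>2"] by simp
      also have "\<dots> = \<epsilon> * w\<^sup>2 / (40000 * real d)"
        unfolding \<theta>_def using e d by (simp add: power_mult_distrib power_divide power2_eq_square)
      also have "\<dots> \<le> \<epsilon> * w\<^sup>2 / 40000" using d e by (intro divide_left_mono) auto
      also have "\<dots> = \<epsilon> * (w / 6)\<^sup>2 * (36 / 40000)" by (simp add: power_divide)
      also have "\<dots> \<le> \<epsilon> * ?D\<^sup>2 * (36 / 40000)" using D(1) w e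
        by (intro mult_right_mono mult_left_mono power_mono) auto
      finally have "t \<le> \<epsilon> * ?D\<^sup>2 * (36 / 40000)" .
      moreover have "0 \<le> \<epsilon> * ?D\<^sup>2" using e by simp
      ultimately have "9 / 4 * t \<le> \<epsilon> / 4 * ?D * ?D"
        unfolding power2_eq_square mult.assoc by (simp del: model_dist.simps)
      then show ?thesis using D(2) by (simp only: pos_divide_le_eq)
    qed
    finally have "?\<delta> p s + ?\<delta> s q \<le> (1 + \<epsilon> / 4) * ?D"
      by (simp add: distrib_right del: model_dist.simps)
    moreover have "s \<in> S" using s(1) i(1) k unfolding S_def I_def by auto
    ultimately show ?thesis by blast
  qed
  show ?thesis
  proof (intro exI[of _ S] conjI ballI impI)
    show "S \<subseteq> ?X" using N unfolding S_def Y_def by blast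
    show "finite S" using N unfolding S_def I_def by blast
    show "real (card S) \<le> 25 * real d * (400 * real d / sqrt \<epsilon> + 2) ^ (d - 1)" by (rule cS)
  qed (use main in blast)
qed

lemma euc_has_spanners:
  assumes d: "2 \<le> d" and e: "0 < \<epsilon>" "\<epsilon> \<le> 1" and M: "192 * real d / \<epsilon> \<le> 2 ^ M"
  shows "has_spanners (model_carrier Euc d) (model_dist Euc d) (1 + \<epsilon>)
    (2 ^ d * (4 * (25 * real d * (400 * real d / sqrt \<epsilon> + 2) ^ (d - 1)) * real (M + 3)))"
proof (rule chordal_has_spanners[OF _ _ _ _ _ _ euc_net[OF d e] _ e M])
  fix x y z :: "nat \<Rightarrow> real"
  have L2: "model_dist Euc d x y = L2_set (\<lambda>i. x i - y i) {..<d}" for x y by (simp add: L2_set_def)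
  show "model_dist Euc d x y = model_dist Euc d y x" by (simp add: power2_commute)
  show "model_dist Euc d x z \<le> model_dist Euc d x y + model_dist Euc d y z"
    using L2_set_triangle_ineq[of "\<lambda>i. x i - y i" "\<lambda>i. y i - z i" "{..<d}"] unfolding L2 by simp
  show "0 \<le> model_dist Euc d x y" by (simp add: sum_nonneg)
  show "\<exists>i<d. x i \<noteq> y i" if "x \<in> model_carrier Euc d" "y \<in> model_carrier Euc d" "x \<noteq> y"
    using that by (auto simp: fun_eq_iff) (metis not_le)
  show "\<bar>x i - y i\<bar> \<le> model_dist Euc d x y" if "i < d" for i
    using coordinate_le_sqrt[OF that, of x y] by simp
  show "model_dist Euc d x y \<le> 2 * real d * r" if "\<And>i. i < d \<Longrightarrow> \<bar>x i - y i\<bar> \<le> r" for r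
  proof -
    have "model_dist Euc d x y \<le> (\<Sum>i<d. \<bar>x i - y i\<bar>)" unfolding L2 by (rule L2_set_le_sum_abs)
    also have "\<dots> \<le> real d * r" using that sum_bounded_above[of "{..<d}" "\<lambda>i. \<bar>x i - y i\<bar>" r] by simp
    also have "0 \<le> r" using that[of 0] d by fastforce
    then have "real d * r \<le> 2 * real d * r" by (simp add: mult_right_mono)
    finally show ?thesis .
  qed
  have "1 \<le> (400 * real d / sqrt \<epsilon> + 2) ^ (d - 1)" using e by (intro one_le_power) simp
  moreover have "1 \<le> 25 * real d" using d by simp
  ultimately show "1 \<le> 25 * real d * (400 * real d / sqrt \<epsilon> + 2) ^ (d - 1)"
    by (metis mult_mono mult_1 zero_le_one order_trans)
qed

section \<open>The sphere\<close>

text \<open>Up to \<pi> / 4 the derivative cos is at least \<surd>2 / 2, so sin s is at least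
  \<surd>2 / 2 times s; the double-angle formula carries this to t = 2 s.\<close>

lemma sin_ge_half:
  fixes t :: real
  assumes "0 \<le> t" "t \<le> pi / 2"
  shows "t / 2 \<le> sin t"
proof -
  define s where "s = t / 2"
  have s: "0 \<le> s" "s \<le> pi / 4" unfolding s_def using assms by auto
  have c: "sqrt 2 / 2 \<le> cos x" if "0 \<le> x" "x \<le> s" for x
    using cos_monotone_0_pi_le[of x "pi / 4"] cos_45 that s by simp
  have "sin 0 - sqrt 2 / 2 * 0 \<le> sin s - sqrt 2 / 2 * s"
  proof (rule DERIV_nonneg_imp_nondecreasing[OF s(1)])
    fix x assume "0 \<le> x" "x \<le> s"
    then show "\<exists>y. ((\<lambda>x. sin x - sqrt 2 / 2 * x) has_real_derivative y) (at x) \<and> 0 \<le> y"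
      using c by (intro exI[of _ "cos x - sqrt 2 / 2"] conjI) (auto intro!: derivative_eq_intros)
  qed
  then have "(sqrt 2 / 2 * s) * (sqrt 2 / 2) \<le> sin s * cos s"
    using c[of s] s sin_ge_zero[of s] pi_gt_zero by (intro mult_mono) auto
  moreover have "(sqrt 2 / 2 * s) * (sqrt 2 / 2) = s / 2" by (simp add: field_simps)
  ultimately have "s \<le> 2 * sin s * cos s" by linarith
  also have "\<dots> = sin t" using sin_double[of s] unfolding s_def by simp
  finally show ?thesis unfolding s_def .
qed

lemma one_minus_cos_le: "1 - cos t \<le> t\<^sup>2 / 2" for t :: real
proof -
  have "1 - cos t = 2 * (sin (t / 2))\<^sup>2" using cos_double_sin[of "t / 2"] by simp
  also have "(sin (t / 2))\<^sup>2 \<le> (t / 2)\<^sup>2"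
    using abs_sin_x_le_abs_x[of "t / 2"] by (simp only: abs_le_square_iff)
  finally show ?thesis by (simp add: power2_eq_square)
qed

lemma cos_le_cos_of_abs_le:
  assumes "\<bar>u\<bar> \<le> t" "t \<le> pi"
  shows "cos t \<le> cos u"
  using cos_monotone_0_pi_le[of "\<bar>u\<bar>" t] assms by simp

text \<open>The spherical form of Stewart's theorem, \<open>cos t = \<alpha> cos a' + \<beta> cos b'\<close>, gives the excess of a detour:
  the first order terms of \<open>u = a' - a\<close> and \<open>v = b' - b\<close> have the same weight.\<close>

lemma spherical_excess:
  fixes a b a' b' t \<alpha> \<beta> b0 :: real
  assumes st: "cos t = \<alpha> * cos a' + \<beta> * cos b'" and one: "1 = \<alpha> * cos a + \<beta> * cos b"
    and \<alpha>: "\<alpha> * sin (a + b) = sin b" and \<beta>: "\<beta> * sin (a + b) = sin a"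
    and pos: "0 \<le> \<alpha>" "0 \<le> \<beta>"
    and ab: "0 < b0" "b0 \<le> 1" "b0 \<le> a" "b0 \<le> b" "a + b < pi"
    and t: "t \<le> 1" "\<bar>a' - a\<bar> \<le> t" "\<bar>b' - b\<bar> \<le> t"
  shows "a' + b' \<le> a + b + 16 * t\<^sup>2 / b0"
proof -
  define u v where "u = a' - a" and "v = b' - b"
  have uv: "\<bar>u\<bar> \<le> t" "\<bar>v\<bar> \<le> t" and t0: "0 \<le> t" "t \<le> pi" using t pi_gt3 unfolding u_def v_def by auto
  have sb: "b0 / 2 \<le> sin x" if x: "b0 \<le> x" "x \<le> pi - b0" for x
  proof (cases "x \<le> pi / 2")
    case True
    then show ?thesis using sin_ge_half[of x] x ab(1) by linarith
  next
    case False
    then show ?thesis using sin_ge_half[of "pi - x"] x ab(1) by (simp del: sin_gt_zero)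
  qed
  have sa: "b0 / 2 \<le> sin a" and sb: "b0 / 2 \<le> sin b" using sb ab by auto
  have sab: "0 < sin (a + b)" using ab by (intro sin_gt_zero) auto
  let ?X = "sin u + sin v"
  have ca: "cos a' = cos a * cos u - sin a * sin u" "cos b' = cos b * cos v - sin b * sin v"
    unfolding u_def v_def cos_add[symmetric] by simp_all
  have bnd: "c * (cos z - 1) \<le> 1 - cos t" if "\<bar>c\<bar> \<le> 1" "\<bar>z\<bar> \<le> t" for c z
  proof -
    have "c * (cos z - 1) \<le> \<bar>c\<bar> * \<bar>cos z - 1\<bar>" by (metis abs_ge_self abs_mult)
    also have "\<dots> \<le> 1 * \<bar>cos z - 1\<bar>" using that by (intro mult_right_mono) auto
    also have "\<dots> = 1 - cos z" by simp
    also have "\<dots> \<le> 1 - cos t" using cos_le_cos_of_abs_le[OF that(2) t0(2)] by simp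
    finally show ?thesis .
  qed
  \<comment> \<open>Multiplying by \<open>sin (a + b)\<close> turns \<alpha> and \<beta> into
    \<open>sin b\<close> and \<open>sin a\<close>, which gives \<open>sin u\<close> and
    \<open>sin v\<close> the common coefficient \<open>sin a * sin b\<close>.\<close>
  have "sin a * sin b * ?X = (\<alpha> * sin (a + b)) * sin a * sin u + (\<beta> * sin (a + b)) * sin b * sin v"
    unfolding \<alpha> \<beta> by (simp add: algebra_simps)
  also have "\<dots> = sin (a + b) * (\<alpha> * sin a * sin u + \<beta> * sin b * sin v)"
    by (simp only: distrib_left mult.commute mult.left_commute)
  also have "\<alpha> * sin a * sin u + \<beta> * sin b * sin v
      = \<alpha> * (cos a * (cos u - 1)) + \<beta> * (cos b * (cos v - 1)) + (1 - cos t)"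
  proof -
    have "\<alpha> * sin a * sin u + \<beta> * sin b * sin v = \<alpha> * (cos a * cos u) + \<beta> * (cos b * cos v) - cos t"
      unfolding st ca by (simp add: right_diff_distrib)
    then show ?thesis using one by (simp add: right_diff_distrib)
  qed
  also have "sin (a + b) * \<dots> \<le> sin (a + b) * (\<alpha> * (1 - cos t) + \<beta> * (1 - cos t) + (1 - cos t))"
    using sab pos uv by (intro mult_left_mono add_mono bnd) auto
  also have "\<dots> = (1 - cos t) * (\<alpha> * sin (a + b) + \<beta> * sin (a + b) + sin (a + b))"
    by (simp only: distrib_left mult.commute mult.left_commute)
  also have "\<dots> = (1 - cos t) * (sin b + sin a + sin (a + b))" unfolding \<alpha> \<beta> ..
  also have "\<dots> \<le> (1 - cos t) * (2 * (sin a + sin b))"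
  proof -
    have "sin (a + b) = sin a * cos b + cos a * sin b" by (rule sin_add)
    also have "\<dots> \<le> sin a * 1 + 1 * sin b"
      using sa sb ab by (intro add_mono mult_left_mono mult_right_mono) auto
    finally show ?thesis by (intro mult_left_mono) auto
  qed
  also have "\<dots> \<le> t\<^sup>2 / 2 * (2 * (sin a + sin b))"
    using one_minus_cos_le[of t] sa sb ab by (intro mult_right_mono) auto
  finally have "sin a * sin b * ?X \<le> t\<^sup>2 * (sin a + sin b)" by (simp add: algebra_simps)
  then have "?X \<le> t\<^sup>2 * (sin a + sin b) / (sin a * sin b)"
    using sa sb ab(1) by (subst pos_le_divide_eq) (auto simp: mult.commute)
  also have "\<dots> = t\<^sup>2 * (1 / sin b + 1 / sin a)" using sa sb ab(1) by (simp add: field_simps)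
  also have "\<dots> \<le> t\<^sup>2 * (2 / b0 + 2 / b0)"
    using sa sb ab(1) by (intro mult_left_mono add_mono) (auto simp: field_simps)
  finally have X: "?X \<le> 4 * t\<^sup>2 / b0" by (simp add: mult.commute)
  have "u + v \<le> 16 * t\<^sup>2 / b0"
  proof (cases "u + v \<le> 0")
    case True
    then show ?thesis using ab(1) by (smt (verit) divide_nonneg_pos zero_le_power2)
  next
    case False
    \<comment> \<open>Write sin u + sin v as 2 sin ((u + v) / 2) cos ((u - v) / 2). The cosine is at
      least 1 / 2 since its argument is at most 1 in modulus, so u + v is at most four times the sum
      of the sines.\<close>
    have "(u + v) / 2 / 2 \<le> sin ((u + v) / 2)"
      using False uv(1) uv(2) t(1) pi_gt3 by (intro sin_ge_half) (simp_all add: abs_le_iff)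
    moreover have "\<bar>u - v\<bar> \<le> 2" using uv t(1) by argo
    then have "\<bar>(u - v) / 2\<bar> \<le> pi / 3" unfolding abs_divide using pi_gt3 by simp
    then have "1 / 2 \<le> cos ((u - v) / 2)"
      using cos_le_cos_of_abs_le[of "(u - v) / 2" "pi / 3"] cos_60 by simp
    ultimately have "((u + v) / 2 / 2) * (1 / 2) \<le> sin ((u + v) / 2) * cos ((u - v) / 2)"
      using False by (intro mult_mono) auto
    then have "(u + v) / 4 \<le> ?X" unfolding sin_plus_sin by simp
    then show ?thesis using X by simp
  qed
  then show ?thesis unfolding u_def v_def by simp
qed

section \<open>Inner products and the metric of the unit sphere\<close>

definition ip :: "nat \<Rightarrow> (nat \<Rightarrow> real) \<Rightarrow> (nat \<Rightarrow> real) \<Rightarrow> real" where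
  "ip N x y = (\<Sum>i<N. x i * y i)"

lemma ip_commute: "ip N x y = ip N y x"
  unfolding ip_def by (simp add: mult.commute)

lemma ip_comb_left: "ip N (\<lambda>i. a * x i + b * y i) z = a * ip N x z + b * ip N y z"
  unfolding ip_def by (simp add: sum_distrib_left sum.distrib algebra_simps)

lemma ip_comb_right: "ip N z (\<lambda>i. a * x i + b * y i) = a * ip N z x + b * ip N z y"
  using ip_comb_left ip_commute by metis

lemma ip_self_nonneg: "0 \<le> ip N x x"
  unfolding ip_def by (simp add: sum_nonneg)

lemma ip_cauchy_schwarz: "\<bar>ip N x y\<bar> \<le> sqrt (ip N x x) * sqrt (ip N y y)"
proof -
  have "\<bar>ip N x y\<bar> \<le> (\<Sum>i<N. \<bar>x i\<bar> * \<bar>y i\<bar>)" unfolding ip_def by (metis (no_types, lifting) abs_mult sum.cong sum_abs)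
  also have "\<dots> \<le> L2_set x {..<N} * L2_set y {..<N}" by (rule L2_set_mult_ineq)
  finally show ?thesis unfolding ip_def L2_set_def by (simp add: power2_eq_square)
qed

context
  fixes d :: nat
begin

private abbreviation "N \<equiv> Suc d"
private abbreviation "SPH \<equiv> model_carrier Sph d"
private abbreviation "sdist \<equiv> model_dist Sph d"

lemma sph_dist: "sdist x y = arccos (ip N x y)"
  by (simp add: ip_def)

lemma sph_carrier: "x \<in> SPH \<longleftrightarrow> (\<forall>i\<ge>N. x i = 0) \<and> ip N x x = 1"
  by (simp add: ip_def power2_eq_square)

declare model_dist.simps(2)[simp del] model_carrier.simps(2)[simp del]

lemma sph_ip_le: assumes "x \<in> SPH" "y \<in> SPH" shows "\<bar>ip N x y\<bar> \<le> 1"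
  using ip_cauchy_schwarz[of N x y] assms sph_carrier by simp

lemma cos_sph_dist: assumes "x \<in> SPH" "y \<in> SPH" shows "cos (sdist x y) = ip N x y"
  unfolding sph_dist using sph_ip_le[OF assms] by simp

lemma sph_dist_bounds: assumes "x \<in> SPH" "y \<in> SPH" shows "0 \<le> sdist x y" "sdist x y \<le> pi"
  unfolding sph_dist using sph_ip_le[OF assms] by (auto intro: arccos_lbound arccos_ubound)

lemma sph_dist_sym: "sdist x y = sdist y x"
  unfolding sph_dist by (simp add: ip_commute)

lemma sin_sph_dist: assumes "x \<in> SPH" "y \<in> SPH" shows "sin (sdist x y) = sqrt (1 - (ip N x y)\<^sup>2)"
  unfolding sph_dist using sph_ip_le[OF assms] by (simp add: sin_arccos_abs)

text \<open>\<open>u\<close> and \<open>v\<close> are the components of x and z orthogonal to y.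
  Cauchy-Schwarz for them says that cos of the distance from x to z is at least cos of the sum of
  the other two distances; if that sum reaches \<pi> there is nothing to prove.\<close>

lemma sph_dist_triangle:
  assumes "x \<in> SPH" "y \<in> SPH" "z \<in> SPH"
  shows "sdist x z \<le> sdist x y + sdist y z"
proof (cases "pi \<le> sdist x y + sdist y z")
  case True
  then show ?thesis using sph_dist_bounds[of x z] assms by simp
next
  case False
  let ?a = "ip N x y" and ?b = "ip N y z"
  have n: "ip N x x = 1" "ip N y y = 1" "ip N z z = 1" using assms sph_carrier by auto
  define u v where "u i = 1 * x i + (- ?a) * y i" and "v i = 1 * z i + (- ?b) * y i" for i
  have uu: "ip N u u = 1 - ?a\<^sup>2" and vv: "ip N v v = 1 - ?b\<^sup>2" and uv: "ip N u v = ip N x z - ?a * ?b"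
    unfolding u_def v_def ip_comb_left ip_comb_right n
    by (simp_all add: ip_commute[of N y x] ip_commute[of N z y] power2_eq_square)
  have "cos (sdist x y + sdist y z) = ?a * ?b - sqrt (1 - ?a\<^sup>2) * sqrt (1 - ?b\<^sup>2)"
    unfolding cos_add using assms by (simp add: cos_sph_dist sin_sph_dist)
  also have "\<dots> \<le> ip N x z" using ip_cauchy_schwarz[of N u v] unfolding uu vv uv by linarith
  finally have "arccos (ip N x z) \<le> arccos (cos (sdist x y + sdist y z))"
    using sph_ip_le[of x z] assms by (intro arccos_le_arccos) auto
  also have "\<dots> = sdist x y + sdist y z"
    using False sph_dist_bounds[of x y] sph_dist_bounds[of y z] assms by (intro arccos_cos) auto
  finally show ?thesis unfolding sph_dist[of x z] .
qed

lemma sph_chord: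
  assumes "x \<in> SPH" "y \<in> SPH"
  shows "sqrt (\<Sum>i<N. (x i - y i)\<^sup>2) = 2 * sin (sdist x y / 2)"
proof -
  have "(\<Sum>i<N. (x i - y i)\<^sup>2) = ip N x x + ip N y y - 2 * ip N x y"
    unfolding ip_def power2_diff by (simp add: sum.distrib sum_subtractf sum_distrib_left power2_eq_square mult.assoc)
  also have "\<dots> = 2 - 2 * cos (2 * (sdist x y / 2))" using assms by (simp add: cos_sph_dist sph_carrier)
  also have "\<dots> = (2 * sin (sdist x y / 2))\<^sup>2" unfolding cos_double_sin by (simp add: power2_eq_square)
  finally have "sqrt (\<Sum>i<N. (x i - y i)\<^sup>2) = sqrt ((2 * sin (sdist x y / 2))\<^sup>2)" by (rule arg_cong)
  moreover have "0 \<le> 2 * sin (sdist x y / 2)" using sph_dist_bounds[OF assms] by (simp add: sin_ge_zero)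
  ultimately show ?thesis by (simp only: real_sqrt_abs abs_of_nonneg)
qed

lemma sph_lower:
  assumes "x \<in> SPH" "y \<in> SPH" "i < N"
  shows "\<bar>x i - y i\<bar> \<le> sdist x y"
proof -
  have "\<bar>x i - y i\<bar> \<le> sqrt (\<Sum>j<N. (x j - y j)\<^sup>2)" by (rule coordinate_le_sqrt[OF assms(3)])
  also have "\<dots> \<le> 2 * (sdist x y / 2)"
    unfolding sph_chord[OF assms(1,2)] using sph_dist_bounds[OF assms(1,2)] sin_x_le_x[of "sdist x y / 2"] by linarith
  finally show ?thesis by simp
qed

lemma sph_upper:
  assumes "x \<in> SPH" "y \<in> SPH" "\<And>i. i < N \<Longrightarrow> \<bar>x i - y i\<bar> \<le> r"
  shows "sdist x y \<le> 2 * real N * r"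
proof -
  have "sdist x y / 2 / 2 \<le> sin (sdist x y / 2)"
    using sph_dist_bounds[OF assms(1,2)] by (intro sin_ge_half) auto
  then have "sdist x y \<le> 2 * sqrt (\<Sum>i<N. (x i - y i)\<^sup>2)" unfolding sph_chord[OF assms(1,2)] by simp
  also have "sqrt (\<Sum>i<N. (x i - y i)\<^sup>2) \<le> (\<Sum>i<N. \<bar>x i - y i\<bar>)"
    using L2_set_le_sum_abs[of "\<lambda>i. x i - y i" "{..<N}"] unfolding L2_set_def .
  also have "\<dots> \<le> real N * r" using assms(3) sum_bounded_above[of "{..<N}" "\<lambda>i. \<bar>x i - y i\<bar>" r] by simp
  finally show ?thesis by (simp only: mult.assoc)
qed

text \<open>A nonnegative combination of p and q of norm 1 lies on the arc between them, and its
  weights are ratios of sines. Both facts about weights follow by comparing squares.\<close>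

lemma sph_between:
  assumes p: "p \<in> SPH" and q: "q \<in> SPH" and y: "y \<in> SPH" "y = (\<lambda>i. \<alpha> * p i + \<beta> * q i)" "0 \<le> \<alpha>" "0 \<le> \<beta>"
    and D: "0 < sdist p q" "sdist p q < pi"
  shows "\<alpha> * sin (sdist p q) = sin (sdist y q)" "\<beta> * sin (sdist p q) = sin (sdist p y)" "sdist p y + sdist y q = sdist p q"
proof -
  let ?c = "ip N p q"
  have n: "ip N p p = 1" "ip N q q = 1" "ip N y y = 1" using p q y(1) sph_carrier by auto
  have norm: "\<alpha>\<^sup>2 + \<beta>\<^sup>2 + 2 * \<alpha> * \<beta> * ?c = 1"
    using n(3) unfolding y(2) ip_comb_left ip_comb_right n(1,2) ip_commute[of N q p] by algebra
  have py: "ip N p y = \<alpha> + \<beta> * ?c" and yq: "ip N y q = \<alpha> * ?c + \<beta>"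
    unfolding y(2) ip_comb_left ip_comb_right n(1,2) by simp_all
  have s: "0 \<le> sin (sdist p q)" "0 \<le> sin (sdist p y)" "0 \<le> sin (sdist y q)"
    using sph_dist_bounds p q y(1) by (auto intro!: sin_ge_zero)
  have sq: "(sin (sdist u v))\<^sup>2 = 1 - (ip N u v)\<^sup>2" if "u \<in> SPH" "v \<in> SPH" for u v
    unfolding sin_squared_eq cos_sph_dist[OF that] ..
  have "(\<alpha> * sin (sdist p q))\<^sup>2 = (sin (sdist y q))\<^sup>2"
    unfolding power_mult_distrib sq[OF p q] sq[OF y(1) q] yq using norm by algebra
  then show A: "\<alpha> * sin (sdist p q) = sin (sdist y q)" using s y(3) by simp
  have "(\<beta> * sin (sdist p q))\<^sup>2 = (sin (sdist p y))\<^sup>2"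
    unfolding power_mult_distrib sq[OF p q] sq[OF p y(1)] py using norm by algebra
  then show B: "\<beta> * sin (sdist p q) = sin (sdist p y)" using s y(4) by simp
  let ?s = "sdist p y + sdist y q"
  have "sin ?s = sin (sdist p q)"
    unfolding sin_add cos_sph_dist[OF p y(1)] cos_sph_dist[OF y(1) q] py yq A[symmetric] B[symmetric]
    using norm by algebra
  moreover have "cos ?s = cos (sdist p q)"
    unfolding cos_add cos_sph_dist[OF p y(1)] cos_sph_dist[OF y(1) q] cos_sph_dist[OF p q] py yq A[symmetric] B[symmetric]
    using norm sq[OF p q] by algebra
  \<comment> \<open>The two angles agree modulo 2 \<pi>, and their ranges exclude every multiple but
    0.\<close>
  ultimately obtain n :: int where n: "?s = sdist p q + 2 * pi * n" using sin_cos_eq_iff by blast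
  have "- pi < 2 * pi * n" "2 * pi * n < 2 * pi"
    using n D sph_dist_bounds[OF p y(1)] sph_dist_bounds[OF y(1) q] by linarith+
  then have "pi * (- 1) < pi * (2 * real_of_int n)" "(2 * pi) * real_of_int n < (2 * pi) * 1" by simp_all
  then have "- 1 < 2 * real_of_int n" "real_of_int n < 1" using pi_gt_zero by (simp_all only: mult_less_cancel_left_pos)
  then have "n = 0" by linarith
  then show "?s = sdist p q" using n by simp
qed

text \<open>Project the chord from p to q radially to the sphere. Coordinate i then runs
  continuously, though not linearly, from p i to q i, so the intermediate value theorem finds the
  wall. As p and q are not antipodal, the chord avoids the origin, which is
  \<open>mpos\<close>.\<close>

lemma sph_cross:
  assumes p: "p \<in> SPH" and q: "q \<in> SPH" and ap: "- 1 < ip N p q" and u: "0 \<le> u" "u \<le> 1"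
  obtains y \<alpha> \<beta> where "y \<in> SPH" "y = (\<lambda>j. \<alpha> * p j + \<beta> * q j)" "0 \<le> \<alpha>" "0 \<le> \<beta>" "y i = p i + u * (q i - p i)"
proof -
  define m where "m \<tau> = (1 - \<tau>)\<^sup>2 + \<tau>\<^sup>2 + 2 * \<tau> * (1 - \<tau>) * ip N p q" for \<tau> :: real
  define f where "f \<tau> = ((1 - \<tau>) * p i + \<tau> * q i) / sqrt (m \<tau>)" for \<tau>
  have n: "ip N p p = 1" "ip N q q = 1" using p q sph_carrier by auto
  have mpos: "0 < m \<tau>" if "0 \<le> \<tau>" "\<tau> \<le> 1" for \<tau>
  proof -
    have "0 \<le> \<tau> * (1 - \<tau>)" using that by simp
    moreover have "0 \<le> 1 - 4 * (\<tau> * (1 - \<tau>))"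
    proof -
      have "1 - 4 * (\<tau> * (1 - \<tau>)) = (1 - 2 * \<tau>)\<^sup>2" by algebra
      then show ?thesis by simp
    qed
    moreover have "m \<tau> = (1 - 4 * (\<tau> * (1 - \<tau>))) + 2 * (\<tau> * (1 - \<tau>)) * (1 + ip N p q)"
      unfolding m_def by algebra
    moreover have "0 \<le> (\<tau> * (1 - \<tau>)) * (1 + ip N p q)" using ap that by simp
    moreover have "0 < (\<tau> * (1 - \<tau>)) * (1 + ip N p q)" if "0 < \<tau> * (1 - \<tau>)" using ap that by simp
    ultimately show ?thesis by (cases "\<tau> * (1 - \<tau>) = 0") auto
  qed
  have cont: "continuous_on {0..1} f"
    unfolding f_def m_def using mpos unfolding m_def
    by (intro continuous_intros) force
  have f01: "f 0 = p i" "f 1 = q i" unfolding f_def m_def by simp_all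
  define c where "c = p i + u * (q i - p i)"
  have "\<exists>\<tau>. 0 \<le> \<tau> \<and> \<tau> \<le> 1 \<and> f \<tau> = c"
  proof (cases "p i \<le> q i")
    case True
    have "u * (q i - p i) \<le> 1 * (q i - p i)" "0 \<le> u * (q i - p i)"
      using True u by (intro mult_right_mono mult_nonneg_nonneg; simp)+
    then show ?thesis using IVT'[of f 0 c 1] cont f01 unfolding c_def by force
  next
    case False
    have "u * (p i - q i) \<le> 1 * (p i - q i)" "0 \<le> u * (p i - q i)"
      using False u by (intro mult_right_mono mult_nonneg_nonneg; simp)+
    then have "f 1 \<le> c" "c \<le> f 0" unfolding c_def f01 by (simp_all add: algebra_simps)
    then show ?thesis using IVT2'[of f 1 c 0] cont by force
  qed
  then obtain \<tau> where \<tau>: "0 \<le> \<tau>" "\<tau> \<le> 1" "f \<tau> = c" by blast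
  define \<alpha> \<beta> where "\<alpha> = (1 - \<tau>) / sqrt (m \<tau>)" and "\<beta> = \<tau> / sqrt (m \<tau>)"
  define y where "y = (\<lambda>j. \<alpha> * p j + \<beta> * q j)"
  have r: "sqrt (m \<tau>) \<noteq> 0" "(sqrt (m \<tau>))\<^sup>2 = m \<tau>" using mpos[OF \<tau>(1,2)] by auto
  have scale: "(x / r)\<^sup>2 + (y / r)\<^sup>2 + 2 * (x / r) * (y / r) * c = (x\<^sup>2 + y\<^sup>2 + 2 * y * x * c) / r\<^sup>2" for x y r c :: real
    by (simp add: power_divide add_divide_distrib power2_eq_square mult_ac)
  have "ip N y y = \<alpha>\<^sup>2 + \<beta>\<^sup>2 + 2 * \<alpha> * \<beta> * ip N p q"
    unfolding y_def ip_comb_left ip_comb_right n ip_commute[of N q p] by algebra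
  also have "\<dots> = m \<tau> / (sqrt (m \<tau>))\<^sup>2"
    unfolding \<alpha>_def \<beta>_def scale unfolding m_def[of \<tau>] ..
  also have "\<dots> = 1" using r mpos[OF \<tau>(1,2)] by simp
  finally have "y \<in> SPH" using p q by (simp add: sph_carrier y_def)
  moreover have "0 \<le> \<alpha>" "0 \<le> \<beta>" unfolding \<alpha>_def \<beta>_def using \<tau> mpos[OF \<tau>(1,2)] by auto
  moreover have "y i = c" using \<tau>(3) unfolding y_def \<alpha>_def \<beta>_def f_def by (simp add: add_divide_distrib)
  ultimately show thesis using that y_def c_def by blast
qed

text \<open>For antipodal p and q every point of the sphere is on a shortest path, so any point y of
  the wall serves; a second coordinate is used to give it norm 1. Otherwise both legs are at least w
  / 18, as y divides the difference in coordinate i inside its middle third, and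
  \<open>spherical_excess\<close> applies with 288 = 16 * 18.\<close>

lemma sph_wall_point:
  assumes d: "1 \<le> d" and p: "p \<in> SPH" and q: "q \<in> SPH" and i: "i < N" and u: "1 / 3 \<le> u" "u \<le> 2 / 3"
    and w: "0 < w" "w / 6 < \<bar>p i - q i\<bar>"
  obtains y where "y \<in> SPH" "y i = p i + u * (q i - p i)" "sdist p y \<le> sdist p q"
    "\<And>s. s \<in> SPH \<Longrightarrow> sdist y s \<le> 1 \<Longrightarrow> sdist p s + sdist s q \<le> sdist p q + 288 * (sdist y s)\<^sup>2 / w"
proof -
  have Dlow: "\<bar>p i - q i\<bar> \<le> sdist p q" using sph_lower[OF p q i] .
  have abs1: "\<bar>x i\<bar> \<le> 1" if "x \<in> SPH" for x
  proof -
    have "x i * x i \<le> ip N x x" unfolding ip_def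
      by (rule member_le_sum[of i "{..<N}" "\<lambda>i. x i * x i"]) (use i in auto)
    then have "(x i)\<^sup>2 \<le> 1\<^sup>2" using that sph_carrier by (simp add: power2_eq_square)
    then show ?thesis by (simp add: abs_square_le_1)
  qed
  let ?c = "p i + u * (q i - p i)"
  show thesis
  proof (cases "ip N p q = -1")
    case True
    have opp: "ip N s q = - ip N p s" if "s \<in> SPH" for s
    proof -
      \<comment> \<open>The vector p + q has norm 0, hence inner product 0 with everything.\<close>
      let ?v = "\<lambda>i. 1 * p i + 1 * q i"
      have "ip N ?v ?v = 0" unfolding ip_comb_left ip_comb_right using p q True ip_commute[of N q p] by (simp add: sph_carrier)
      then have "ip N s ?v = 0" using ip_cauchy_schwarz[of N s ?v] by simp
      then show ?thesis unfolding ip_comb_right using ip_commute[of N s p] by simp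
    qed
    have pi: "sdist p s + sdist s q = sdist p q" if "s \<in> SPH" for s
      unfolding sph_dist opp[OF that] True using sph_ip_le[OF p that] by (simp add: arccos_minus)
    obtain j where j: "j < N" "j \<noteq> i" using d by (metis One_nat_def Suc_le_eq less_Suc_eq_0_disj not_less_eq zero_less_Suc nat_neq_iff)
    have "\<bar>?c\<bar> \<le> 1"
    proof -
      have "?c = (1 - u) * p i + u * q i" by algebra
      also have "\<bar>\<dots>\<bar> \<le> (1 - u) * \<bar>p i\<bar> + u * \<bar>q i\<bar>" using u abs_triangle_ineq[of "(1 - u) * p i" "u * q i"] by (simp add: abs_mult)
      also have "\<dots> \<le> (1 - u) * 1 + u * 1" using u abs1 p q by (intro add_mono mult_left_mono) auto
      finally show ?thesis by simp
    qed
    then have c1: "?c * ?c \<le> 1" by (metis abs_mult_self_eq abs_ge_zero mult_le_one)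
    define y where "y l = (if l = i then ?c else if l = j then sqrt (1 - ?c * ?c) else 0)" for l
    have "ip N y y = (\<Sum>l\<in>{i, j}. y l * y l)"
      unfolding ip_def by (rule sum.mono_neutral_right) (use i j in \<open>auto simp: y_def\<close>)
    also have "\<dots> = 1" using j c1 by (simp add: y_def)
    finally have "y \<in> SPH" unfolding sph_carrier using i j by (auto simp: y_def)
    then show thesis
    proof (rule that)
      show "y i = ?c" unfolding y_def by simp
      show "sdist p y \<le> sdist p q" using pi[OF \<open>y \<in> SPH\<close>] sph_dist_bounds[OF \<open>y \<in> SPH\<close> q] by linarith
      show "sdist p s + sdist s q \<le> sdist p q + 288 * (sdist y s)\<^sup>2 / w" if "s \<in> SPH" for s using pi[OF that] w by simp
    qed
  next
    case False
    then have ap: "- 1 < ip N p q" using sph_ip_le[OF p q] by linarith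
    obtain y \<alpha> \<beta> where y: "y \<in> SPH" "y = (\<lambda>j. \<alpha> * p j + \<beta> * q j)" "0 \<le> \<alpha>" "0 \<le> \<beta>" "y i = ?c"
      using sph_cross[OF p q ap, of u i] u by auto
    have D: "0 < sdist p q" "sdist p q < pi"
    proof -
      show "0 < sdist p q" using Dlow w by linarith
      show "sdist p q < pi" using arccos_less_arccos[OF _ ap] sph_ip_le[OF p q] by (simp add: sph_dist)
    qed
    note bt = sph_between[OF p q y(1-4) D]
    have "p i - y i = u * (p i - q i)" "y i - q i = (1 - u) * (p i - q i)" unfolding y(5) by algebra+
    then have "\<bar>p i - y i\<bar> = u * \<bar>p i - q i\<bar>" "\<bar>y i - q i\<bar> = (1 - u) * \<bar>p i - q i\<bar>"
      using u by (simp_all add: abs_mult)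
    moreover have "1 / 3 * \<bar>p i - q i\<bar> \<le> u * \<bar>p i - q i\<bar>" "1 / 3 * \<bar>p i - q i\<bar> \<le> (1 - u) * \<bar>p i - q i\<bar>"
      using u by (intro mult_right_mono; simp)+
    ultimately have far: "w / 18 \<le> sdist p y" "w / 18 \<le> sdist y q"
      using sph_lower[OF p y(1) i] sph_lower[OF y(1) q i] w(2) by linarith+
    have w1: "w / 18 \<le> 1" using abs1[OF p] abs1[OF q] w(2) by linarith
    show thesis
    proof (rule that[OF y(1,5)])
      show "sdist p y \<le> sdist p q" using bt(3) sph_dist_bounds[OF y(1) q] by linarith
      fix s assume s: "s \<in> SPH" "sdist y s \<le> 1"
      have "sdist p s + sdist s q \<le> sdist p y + sdist y q + 16 * (sdist y s)\<^sup>2 / (w / 18)"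
      proof (rule spherical_excess[where \<alpha> = \<alpha> and \<beta> = \<beta>])
        have yz: "ip N y z = \<alpha> * ip N p z + \<beta> * ip N z q" for z
          unfolding y(2) ip_comb_left ip_commute[of N z q] ..
        show "cos (sdist y s) = \<alpha> * cos (sdist p s) + \<beta> * cos (sdist s q)"
          unfolding cos_sph_dist[OF y(1) s(1)] cos_sph_dist[OF p s(1)] cos_sph_dist[OF s(1) q] by (rule yz)
        show "1 = \<alpha> * cos (sdist p y) + \<beta> * cos (sdist y q)"
          unfolding cos_sph_dist[OF p y(1)] cos_sph_dist[OF y(1) q]
          using yz[of y] y(1) sph_carrier by simp
        show "\<bar>sdist p s - sdist p y\<bar> \<le> sdist y s"
          using sph_dist_triangle[OF p y(1) s(1)] sph_dist_triangle[OF p s(1) y(1)] sph_dist_sym[of s y] by linarith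
        show "\<bar>sdist s q - sdist y q\<bar> \<le> sdist y s"
          using sph_dist_triangle[OF y(1) s(1) q] sph_dist_triangle[OF s(1) y(1) q] sph_dist_sym[of s y] by linarith
      qed (use bt y w w1 far s D in auto)
      then show "sdist p s + sdist s q \<le> sdist p q + 288 * (sdist y s)\<^sup>2 / w" unfolding bt(3) by simp
    qed
  qed
qed

text \<open>On the wall \<open>y i = c\<close> the coordinate of largest modulus among the others is determined, up to
  sign and in a Lipschitz way, by the remaining \<open>d - 1\<close> coordinates.\<close>

lemma sph_dominant_close:
  assumes SPH: "y \<in> SPH" "s \<in> SPH" and i: "i < N" "y i = s i" and j: "j < N" "j \<noteq> i"
    and dom: "\<And>l. l < N \<Longrightarrow> l \<noteq> i \<Longrightarrow> \<bar>y l\<bar> \<le> \<bar>y j\<bar>" "\<And>l. l < N \<Longrightarrow> l \<noteq> i \<Longrightarrow> \<bar>s l\<bar> \<le> \<bar>s j\<bar>"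
    and sgn: "(0 \<le> y j) = (0 \<le> s j)" and \<theta>: "0 \<le> \<theta>"
    and close: "\<And>l. l \<in> {..<N} - {i, j} \<Longrightarrow> \<bar>y l - s l\<bar> \<le> \<theta>"
  shows "\<bar>y j - s j\<bar> \<le> real N * \<theta>"
proof -
  let ?J = "{..<N} - {i, j}" and ?m = "\<bar>y j\<bar> + \<bar>s j\<bar>"
  have split: "1 = x i * x i + (x j * x j + (\<Sum>l\<in>?J. x l * x l))" if "x \<in> SPH" for x
  proof -
    have "ip N x x = x i * x i + (\<Sum>l\<in>{..<N} - {i}. x l * x l)"
      unfolding ip_def using i(1) by (intro sum.remove) auto
    also have "(\<Sum>l\<in>{..<N} - {i}. x l * x l) = x j * x j + (\<Sum>l\<in>{..<N} - {i} - {j}. x l * x l)"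
      using j by (intro sum.remove) auto
    also have "{..<N} - {i} - {j} = ?J" by auto
    finally show ?thesis using that sph_carrier by simp
  qed
  \<comment> \<open>Compare squares through the norm equation. By dominance each remaining
    coordinate satisfies \<bar>y l + s l\<bar> \<le> \<open>?m\<close>, so every summand carries the
    factor \<open>?m\<close>, which cancels in the end.\<close>
  have "\<bar>y j - s j\<bar> * ?m = \<bar>y j * y j - s j * s j\<bar>"
  proof -
    have "\<bar>y j + s j\<bar> = ?m" using sgn by auto
    then have "\<bar>y j - s j\<bar> * ?m = \<bar>(y j - s j) * (y j + s j)\<bar>" by (simp add: abs_mult)
    then show ?thesis by (simp add: algebra_simps)
  qed
  also have "y j * y j - s j * s j = (\<Sum>l\<in>?J. s l * s l - y l * y l)"
    using split[OF SPH(1)] split[OF SPH(2)] i(2) unfolding sum_subtractf by simp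
  also have "\<bar>\<dots>\<bar> \<le> (\<Sum>l\<in>?J. \<bar>s l * s l - y l * y l\<bar>)" by (rule sum_abs)
  also have "\<dots> \<le> (\<Sum>l\<in>?J. \<theta> * ?m)"
  proof (rule sum_mono)
    fix l assume l: "l \<in> ?J"
    have "\<bar>s l * s l - y l * y l\<bar> = \<bar>y l - s l\<bar> * \<bar>y l + s l\<bar>"
      unfolding abs_mult[symmetric] by (subst abs_minus_cancel[symmetric]) (simp add: algebra_simps)
    also have "\<dots> \<le> \<theta> * ?m"
      using close[OF l] dom[of l] l \<theta> by (intro mult_mono) auto
    finally show "\<bar>s l * s l - y l * y l\<bar> \<le> \<theta> * ?m" .
  qed
  also have "\<dots> = real (card ?J) * (\<theta> * ?m)" by simp
  also have "\<dots> \<le> real N * (\<theta> * ?m)"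
  proof -
    have "card ?J \<le> card {..<N}" by (intro card_mono) auto
    then show ?thesis using \<theta> by (intro mult_right_mono) auto
  qed
  finally have le: "\<bar>y j - s j\<bar> * ?m \<le> (real N * \<theta>) * ?m" by (simp only: mult.assoc)
  show ?thesis
  proof (cases "?m = 0")
    case True
    then have "y j = 0" "s j = 0" by linarith+
    then show ?thesis using \<theta> by simp
  next
    case False
    then show ?thesis using le by (intro mult_right_le_imp_le[OF le]) auto
  qed
qed

lemma sph_net:
  assumes d: "2 \<le> d" and e: "0 < \<epsilon>" "\<epsilon> \<le> 1" and w: "0 < w"
  shows "\<exists>S\<subseteq>SPH. finite S \<and>
     real (card S) \<le> 50 * real N ^ 2 * (1200 * real N ^ 3 / sqrt \<epsilon> + 2) ^ (d - 1) \<and>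
     (\<forall>p\<in>SPH. \<forall>q\<in>SPH. in_box N o' w p \<longrightarrow> in_box N o' w q \<longrightarrow> (\<exists>i<N. w / 6 < \<bar>p i - q i\<bar>) \<longrightarrow>
        (\<exists>s\<in>S. sdist p s + sdist s q \<le> (1 + \<epsilon> / 4) * sdist p q))"
proof -
  \<comment> \<open>One factor \<open>N\<close> is lost in \<open>sph_dominant_close\<close> and one
    in \<open>sph_upper\<close>; together they give a net distance of \<surd>\<epsilon> w /
    100.\<close>
  define \<theta> where "\<theta> = sqrt \<epsilon> * w / (200 * real N ^ 2)"
  have \<theta>: "0 < \<theta>" unfolding \<theta>_def using e w by (intro divide_pos_pos mult_pos_pos) auto
  \<comment> \<open>An index fixes the wall (i, k), the dominant coordinate j and its sign b. The
    arc may bulge out of the cube, but y stays within 2 N w of p, hence the radius 3 N w.\<close>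
  define Y where "Y x = (case x of (i, k, j, b) \<Rightarrow> {y\<in>SPH. y i = o' i + real k * w / 24 \<and>
      (\<forall>l<N. \<bar>y l - o' l\<bar> \<le> 3 * real N * w) \<and> (\<forall>l<N. l \<noteq> i \<longrightarrow> \<bar>y l\<bar> \<le> \<bar>y j\<bar>) \<and> (0 \<le> y j) = b})"
    for x :: "nat \<times> nat \<times> nat \<times> bool"
  define J where "J x = (case x of (i, k, j, b) \<Rightarrow> {..<N} - {i, j})" for x :: "nat \<times> nat \<times> nat \<times> bool"
  have "\<exists>S\<subseteq>Y x. finite S \<and> real (card S) \<le> (2 * (3 * real N * w) / \<theta> + 2) ^ card (J x) \<and>
    (\<forall>y\<in>Y x. \<exists>s\<in>S. \<forall>j\<in>J x. \<bar>y j - s j\<bar> \<le> \<theta>)" for x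
  proof (rule grid_net[where o' = o'])
    show "finite (J x)" unfolding J_def by (simp split: prod.splits)
    show "\<bar>y j - o' j\<bar> \<le> 3 * real N * w" if "y \<in> Y x" "j \<in> J x" for y j
      using that unfolding Y_def J_def by (auto split: prod.splits)
  qed (use \<theta> w in auto)
  then obtain Z where Z: "\<And>x. Z x \<subseteq> Y x \<and> finite (Z x) \<and> real (card (Z x)) \<le> (2 * (3 * real N * w) / \<theta> + 2) ^ card (J x) \<and>
    (\<forall>y\<in>Y x. \<exists>s\<in>Z x. \<forall>j\<in>J x. \<bar>y j - s j\<bar> \<le> \<theta>)" by metis
  define I where "I = {x :: nat \<times> nat \<times> nat \<times> bool. case x of (i, k, j, b) \<Rightarrow> i < N \<and> k \<le> 24 \<and> j < N \<and> j \<noteq> i}"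
  have Isub: "I \<subseteq> {..<N} \<times> {..24} \<times> {..<N} \<times> UNIV" unfolding I_def by auto
  have finI: "finite I" by (rule finite_subset[OF Isub]) auto
  have "card I \<le> card ({..<N} \<times> {..24::nat} \<times> {..<N} \<times> (UNIV :: bool set))" by (rule card_mono[OF _ Isub]) auto
  also have "\<dots> = 50 * N ^ 2" by (simp add: power2_eq_square algebra_simps)
  finally have cI: "real (card I) \<le> 50 * real N ^ 2"
    using of_nat_mono[of "card I" "50 * N ^ 2", where 'a = real] by (simp del: of_nat_Suc)
  define S where "S = (\<Union>x\<in>I. Z x)"
  have ratio: "2 * (3 * real N * w) / \<theta> = 1200 * real N ^ 3 / sqrt \<epsilon>"
    unfolding \<theta>_def using w e by (simp add: field_simps power2_eq_square power3_eq_cube del: of_nat_Suc)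
  have "real (card (Z x)) \<le> (1200 * real N ^ 3 / sqrt \<epsilon> + 2) ^ (d - 1)" if "x \<in> I" for x
  proof -
    obtain i k j b where x: "x = (i, k, j, b)" by (cases x)
    have "card (J x) = card {..<N} - card {i, j}"
      unfolding J_def x using that by (simp only: prod.case) (rule card_Diff_subset, auto simp: I_def x)
    also have "\<dots> = d - 1" using that by (simp add: I_def x)
    finally show ?thesis using Z[of x] unfolding ratio by simp
  qed
  then have "real (card S) \<le> (1200 * real N ^ 3 / sqrt \<epsilon> + 2) ^ (d - 1) * real (card I)"
    unfolding S_def by (intro real_card_UN_le finI)
  also have "\<dots> \<le> (1200 * real N ^ 3 / sqrt \<epsilon> + 2) ^ (d - 1) * (50 * real N ^ 2)"
    using cI e by (intro mult_left_mono) auto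
  finally have cS: "real (card S) \<le> 50 * real N ^ 2 * (1200 * real N ^ 3 / sqrt \<epsilon> + 2) ^ (d - 1)"
    by (simp only: mult.commute)
  have main: "\<exists>s\<in>S. sdist p s + sdist s q \<le> (1 + \<epsilon> / 4) * sdist p q"
    if p: "p \<in> SPH" "in_box N o' w p" and q: "q \<in> SPH" "in_box N o' w q" and i: "i < N" "w / 6 < \<bar>p i - q i\<bar>" for p q i
  proof -
    obtain k u where k: "k \<le> 24" and u: "1 / 3 \<le> u" "u \<le> 2 / 3" "o' i + real k * w / 24 = p i + u * (q i - p i)"
      by (rule wall_between[OF w, of "o' i" "p i" "q i"]) (use p q i in \<open>auto simp: in_box_def\<close>)
    obtain y where y: "y \<in> SPH" "y i = p i + u * (q i - p i)" "sdist p y \<le> sdist p q"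
      and ex: "\<And>s. s \<in> SPH \<Longrightarrow> sdist y s \<le> 1 \<Longrightarrow> sdist p s + sdist s q \<le> sdist p q + 288 * (sdist y s)\<^sup>2 / w"
      using sph_wall_point[of p q i u w] d p q i u w by (metis One_nat_def Suc_1 Suc_leD)
    have pq: "sdist p q \<le> 2 * real N * w"
    proof (rule sph_upper[OF p(1) q(1)])
      show "\<bar>p l - q l\<bar> \<le> w" if "l < N" for l
        using p(2) q(2) that unfolding in_box_def by (smt (verit))
    qed
    have ybox: "\<bar>y l - o' l\<bar> \<le> 3 * real N * w" if l: "l < N" for l
    proof -
      have "\<bar>p l - y l\<bar> \<le> 2 * real N * w" using sph_lower[OF p(1) y(1) l] y(3) pq by linarith
      moreover have "\<bar>p l - o' l\<bar> \<le> w" using p(2) l unfolding in_box_def by (smt (verit))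
      moreover have "w \<le> real N * w" using w by simp
      ultimately show ?thesis by linarith
    qed
    have "finite ((\<lambda>l. \<bar>y l\<bar>) ` ({..<N} - {i}))" "(\<lambda>l. \<bar>y l\<bar>) ` ({..<N} - {i}) \<noteq> {}"
    proof -
      have "card ({..<N} - {i}) = d" using i(1) by simp
      then have "{..<N} - {i} \<noteq> {}" using d by (metis card.empty not_numeral_le_zero)
      then show "(\<lambda>l. \<bar>y l\<bar>) ` ({..<N} - {i}) \<noteq> {}" by blast
    qed simp
    from Max_in[OF this] obtain j where "j \<in> {..<N} - {i}" "Max ((\<lambda>l. \<bar>y l\<bar>) ` ({..<N} - {i})) = \<bar>y j\<bar>"
      by (rule imageE)
    then have j: "j < N" "j \<noteq> i" "\<bar>y j\<bar> = Max ((\<lambda>l. \<bar>y l\<bar>) ` ({..<N} - {i}))" by simp_all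
    have dom: "\<bar>y l\<bar> \<le> \<bar>y j\<bar>" if "l < N" "l \<noteq> i" for l
      unfolding j(3) using that by (intro Max_ge) auto
    define x where "x = (i, k, j, 0 \<le> y j)"
    have xI: "x \<in> I" unfolding x_def I_def using i k j by simp
    have yY: "y \<in> Y x" unfolding Y_def x_def using y u(3) ybox dom by simp
    obtain s where s: "s \<in> Z x" "\<forall>l\<in>J x. \<bar>y l - s l\<bar> \<le> \<theta>" using Z[of x] yY by blast
    have sY: "s \<in> Y x" using s(1) Z by blast
    then have sX: "s \<in> SPH" unfolding Y_def x_def by auto
    have yj: "\<bar>y j - s j\<bar> \<le> real N * \<theta>"
      by (rule sph_dominant_close[OF y(1) sX i(1) _ j(1,2)])
        (use sY yY s(2) dom \<theta> in \<open>auto simp: Y_def J_def x_def\<close>)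
    have near: "\<bar>y l - s l\<bar> \<le> real N * \<theta>" if "l < N" for l
    proof -
      have "\<theta> \<le> real N * \<theta>" "0 \<le> real N * \<theta>" using \<theta> by simp_all
      moreover have "y i = s i" using sY yY unfolding Y_def x_def by simp
      moreover have "\<bar>y l - s l\<bar> \<le> \<theta>" if "l \<noteq> i" "l \<noteq> j" using s(2) that \<open>l < N\<close> unfolding J_def x_def by simp
      ultimately show ?thesis using yj by (cases "l = i"; cases "l = j") auto
    qed
    have t: "sdist y s \<le> sqrt \<epsilon> * w / 100"
    proof -
      have "sdist y s \<le> 2 * real N * (real N * \<theta>)" by (rule sph_upper[OF y(1) sX near])
      also have "\<dots> = sqrt \<epsilon> * w / 100" unfolding \<theta>_def by (simp add: power2_eq_square del: of_nat_Suc)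
      finally show ?thesis .
    qed
    have D: "w / 6 < sdist p q" using i(2) sph_lower[OF p(1) q(1) i(1)] by linarith
    \<comment> \<open>The excess estimate needs net distances of at most 1. The bounded diameter of
      the sphere provides this: w / 6 is less than a distance, and \<pi> < 4.\<close>
    have "w \<le> 24" using D sph_dist_bounds[OF p(1) q(1)] pi_less_4 by linarith
    moreover have se: "sqrt \<epsilon> \<le> 1" using e by simp
    ultimately have "sqrt \<epsilon> * w \<le> 1 * 24" using w e by (intro mult_mono) auto
    then have "sdist y s \<le> 1" using t by linarith
    from ex[OF sX this] have "sdist p s + sdist s q \<le> sdist p q + 288 * (sdist y s)\<^sup>2 / w" .
    also have "288 * (sdist y s)\<^sup>2 / w \<le> 288 * (sqrt \<epsilon> * w / 100)\<^sup>2 / w"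
      using t sph_dist_bounds[OF y(1) sX] w by (intro divide_right_mono mult_left_mono power_mono) auto
    also have "\<dots> = \<epsilon> * w * (288 / 10000)"
      using e w by (simp add: power_mult_distrib power_divide power2_eq_square)
    also have "\<dots> \<le> \<epsilon> / 4 * sdist p q"
    proof -
      have "\<epsilon> * (w / 6) \<le> \<epsilon> * sdist p q" using D e by (intro mult_left_mono) auto
      moreover have "0 \<le> \<epsilon> * w" using e w by simp
      ultimately show ?thesis by simp
    qed
    finally have "sdist p s + sdist s q \<le> (1 + \<epsilon> / 4) * sdist p q" by (simp add: distrib_right)
    moreover have "s \<in> S" using s(1) xI unfolding S_def by blast
    ultimately show ?thesis by blast
  qed
  show ?thesis
  proof (intro exI[of _ S] conjI ballI impI)
    show "S \<subseteq> SPH" using Z unfolding S_def Y_def by (fastforce split: prod.splits)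
    show "finite S" using Z finI unfolding S_def by blast
    show "real (card S) \<le> 50 * real N ^ 2 * (1200 * real N ^ 3 / sqrt \<epsilon> + 2) ^ (d - 1)" by (rule cS)
  qed (use main in blast)
qed

lemma sph_has_spanners:
  assumes d: "2 \<le> d" and e: "0 < \<epsilon>" "\<epsilon> \<le> 1" and M: "192 * real N / \<epsilon> \<le> 2 ^ M"
  shows "has_spanners SPH sdist (1 + \<epsilon>)
    (2 ^ N * (4 * (50 * real N ^ 2 * (1200 * real N ^ 3 / sqrt \<epsilon> + 2) ^ (d - 1)) * real (M + 3)))"
proof (rule chordal_has_spanners[OF sph_dist_sym sph_dist_triangle sph_dist_bounds(1) _ sph_lower sph_upper sph_net[OF d e] _ e M])
  show "\<exists>i<N. x i \<noteq> y i" if "x \<in> SPH" "y \<in> SPH" "x \<noteq> y" for x y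
  proof (rule ccontr)
    assume "\<not> ?thesis"
    then have "x i = y i" for i using that(1,2) unfolding sph_carrier by (cases "i < N") auto
    then show False using that(3) by auto
  qed
  have "1 \<le> (1200 * real N ^ 3 / sqrt \<epsilon> + 2) ^ (d - 1)" using e by (intro one_le_power) simp
  moreover have "1 \<le> real N ^ 2" by (rule one_le_power) simp
  then have "1 \<le> 50 * real N ^ 2" by linarith
  ultimately show "1 \<le> 50 * real N ^ 2 * (1200 * real N ^ 3 / sqrt \<epsilon> + 2) ^ (d - 1)"
    using mult_mono[of 1 "50 * real N ^ 2" 1] by simp
qed

end

section \<open>The half-space model of hyperbolic space\<close>

lemma cosh_tangent: "cosh a + sinh a * (b - a) \<le> cosh b" for a b :: real
proof -
  have "exp a * (1 + (b - a)) \<le> exp a * exp (b - a)" "exp (- a) * (1 + (a - b)) \<le> exp (- a) * exp (a - b)"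
    using exp_ge_add_one_self[of "b - a"] exp_ge_add_one_self[of "a - b"] by (intro mult_left_mono; simp)+
  then have "exp a * (1 + (b - a)) \<le> exp b" "exp (- a) * (1 + (a - b)) \<le> exp (- b)"
    by (simp_all flip: exp_add)
  then have "(exp a * (1 + (b - a)) + exp (- a) * (1 + (a - b))) / 2 \<le> (exp b + exp (- b)) / 2" by simp
  moreover have "(exp a * (1 + (b - a)) + exp (- a) * (1 + (a - b))) / 2 = cosh a + sinh a * (b - a)"
    unfolding cosh_def sinh_def by (simp add: field_simps)
  ultimately show ?thesis unfolding cosh_def by simp
qed

lemma sinh_ge_self: "0 \<le> x \<Longrightarrow> x \<le> sinh x" for x :: real
proof -
  assume x: "0 \<le> x"
  have "sinh 0 - 0 \<le> sinh x - x"
  proof (rule DERIV_nonneg_imp_nondecreasing[OF x])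
    fix t :: real
    show "\<exists>y. ((\<lambda>t. sinh t - t) has_real_derivative y) (at t) \<and> 0 \<le> y"
      by (intro exI[of _ "cosh t - 1"] conjI) (auto intro!: derivative_eq_intros cosh_real_ge_1)
  qed
  then show ?thesis by simp
qed

lemma cosh_ge_quadratic: "1 + x\<^sup>2 / 2 \<le> cosh x" for x :: real
proof -
  have *: "1 + x\<^sup>2 / 2 \<le> cosh x" if x: "0 \<le> x" for x :: real
  proof -
    have "cosh 0 - 0\<^sup>2 / 2 \<le> cosh x - x\<^sup>2 / 2"
    proof (rule DERIV_nonneg_imp_nondecreasing[OF x])
      fix t :: real assume "0 \<le> t"
      then show "\<exists>y. ((\<lambda>t. cosh t - t\<^sup>2 / 2) has_real_derivative y) (at t) \<and> 0 \<le> y"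
        using sinh_ge_self[of t] by (intro exI[of _ "sinh t - t"] conjI) (auto intro!: derivative_eq_intros)
    qed
    then show ?thesis by simp
  qed
  show ?thesis using *[of x] *[of "- x"] by (cases "0 \<le> x") auto
qed

lemma cosh_le_quadratic:
  fixes a :: real
  assumes "0 \<le> a" "a \<le> 1"
  shows "cosh a \<le> 1 + a\<^sup>2"
proof -
  have "exp a \<le> 1 + a + a\<^sup>2" by (rule exp_bound) (use assms in auto)
  moreover have "exp (- a) \<le> 1 - a + a\<^sup>2"
  proof -
    have "exp (- a) = 1 / exp a" by (simp add: exp_minus field_simps)
    also have "\<dots> \<le> 1 / (1 + a)" using assms exp_ge_add_one_self[of a] by (intro divide_left_mono) auto
    also have "\<dots> \<le> 1 - a + a\<^sup>2"
    proof -
      have "(1 - a + a\<^sup>2) * (1 + a) = 1 + a ^ 3" by algebra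
      then show ?thesis using assms by (subst pos_divide_le_eq) auto
    qed
    finally show ?thesis .
  qed
  ultimately show ?thesis unfolding cosh_def by simp
qed

lemma le_of_cosh_ge:
  fixes a x :: real
  assumes "0 \<le> a" "0 \<le> x" "x \<le> 1" "1 + x\<^sup>2 \<le> cosh a"
  shows "x \<le> a"
proof (rule ccontr)
  assume "\<not> x \<le> a"
  then have "cosh a \<le> 1 + a\<^sup>2" "a\<^sup>2 < x\<^sup>2" using assms by (auto intro!: cosh_le_quadratic power_strict_mono)
  then show False using assms(4) by simp
qed

lemma coth_le:
  fixes a x :: real
  assumes "0 < x" "x \<le> 1" "x \<le> a"
  shows "cosh a / sinh a \<le> 2 / x"
proof -
  have a: "0 < a" "0 < sinh a" using assms by auto
  have "cosh a = sinh a + exp (- a)" unfolding cosh_def sinh_def by (simp add: field_simps)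
  also have "\<dots> \<le> sinh a + 1" using a by simp
  also have "1 \<le> sinh a / a" using sinh_ge_self[of a] a by simp
  also have "sinh a / a \<le> sinh a / x" using a assms by (intro divide_left_mono) auto
  also have "sinh a + sinh a / x \<le> sinh a / x + sinh a / x"
  proof -
    have "sinh a / 1 \<le> sinh a / x" using a assms by (intro divide_left_mono) auto
    then show ?thesis by simp
  qed
  finally have "cosh a \<le> 2 / x * sinh a" by simp
  then show ?thesis using a by (simp add: pos_divide_le_eq)
qed

text \<open>The hyperbolic form of Stewart's theorem is \<open>cosh t = \<alpha> cosh a' + \<beta> cosh b'\<close>; bounding \<open>cosh\<close> below by its
  tangents at \<open>a\<close> and \<open>b\<close> bounds the excess of a detour.\<close>

lemma hyperbolic_excess:
  fixes a b a' b' t \<alpha> \<beta> D x :: real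
  assumes st: "cosh t = \<alpha> * cosh a' + \<beta> * cosh b'"
    and a: "cosh a = \<alpha> + \<beta> * cosh D" and b: "cosh b = \<alpha> * cosh D + \<beta>"
    and one: "1 = \<alpha> * cosh a + \<beta> * cosh b"
    and pos: "0 \<le> \<alpha>" "0 \<le> \<beta>" "0 \<le> D" and x: "0 < x" "x \<le> 1" "x \<le> a" "x \<le> b"
  shows "a + b = D" "a' + b' \<le> D + (cosh t - 1) * (4 / x)"
proof -
  have norm: "\<alpha>\<^sup>2 + \<beta>\<^sup>2 + 2 * \<alpha> * \<beta> * cosh D = 1" using a b one by algebra
  have sq: "(sinh z)\<^sup>2 = (cosh z)\<^sup>2 - 1" for z :: real using cosh_square_eq[of z] by simp
  have "(sinh a)\<^sup>2 = (\<beta> * sinh D)\<^sup>2" unfolding power_mult_distrib sq a using norm by algebra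
  then have sa: "sinh a = \<beta> * sinh D" using pos x by (simp add: power2_eq_iff_nonneg)
  have "(sinh b)\<^sup>2 = (\<alpha> * sinh D)\<^sup>2" unfolding power_mult_distrib sq b using norm by algebra
  then have sb: "sinh b = \<alpha> * sinh D" using pos x by (simp add: power2_eq_iff_nonneg)
  have "cosh (a + b) = cosh D" unfolding cosh_add a b sa sb using norm sq[of D] by algebra
  then have "a + b \<le> D" "D \<le> a + b"
    using cosh_real_nonneg_le_iff[of "a + b" D] cosh_real_nonneg_le_iff[of D "a + b"] x pos by auto
  then show D: "a + b = D" by simp
  have s0: "0 < sinh a" "0 < sinh b" using x by auto
  let ?e = "a' + b' - D"
  have "\<alpha> * (cosh a + sinh a * (a' - a)) + \<beta> * (cosh b + sinh b * (b' - b)) \<le> cosh t"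
    unfolding st using pos cosh_tangent[of a a'] cosh_tangent[of b b'] by (intro add_mono mult_left_mono) auto
  moreover have "\<alpha> * (cosh a + sinh a * (a' - a)) + \<beta> * (cosh b + sinh b * (b' - b)) = 1 + \<alpha> * \<beta> * sinh D * ?e"
    using one D unfolding sa sb by algebra
  ultimately have "\<alpha> * \<beta> * sinh D * ?e \<le> cosh t - 1" by simp
  \<comment> \<open>The extra factor \<open>sinh D\<close> completes the coefficient of the excess
    to \<open>sinh a * sinh b\<close>; expanding sinh (a + b) on the other side then leaves two
    hyperbolic cotangents.\<close>
  then have "sinh D * (\<alpha> * \<beta> * sinh D * ?e) \<le> sinh D * (cosh t - 1)" using pos by (intro mult_left_mono) auto
  moreover have "sinh D * (\<alpha> * \<beta> * sinh D * ?e) = ?e * (sinh a * sinh b)" unfolding sa sb by algebra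
  ultimately have "?e * (sinh a * sinh b) \<le> sinh D * (cosh t - 1)" by simp
  then have "?e \<le> sinh D * (cosh t - 1) / (sinh a * sinh b)" using s0 by (simp add: pos_le_divide_eq)
  also have "sinh D = sinh a * cosh b + cosh a * sinh b" unfolding D[symmetric] by (rule sinh_add)
  also have "(sinh a * cosh b + cosh a * sinh b) * (cosh t - 1) / (sinh a * sinh b)
      = (cosh t - 1) * (cosh b / sinh b + cosh a / sinh a)" using s0 by (simp add: field_simps)
  also have "\<dots> \<le> (cosh t - 1) * (2 / x + 2 / x)"
    using x cosh_real_ge_1[of t] by (intro mult_left_mono add_mono coth_le) auto
  finally show "a' + b' \<le> D + (cosh t - 1) * (4 / x)" by simp
qed

text \<open>Coordinate \<open>e\<close> is the height above the boundary at infinity, so this models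
  hyperbolic space of dimension \<open>e + 1\<close>.\<close>

definition halfspace :: "nat \<Rightarrow> (nat \<Rightarrow> real) set" where
  "halfspace e = {x. (\<forall>i\<ge>Suc e. x i = 0) \<and> 0 < x e}"

definition hsq :: "nat \<Rightarrow> (nat \<Rightarrow> real) \<Rightarrow> (nat \<Rightarrow> real) \<Rightarrow> real" where
  "hsq e x y = (\<Sum>i<e. (x i - y i)\<^sup>2)"

text \<open>The familiar 1 + |x - y|^2 / (2 x_e y_e), rearranged: with this numerator Stewart's
  identity for the horizontal parts becomes a linear relation between values of
  \<open>hcosh\<close>.\<close>

definition hcosh :: "nat \<Rightarrow> (nat \<Rightarrow> real) \<Rightarrow> (nat \<Rightarrow> real) \<Rightarrow> real" where
  "hcosh e x y = (hsq e x y + (x e)\<^sup>2 + (y e)\<^sup>2) / (2 * x e * y e)"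

definition hdist :: "nat \<Rightarrow> (nat \<Rightarrow> real) \<Rightarrow> (nat \<Rightarrow> real) \<Rightarrow> real" where
  "hdist e x y = arcosh (hcosh e x y)"

lemma hsq_nonneg: "0 \<le> hsq e x y"
  unfolding hsq_def by (simp add: sum_nonneg)

lemma hsq_commute: "hsq e x y = hsq e y x"
  unfolding hsq_def by (simp add: power2_commute)

lemma hcosh_commute: "hcosh e x y = hcosh e y x"
  unfolding hcosh_def by (simp add: hsq_commute[of e x y] add_ac mult_ac)

lemma hdist_sym: "hdist e x y = hdist e y x"
  unfolding hdist_def by (simp add: hcosh_commute)

lemma hcosh_self: "0 < x e \<Longrightarrow> hcosh e x x = 1"
  unfolding hcosh_def hsq_def by (simp add: power2_eq_square)

lemma hcosh_minus_one:
  assumes "0 < x e" "0 < y e"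
  shows "hcosh e x y - 1 = (\<Sum>i<Suc e. (x i - y i)\<^sup>2) / (2 * x e * y e)"
proof -
  have "hcosh e x y - 1 = (hsq e x y + (x e)\<^sup>2 + (y e)\<^sup>2 - 2 * x e * y e) / (2 * x e * y e)"
    unfolding hcosh_def diff_divide_distrib using assms by simp
  also have "hsq e x y + (x e)\<^sup>2 + (y e)\<^sup>2 - 2 * x e * y e = (\<Sum>i<Suc e. (x i - y i)\<^sup>2)"
    unfolding hsq_def power2_diff by (simp add: power2_diff)
  finally show ?thesis .
qed

lemma hcosh_ge_1: "0 < x e \<Longrightarrow> 0 < y e \<Longrightarrow> 1 \<le> hcosh e x y"
  using hcosh_minus_one[of x e y] by (smt (verit) divide_nonneg_pos mult_pos_pos sum_nonneg zero_le_power2)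

section \<open>The hyperboloid\<close>

text \<open>The Lorentz form with positive time direction, so that on the hyperboloid it is the cosh
  of the distance.\<close>

definition mink :: "nat \<Rightarrow> (nat \<Rightarrow> real) \<Rightarrow> (nat \<Rightarrow> real) \<Rightarrow> real" where
  "mink d x y = x d * y d - ip d x y"

lemma mink_commute: "mink d x y = mink d y x"
  unfolding mink_def by (simp add: ip_commute mult.commute)

lemma mink_comb_left: "mink d (\<lambda>i. a * x i + b * y i) z = a * mink d x z + b * mink d y z"
  unfolding mink_def ip_comb_left by (simp add: algebra_simps)

lemma mink_comb_right: "mink d z (\<lambda>i. a * x i + b * y i) = a * mink d z x + b * mink d z y"
  using mink_comb_left mink_commute by metis

lemma hyp_dist: "model_dist Hyp d x y = arcosh (mink d x y)"
  by (simp add: mink_def ip_def)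

lemma hyp_carrier: "x \<in> model_carrier Hyp d \<longleftrightarrow> (\<forall>i\<ge>Suc d. x i = 0) \<and> 0 < x d \<and> mink d x x = 1"
  by (auto simp: mink_def ip_def power2_eq_square)

text \<open>The orthogonal complement of a timelike vector is spacelike: orthogonality expresses the
  time part of w through its space part, and Cauchy-Schwarz bounds it.\<close>

lemma mink_orthogonal_nonpos:
  assumes y: "mink d y y = 1" and o: "mink d w y = 0"
  shows "mink d w w \<le> 0"
proof -
  have "(w d * y d)\<^sup>2 = \<bar>ip d w y\<bar>\<^sup>2" using o unfolding mink_def by simp
  also have "\<dots> \<le> (sqrt (ip d w w) * sqrt (ip d y y))\<^sup>2" by (rule power_mono[OF ip_cauchy_schwarz]) simp
  also have "\<dots> = ip d w w * ip d y y" using ip_self_nonneg by (simp add: power_mult_distrib)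
  also have "ip d y y = (y d)\<^sup>2 - 1" using y unfolding mink_def by (simp add: power2_eq_square)
  finally have le: "(w d)\<^sup>2 * (y d)\<^sup>2 \<le> ip d w w * (y d)\<^sup>2 - ip d w w" by (simp add: power_mult_distrib right_diff_distrib)
  have yd: "1 \<le> (y d)\<^sup>2" using y ip_self_nonneg[of d y] unfolding mink_def by (simp add: power2_eq_square)
  have "(w d)\<^sup>2 * (y d)\<^sup>2 \<le> ip d w w * (y d)\<^sup>2" using le ip_self_nonneg[of d w] by linarith
  then have "(w d)\<^sup>2 \<le> ip d w w" by (rule mult_right_le_imp_le) (use yd in linarith)
  then show ?thesis unfolding mink_def by (simp add: power2_eq_square)
qed

text \<open>Cauchy-Schwarz for a negative semidefinite form, stated for the three numbers because
  the Lorentz form is semidefinite only on the complement of a point.\<close>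

lemma quadratic_nonpos_discriminant:
  fixes A B C :: real
  assumes "\<And>t. A + 2 * t * B + t\<^sup>2 * C \<le> 0" and C0: "C \<le> 0"
  shows "\<bar>B\<bar> \<le> sqrt (- A) * sqrt (- C)"
proof -
  have A: "A \<le> 0" using assms(1)[of 0] by simp
  have AC: "B\<^sup>2 \<le> A * C"
  proof (cases "C = 0")
    case True
    have "B = 0"
    proof (rule ccontr)
      assume "B \<noteq> 0"
      then have "2 * ((1 - A) / (2 * B)) * B = 1 - A" by simp
      then show False using assms(1)[of "(1 - A) / (2 * B)"] True by simp
    qed
    then show ?thesis using True by simp
  next
    case False
    then have C: "C < 0" using C0 by simp
    have "A - B\<^sup>2 / C \<le> 0" using assms(1)[of "- B / C"] C by (simp add: field_simps power2_eq_square)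
    then show ?thesis using C by (simp add: field_simps)
  qed
  have "\<bar>B\<bar> = sqrt (B\<^sup>2)" by simp
  also have "\<dots> \<le> sqrt ((- A) * (- C))" using AC by (simp only: real_sqrt_le_iff minus_mult_minus)
  finally show ?thesis by (simp only: real_sqrt_mult)
qed

lemma hyp_mink_ge_1:
  assumes "x \<in> model_carrier Hyp d" "y \<in> model_carrier Hyp d"
  shows "1 \<le> mink d x y"
proof -
  have n: "mink d x x = 1" "mink d y y = 1" "0 < x d" "0 < y d" using assms hyp_carrier by auto
  let ?a = "ip d x x" and ?b = "ip d y y"
  have ab: "0 \<le> ?a" "0 \<le> ?b" by (rule ip_self_nonneg)+
  have sq: "(x d)\<^sup>2 = 1 + ?a" "(y d)\<^sup>2 = 1 + ?b" using n unfolding mink_def by (simp_all add: power2_eq_square)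
  have "(1 + sqrt ?a * sqrt ?b)\<^sup>2 \<le> (x d * y d)\<^sup>2"
  proof -
    have "0 \<le> (sqrt ?a - sqrt ?b)\<^sup>2" by simp
    then have "2 * (sqrt ?a * sqrt ?b) \<le> ?a + ?b" unfolding power2_diff using ab by simp
    then show ?thesis unfolding power_mult_distrib sq power2_sum using ab by (simp add: power_mult_distrib algebra_simps)
  qed
  then have "1 + sqrt ?a * sqrt ?b \<le> x d * y d" by (rule power2_le_imp_le) (use n in simp)
  then show ?thesis using ip_cauchy_schwarz[of d x y] unfolding mink_def by linarith
qed

text \<open>The argument for the sphere with the Lorentz form: split off from x and z their
  components along y and apply Cauchy-Schwarz in the complement of y.\<close>

lemma hyp_triangle:
  assumes "x \<in> model_carrier Hyp d" "y \<in> model_carrier Hyp d" "z \<in> model_carrier Hyp d"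
  shows "model_dist Hyp d x z \<le> model_dist Hyp d x y + model_dist Hyp d y z"
proof -
  let ?a = "mink d x y" and ?b = "mink d y z" and ?c = "mink d x z"
  have n: "mink d x x = 1" "mink d y y = 1" "mink d z z = 1" using assms hyp_carrier by auto
  have ge: "1 \<le> ?a" "1 \<le> ?b" "1 \<le> ?c" using assms by (auto intro: hyp_mink_ge_1)
  define u v where "u = (\<lambda>i. 1 * x i + (- ?a) * y i)" and "v = (\<lambda>i. 1 * z i + (- ?b) * y i)"
  have uu: "mink d u u = 1 - ?a\<^sup>2" and vv: "mink d v v = 1 - ?b\<^sup>2" and uv: "mink d u v = ?c - ?a * ?b"
    and uy: "mink d u y = 0" and vy: "mink d v y = 0"
    unfolding u_def v_def mink_comb_left mink_comb_right n
    by (simp_all add: mink_commute[of d y x] mink_commute[of d z y] power2_eq_square)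
  have "\<bar>mink d u v\<bar> \<le> sqrt (- mink d u u) * sqrt (- mink d v v)"
  proof (rule quadratic_nonpos_discriminant)
    fix t
    have "mink d (\<lambda>i. 1 * u i + t * v i) y = 0" unfolding mink_comb_left uy vy by simp
    from mink_orthogonal_nonpos[OF n(2) this]
    show "mink d u u + 2 * t * mink d u v + t\<^sup>2 * mink d v v \<le> 0"
      unfolding mink_comb_left mink_comb_right mink_commute[of d v u] by (simp add: power2_eq_square algebra_simps)
  qed (rule mink_orthogonal_nonpos[OF n(2) vy])
  then have c: "?c \<le> ?a * ?b + sqrt (?a\<^sup>2 - 1) * sqrt (?b\<^sup>2 - 1)" unfolding uu vv uv by simp
  have s: "sinh (arcosh g) = sqrt (g\<^sup>2 - 1)" if "1 \<le> g" for g :: real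
    using that by (rule sinh_arcosh_real)
  have nn: "0 \<le> arcosh ?a" "0 \<le> arcosh ?b" "0 \<le> arcosh ?c" using ge by (simp_all add: arcosh_nonneg_real)
  have "cosh (arcosh ?c) \<le> cosh (arcosh ?a + arcosh ?b)"
    unfolding cosh_add using ge c by (simp add: cosh_arcosh_real s)
  then show ?thesis unfolding hyp_dist using nn cosh_real_nonneg_le_iff[of "arcosh ?c" "arcosh ?a + arcosh ?b"] by simp
qed

section \<open>Hyperbolic distance in the half-space against heights and coordinates\<close>

context
  fixes e :: nat
begin

private abbreviation "U \<equiv> halfspace e"
private abbreviation "\<delta> \<equiv> hdist e"

lemma halfspace_pos: "x \<in> U \<Longrightarrow> 0 < x e"
  unfolding halfspace_def by simp

lemma cosh_hdist: "x \<in> U \<Longrightarrow> y \<in> U \<Longrightarrow> cosh (\<delta> x y) = hcosh e x y"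
  unfolding hdist_def using hcosh_ge_1 halfspace_pos by (simp add: cosh_arcosh_real)

lemma hdist_nonneg: "x \<in> U \<Longrightarrow> y \<in> U \<Longrightarrow> 0 \<le> \<delta> x y"
  unfolding hdist_def using hcosh_ge_1 halfspace_pos by (simp add: arcosh_nonneg_real)

lemma hdist_le_iff: "x \<in> U \<Longrightarrow> y \<in> U \<Longrightarrow> 0 \<le> t \<Longrightarrow> \<delta> x y \<le> t \<longleftrightarrow> hcosh e x y \<le> cosh t"
  using cosh_real_nonneg_le_iff[OF hdist_nonneg] cosh_hdist by metis

lemma hdist_ge_iff: "x \<in> U \<Longrightarrow> y \<in> U \<Longrightarrow> 0 \<le> t \<Longrightarrow> t \<le> \<delta> x y \<longleftrightarrow> cosh t \<le> hcosh e x y"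
  using cosh_real_nonneg_le_iff[OF _ hdist_nonneg] cosh_hdist by metis

lemma cosh_ln_ratio: "0 < a \<Longrightarrow> 0 < b \<Longrightarrow> cosh (ln (a / b)) = (a\<^sup>2 + b\<^sup>2) / (2 * a * b)" for a b :: real
  by (simp add: cosh_ln_real field_simps power2_eq_square)

lemma sinh_ln_ratio: "0 < a \<Longrightarrow> 0 < b \<Longrightarrow> sinh (ln (a / b)) = (a\<^sup>2 - b\<^sup>2) / (2 * a * b)" for a b :: real
  by (simp add: sinh_ln_real field_simps power2_eq_square)

text \<open>With l the logarithm of the height ratio, \<open>hcosh\<close> equals cosh l + sinh l
  times the correction term. This is the tangent of cosh at l, which lies below cosh; so a
  horizontal offset costs only second order.\<close>

lemma hdist_upper:
  assumes x: "x \<in> U" and y: "y \<in> U" and lt: "y e < x e"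
  shows "\<delta> x y \<le> ln (x e / y e) + hsq e x y / ((x e)\<^sup>2 - (y e)\<^sup>2)"
proof -
  let ?l = "ln (x e / y e)" and ?t = "hsq e x y / ((x e)\<^sup>2 - (y e)\<^sup>2)"
  have pos: "0 < x e" "0 < y e" using x y halfspace_pos by auto
  have l: "0 \<le> ?l" using pos lt by simp
  have sqd: "0 < (x e)\<^sup>2 - (y e)\<^sup>2" using pos lt by (simp add: power_strict_mono)
  have t: "0 \<le> ?t" using hsq_nonneg sqd by (intro divide_nonneg_pos) auto
  have "hcosh e x y = cosh ?l + hsq e x y / (2 * x e * y e)"
    unfolding cosh_ln_ratio[OF pos] hcosh_def by (simp add: add_divide_distrib)
  also have "hsq e x y / (2 * x e * y e) = sinh ?l * ?t"
    unfolding sinh_ln_ratio[OF pos] using sqd by simp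
  also have "cosh ?l + sinh ?l * ?t \<le> cosh (?l + ?t)" using cosh_tangent[of ?l "?l + ?t"] by simp
  finally show ?thesis using hdist_le_iff[OF x y, of "?l + ?t"] l t by simp
qed

lemma hdist_lower:
  assumes x: "x \<in> U" and y: "y \<in> U" and le: "y e \<le> x e"
  shows "ln (x e / y e) \<le> \<delta> x y"
proof -
  have pos: "0 < x e" "0 < y e" using x y halfspace_pos by auto
  have "cosh (ln (x e / y e)) \<le> hcosh e x y"
    unfolding cosh_ln_ratio[OF pos] hcosh_def using pos hsq_nonneg by (intro divide_right_mono) auto
  then show ?thesis using hdist_ge_iff[OF x y, of "ln (x e / y e)"] pos le by simp
qed

lemma hdist_le_ln: "x \<in> U \<Longrightarrow> y \<in> U \<Longrightarrow> \<delta> x y \<le> ln (2 * hcosh e x y)"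
proof -
  assume xy: "x \<in> U" "y \<in> U"
  have "exp (\<delta> x y) \<le> 2 * cosh (\<delta> x y)" unfolding cosh_def by simp
  then show ?thesis using cosh_hdist[OF xy] by (metis exp_gt_zero less_le_trans ln_exp ln_le_cancel_iff)
qed

text \<open>With \<open>hdist_le_ln\<close> this says that the distance is ln (2 g) up to 1 / g^2,
  where g is its cosh; for far apart points, distances thus become logarithms of explicit quotients.
  It holds since e^D = 2 g - e^(-D) is at least 2 g - 1 / g = 2 g (1 - t / 2), and e^(-t) \<le> 1 -
  t / 2 on [0, 1].\<close>

lemma hdist_ge_ln: "x \<in> U \<Longrightarrow> y \<in> U \<Longrightarrow> ln (2 * hcosh e x y) - 1 / (hcosh e x y)\<^sup>2 \<le> \<delta> x y"
proof -
  assume xy: "x \<in> U" "y \<in> U"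
  define g D where "g = hcosh e x y" and "D = \<delta> x y"
  have g: "1 \<le> g" "cosh D = g" "0 \<le> D"
    using xy hcosh_ge_1 halfspace_pos cosh_hdist hdist_nonneg unfolding g_def D_def by auto
  define t where "t = 1 / g\<^sup>2"
  have t: "0 \<le> t" "t \<le> 1" using g(1) unfolding t_def by auto
  have "exp (- D) \<le> exp D" using g(3) by (subst exp_le_cancel_iff) simp
  moreover have "g = (exp D + exp (- D)) / 2" using g(2) cosh_field_def[of D] by simp
  moreover have "B \<le> A \<Longrightarrow> z = (A + B) / 2 \<Longrightarrow> z \<le> A" for A B z :: real by simp
  ultimately have "g \<le> exp D" by blast
  then have "exp (- D) \<le> 1 / g" using g(1) by (simp add: exp_minus inverse_eq_divide divide_left_mono)
  then have "2 * g - 1 / g \<le> exp D" using g(2) cosh_field_def[of D] by simp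
  moreover have "2 * g * (1 - t / 2) = 2 * g - 1 / g" unfolding t_def using g(1) by (simp add: field_simps power2_eq_square)
  moreover have "exp (- t) \<le> 1 - t / 2"
  proof -
    have "exp (- t) = 1 / exp t" by (simp add: exp_minus field_simps)
    also have "\<dots> \<le> 1 / (1 + t)" using t exp_ge_add_one_self[of t] by (intro divide_left_mono) auto
    also have "\<dots> \<le> 1 - t / 2"
    proof -
      have "(1 - t / 2) * (1 + t) = 1 + t * (1 - t) / 2" by (simp add: field_simps)
      then show ?thesis using t by (subst pos_divide_le_eq) auto
    qed
    finally show ?thesis .
  qed
  ultimately have "2 * g * exp (- t) \<le> exp D" using g(1) by (smt (verit) mult_left_mono)
  then have "ln (2 * g * exp (- t)) \<le> D" using g(1) by (metis exp_gt_zero ln_exp ln_le_cancel_iff mult_pos_pos less_le_trans zero_less_one zero_less_numeral)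
  then show ?thesis using g(1) unfolding g_def D_def t_def by (simp add: ln_mult)
qed

lemma hdist_ge_coordinate:
  assumes x: "x \<in> U" and y: "y \<in> U" and i: "i \<le> e" and t: "0 \<le> t" "t \<le> 1"
    and le: "t\<^sup>2 * (2 * x e * y e) \<le> (x i - y i)\<^sup>2"
  shows "t \<le> \<delta> x y"
proof (rule le_of_cosh_ge[OF hdist_nonneg[OF x y] t])
  have pos: "0 < x e" "0 < y e" using x y halfspace_pos by auto
  have "(x i - y i)\<^sup>2 \<le> (\<Sum>j<Suc e. (x j - y j)\<^sup>2)"
    using i by (intro member_le_sum[of i "{..<Suc e}" "\<lambda>j. (x j - y j)\<^sup>2"]) auto
  then have "t\<^sup>2 \<le> (\<Sum>j<Suc e. (x j - y j)\<^sup>2) / (2 * x e * y e)"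
    using le pos by (subst pos_le_divide_eq) auto
  then show "1 + t\<^sup>2 \<le> cosh (\<delta> x y)" unfolding cosh_hdist[OF x y] using hcosh_minus_one[of x e y] pos by simp
qed

lemma hdist_le_coordinates:
  assumes x: "x \<in> U" and y: "y \<in> U" and r: "0 \<le> r" "\<And>j. j < Suc e \<Longrightarrow> \<bar>x j - y j\<bar> \<le> r"
  shows "hcosh e x y - 1 \<le> real (Suc e) * r\<^sup>2 / (2 * x e * y e)"
proof -
  have pos: "0 < x e" "0 < y e" using x y halfspace_pos by auto
  have "(x j - y j)\<^sup>2 \<le> r\<^sup>2" if "j < Suc e" for j using r(2)[OF that] r(1) by (metis abs_ge_zero power2_abs power_mono)
  then have "(\<Sum>j<Suc e. (x j - y j)\<^sup>2) \<le> real (Suc e) * r\<^sup>2"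
    using sum_bounded_above[of "{..<Suc e}" "\<lambda>j. (x j - y j)\<^sup>2" "r\<^sup>2"] by simp
  then show ?thesis unfolding hcosh_minus_one[of x e y, OF pos] using pos by (intro divide_right_mono) auto
qed

section \<open>Geodesics of the half-space and nets on the walls they cross\<close>

definition hpoint :: "(nat \<Rightarrow> real) \<Rightarrow> (nat \<Rightarrow> real) \<Rightarrow> real \<Rightarrow> nat \<Rightarrow> real" where
  "hpoint p q v = (\<lambda>j. if j < e then p j + v * (q j - p j)
     else if j = e then sqrt ((1 - v) * (p e)\<^sup>2 + v * (q e)\<^sup>2 + v * (1 - v) * hsq e p q) else 0)"

text \<open>\<open>hpoint p q v\<close> is the point of the geodesic above the horizontal position p
  + v (q - p): the geodesic is a semicircle centred on the boundary, so its squared height is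
  quadratic in v with leading coefficient \<open>- hsq e p q\<close>. The last claim adds Stewart's
  identity to this quadratic; dividing by the heights produces the weights.\<close>

lemma hpoint:
  assumes p: "p \<in> U" and q: "q \<in> U" and v: "0 \<le> v" "v \<le> 1"
  shows "hpoint p q v \<in> U"
    and "(hpoint p q v e)\<^sup>2 = (1 - v) * (p e)\<^sup>2 + v * (q e)\<^sup>2 + v * (1 - v) * hsq e p q"
    and "min (p e) (q e) \<le> hpoint p q v e"
    and "hpoint p q v e \<le> max (p e) (q e) + sqrt (hsq e p q)"
    and "0 < s e \<Longrightarrow> hcosh e (hpoint p q v) s = (1 - v) * p e / hpoint p q v e * hcosh e p s
      + v * q e / hpoint p q v e * hcosh e s q"
proof -
  let ?y = "hpoint p q v" and ?h = "hsq e p q"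
  let ?Q = "(1 - v) * (p e)\<^sup>2 + v * (q e)\<^sup>2 + v * (1 - v) * ?h"
  let ?a = "min (p e) (q e)" and ?b = "max (p e) (q e)"
  have pos: "0 < p e" "0 < q e" using p q halfspace_pos by auto
  have vv: "0 \<le> v * (1 - v)" "v * (1 - v) \<le> 1" using v by (auto intro: mult_le_one)
  have lo: "?a\<^sup>2 \<le> ?Q"
  proof -
    have "?a\<^sup>2 = (1 - v) * ?a\<^sup>2 + v * ?a\<^sup>2 + 0" by algebra
    also have "\<dots> \<le> ?Q" using v pos vv hsq_nonneg[of e p q]
      by (intro add_mono mult_left_mono power_mono mult_nonneg_nonneg) auto
    finally show ?thesis .
  qed
  have hi: "?Q \<le> (?b + sqrt ?h)\<^sup>2"
  proof -
    have "?Q \<le> (1 - v) * ?b\<^sup>2 + v * ?b\<^sup>2 + 1 * ?h" using v pos vv hsq_nonneg[of e p q]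
      by (intro add_mono mult_left_mono power_mono mult_right_mono) auto
    also have "\<dots> = ?b\<^sup>2 + ?h" by algebra
    also have "\<dots> \<le> ?b\<^sup>2 + ?h + 2 * ?b * sqrt ?h" using pos hsq_nonneg[of e p q] by simp
    also have "\<dots> = (?b + sqrt ?h)\<^sup>2" unfolding power2_sum using hsq_nonneg[of e p q] by simp
    finally show ?thesis .
  qed
  have apos: "0 < ?a" using pos by simp
  have ye: "?y e = sqrt ?Q" unfolding hpoint_def by simp
  show sq: "(?y e)\<^sup>2 = ?Q" unfolding ye using lo by (simp add: order_trans[OF zero_le_power2])
  show "?a \<le> ?y e" unfolding ye using lo by (rule real_le_rsqrt)
  then have ypos: "0 < ?y e" using apos by linarith
  then show yU: "?y \<in> U" unfolding halfspace_def by (simp add: hpoint_def)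
  show "?y e \<le> ?b + sqrt ?h" unfolding ye using hi pos hsq_nonneg[of e p q] by (intro real_le_lsqrt) auto
  assume s: "0 < s e"
  have "(1 - v) * hsq e p s + v * hsq e s q = hsq e ?y s + v * (1 - v) * ?h"
    using stewart_euclid[of "\<lambda>j. p j + v * (q j - p j)" p v q, where d = e and s = s]
    unfolding hsq_def hpoint_def by simp
  then have num: "hsq e ?y s + (?y e)\<^sup>2 + (s e)\<^sup>2 = (1 - v) * (hsq e p s + (p e)\<^sup>2 + (s e)\<^sup>2) + v * (hsq e s q + (s e)\<^sup>2 + (q e)\<^sup>2)"
    unfolding sq by algebra
  show "hcosh e ?y s = (1 - v) * p e / ?y e * hcosh e p s + v * q e / ?y e * hcosh e s q"
    unfolding hcosh_def num using ypos pos s by (simp add: field_simps)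
qed

text \<open>On a vertical wall v = u, and the bulge u (1 - u) \<open>hsq\<close> lifts the crossing
  to height w / 18. On a horizontal wall the height is prescribed and v comes from the intermediate
  value theorem. The lower bound on the height is essential: at the crossing, hyperbolic length is
  at most of order Euclidean length over w.\<close>

lemma hyp_wall_param:
  assumes p: "p \<in> U" and q: "q \<in> U" and i: "i < Suc e" and u: "1 / 3 \<le> u" "u \<le> 2 / 3"
    and w: "0 < w" "w / 6 < \<bar>p i - q i\<bar>"
  obtains v where "0 \<le> v" "v \<le> 1" "hpoint p q v i = p i + u * (q i - p i)" "w / 18 \<le> hpoint p q v e"
proof (cases "i = e")
  case False
  then have ie: "i < e" using i by simp
  have u01: "0 \<le> u" "u \<le> 1" using u by auto
  have "0 \<le> (u - 1 / 3) * (2 / 3 - u)" using u by simp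
  also have "\<dots> = u * (1 - u) - 2 / 9" by algebra
  finally have uu: "2 / 9 \<le> u * (1 - u)" by simp
  have "(w / 6)\<^sup>2 \<le> \<bar>p i - q i\<bar>\<^sup>2" using w by (intro power_mono) auto
  also have "\<dots> \<le> hsq e p q" unfolding hsq_def power2_abs
    using ie by (intro member_le_sum[of i "{..<e}" "\<lambda>j. (p j - q j)\<^sup>2"]) auto
  finally have "2 / 9 * (w / 6)\<^sup>2 \<le> u * (1 - u) * hsq e p q" using uu by (intro mult_mono) auto
  also have "\<dots> \<le> (hpoint p q u e)\<^sup>2" unfolding hpoint(2)[OF p q u01] using u01 by simp
  finally have "(w / 18)\<^sup>2 \<le> (hpoint p q u e)\<^sup>2"
    by (simp add: power2_eq_square) (use zero_le_square[of w] in argo)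
  then have "w / 18 \<le> hpoint p q u e"
    by (rule power2_le_imp_le) (rule less_imp_le[OF halfspace_pos[OF hpoint(1)[OF p q u01]]])
  then show thesis using that[OF u01] ie by (simp add: hpoint_def)
next
  case True
  define f where "f v = (1 - v) * (p e)\<^sup>2 + v * (q e)\<^sup>2 + v * (1 - v) * hsq e p q" for v
  define c where "c = p e + u * (q e - p e)"
  have pos: "0 < p e" "0 < q e" using p q halfspace_pos by auto
  have c': "c = (1 - u) * p e + u * q e" unfolding c_def by algebra
  have cpos: "0 < c" unfolding c' using pos u by (intro add_pos_pos mult_pos_pos) auto
  have cont: "continuous_on {0..1} f" unfolding f_def by (intro continuous_intros)
  have f01: "f 0 = (p e)\<^sup>2" "f 1 = (q e)\<^sup>2" unfolding f_def by simp_all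
  have "\<exists>v. 0 \<le> v \<and> v \<le> 1 \<and> f v = c\<^sup>2 \<and> w / 18 \<le> c"
  proof (cases "p e \<le> q e")
    case le: True
    have "1 / 3 * (q e - p e) \<le> u * (q e - p e)" "u * (q e - p e) \<le> 1 * (q e - p e)"
      using le u by (intro mult_right_mono; simp)+
    then have b: "p e + (q e - p e) / 3 \<le> c" "c \<le> q e" "p e \<le> c" unfolding c_def using le by auto
    have "(p e)\<^sup>2 \<le> c\<^sup>2" "c\<^sup>2 \<le> (q e)\<^sup>2" using b pos cpos by (auto intro!: power_mono)
    then have "\<exists>v. 0 \<le> v \<and> v \<le> 1 \<and> f v = c\<^sup>2" using IVT'[of f 0 "c\<^sup>2" 1] cont f01 by simp
    moreover have "w / 18 \<le> c" using b(1) pos w(2) le unfolding True by argo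
    ultimately show ?thesis by blast
  next
    case le: False
    define z where "z = (1 - u) * (p e - q e)"
    have "1 / 3 * (p e - q e) \<le> z" "z \<le> 1 * (p e - q e)"
      unfolding z_def using le u by (intro mult_right_mono; simp)+
    moreover have "c = q e + z" unfolding c_def z_def by algebra
    ultimately have b: "q e + (p e - q e) / 3 \<le> c" "c \<le> p e" "q e \<le> c" using le by simp_all
    have "(q e)\<^sup>2 \<le> c\<^sup>2" "c\<^sup>2 \<le> (p e)\<^sup>2" using b pos cpos by (auto intro!: power_mono)
    then have "\<exists>v. 0 \<le> v \<and> v \<le> 1 \<and> f v = c\<^sup>2" using IVT2'[of f 1 "c\<^sup>2" 0] cont f01 by simp
    moreover have "w / 18 \<le> c" using b(1) pos w(2) le unfolding True by argo
    ultimately show ?thesis by blast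
  qed
  then obtain v where v: "0 \<le> v" "v \<le> 1" "f v = c\<^sup>2" "w / 18 \<le> c" by blast
  have "hpoint p q v e = sqrt (f v)" unfolding hpoint_def f_def by simp
  then have "hpoint p q v e = c" unfolding v(3) using cpos by simp
  then show thesis using that[OF v(1,2)] v(4) True c_def by simp
qed

lemma hyp_wall_point:
  assumes p: "p \<in> U" and q: "q \<in> U" and i: "i < Suc e" and u: "1 / 3 \<le> u" "u \<le> 2 / 3"
    and w: "0 < w" "w / 6 < \<bar>p i - q i\<bar>" and box: "\<And>j. j < Suc e \<Longrightarrow> \<bar>p j - q j\<bar> \<le> w / 3"
  obtains y where "y \<in> U" "y i = p i + u * (q i - p i)" "w / 18 \<le> y e"
    "\<forall>j<Suc e. \<bar>y j - p j\<bar> \<le> real (Suc e) * w" "w / (68 * y e) \<le> \<delta> p q"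
    "\<forall>s\<in>U. \<delta> p s + \<delta> s q \<le> \<delta> p q + (hcosh e y s - 1) * (4 / (w / (68 * y e)))"
proof -
  obtain v where v: "0 \<le> v" "v \<le> 1" and yi: "hpoint p q v i = p i + u * (q i - p i)"
    and ylow: "w / 18 \<le> hpoint p q v e" by (rule hyp_wall_param[OF p q i u w])
  define y where "y = hpoint p q v"
  note hp = hpoint[OF p q v, folded y_def]
  have pos: "0 < p e" "0 < q e" "0 < y e" using p q hp(1) halfspace_pos by auto
  have be: "\<bar>p e - q e\<bar> \<le> w / 3" using box[of e] by simp
  have ylow': "w \<le> 18 * y e" using ylow unfolding y_def by simp
  have pe: "p e \<le> 7 * y e" "q e \<le> 7 * y e" using hp(3) be ylow' pos by (auto simp: min_def split: if_splits)
  define x where "x = w / (68 * y e)"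
  have x: "0 < x" "x \<le> 1" unfolding x_def using w pos ylow' by (auto simp: pos_divide_le_eq)
  \<comment> \<open>The 68 comes from here: both ends have height at most 7 times that of y, and
    legs of at least w / 18 in coordinate i need 68^2 = 4624 \<ge> 14 * 324.\<close>
  have xs: "x\<^sup>2 * (2 * r * y e) \<le> z\<^sup>2" if r: "0 < r" "r \<le> 7 * y e" and z: "w / 18 \<le> \<bar>z\<bar>" for r z
  proof -
    have "x\<^sup>2 * (2 * r * y e) \<le> x\<^sup>2 * (2 * (7 * y e) * y e)" using r pos by (intro mult_left_mono mult_right_mono) auto
    also have "\<dots> = w\<^sup>2 * (14 / 4624)" unfolding x_def using pos by (simp add: power_divide power_mult_distrib power2_eq_square)
    also have "\<dots> \<le> (w / 18)\<^sup>2" by (simp add: power_divide)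
    also have "\<dots> \<le> \<bar>z\<bar>\<^sup>2" using z w by (intro power_mono) auto
    finally show ?thesis by simp
  qed
  have "p i - y i = u * (p i - q i)" "y i - q i = (1 - u) * (p i - q i)" using yi unfolding y_def by algebra+
  then have "\<bar>p i - y i\<bar> = u * \<bar>p i - q i\<bar>" "\<bar>y i - q i\<bar> = (1 - u) * \<bar>p i - q i\<bar>"
    using u by (simp_all add: abs_mult)
  moreover have "1 / 3 * \<bar>p i - q i\<bar> \<le> u * \<bar>p i - q i\<bar>" "1 / 3 * \<bar>p i - q i\<bar> \<le> (1 - u) * \<bar>p i - q i\<bar>"
    using u by (intro mult_right_mono; simp)+
  ultimately have far: "w / 18 \<le> \<bar>p i - y i\<bar>" "w / 18 \<le> \<bar>y i - q i\<bar>" using w(2) by linarith+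
  have a: "x \<le> \<delta> p y"
    using hdist_ge_coordinate[OF p hp(1), of i x] xs[OF pos(1) pe(1) far(1)] i x by simp
  have b: "x \<le> \<delta> y q"
    using hdist_ge_coordinate[OF hp(1) q, of i x] xs[OF pos(2) pe(2) far(2)] i x by (simp add: mult_ac)
  define \<alpha> \<beta> where "\<alpha> = (1 - v) * p e / y e" and "\<beta> = v * q e / y e"
  have ab: "0 \<le> \<alpha>" "0 \<le> \<beta>" unfolding \<alpha>_def \<beta>_def using v pos by auto
  have st: "hcosh e y s = \<alpha> * hcosh e p s + \<beta> * hcosh e s q" if "0 < s e" for s
    using hp(5)[of s, OF that] unfolding \<alpha>_def \<beta>_def .
  have ex: "\<delta> p y + \<delta> y q = \<delta> p q \<and> \<delta> p s + \<delta> s q \<le> \<delta> p q + (hcosh e y s - 1) * (4 / x)" if s: "s \<in> U" for s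
  proof -
    have 1: "cosh (\<delta> y s) = \<alpha> * cosh (\<delta> p s) + \<beta> * cosh (\<delta> s q)"
      unfolding cosh_hdist[OF hp(1) s] cosh_hdist[OF p s] cosh_hdist[OF s q] by (rule st[of s, OF halfspace_pos[OF s]])
    have 2: "cosh (\<delta> p y) = \<alpha> + \<beta> * cosh (\<delta> p q)"
      unfolding cosh_hdist[OF p hp(1)] cosh_hdist[OF p q] hcosh_commute[of e p y] st[of p, OF pos(1)]
      using hcosh_self[of p e] pos by simp
    have 3: "cosh (\<delta> y q) = \<alpha> * cosh (\<delta> p q) + \<beta>"
      unfolding cosh_hdist[OF hp(1) q] cosh_hdist[OF p q] st[of q, OF pos(2)] using hcosh_self[of q e] pos by simp
    have 4: "1 = \<alpha> * cosh (\<delta> p y) + \<beta> * cosh (\<delta> y q)"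
      unfolding cosh_hdist[OF hp(1) q] cosh_hdist[OF p hp(1)] st[of y, OF pos(3), symmetric] using hcosh_self[of y e] pos by simp
    show ?thesis
      using hyperbolic_excess[OF 1 2 3 4 ab hdist_nonneg[OF p q] x a b] cosh_hdist[OF hp(1) s] by simp
  qed
  show thesis
  proof (rule that[of y])
    show "y \<in> U" by (rule hp(1))
    show "y i = p i + u * (q i - p i)" "w / 18 \<le> y e" using yi ylow unfolding y_def by auto
    have "x \<le> \<delta> p y + \<delta> y q" using a b x by linarith
    then show "w / (68 * y e) \<le> \<delta> p q" using ex[OF p] unfolding x_def by simp
    show "\<forall>s\<in>U. \<delta> p s + \<delta> s q \<le> \<delta> p q + (hcosh e y s - 1) * (4 / (w / (68 * y e)))"
      using ex unfolding x_def by blast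
    show "\<forall>j<Suc e. \<bar>y j - p j\<bar> \<le> real (Suc e) * w"
    proof (intro allI impI)
      fix j assume j: "j < Suc e"
      have ww: "0 \<le> real e * w" "real (Suc e) * w = w + real e * w" using w by (simp_all add: distrib_right)
      show "\<bar>y j - p j\<bar> \<le> real (Suc e) * w"
      proof (cases "j = e")
        case False
        then have "\<bar>y j - p j\<bar> = v * \<bar>p j - q j\<bar>" using j v unfolding y_def hpoint_def by (simp add: abs_mult abs_minus_commute)
        also have "\<dots> \<le> 1 * (w / 3)" using v box[OF j] by (intro mult_mono) auto
        finally show ?thesis using w(1) ww by linarith
      next
        case True
        have "sqrt (hsq e p q) \<le> (\<Sum>j<e. \<bar>p j - q j\<bar>)"
          using L2_set_le_sum_abs[of "\<lambda>j. p j - q j" "{..<e}"] unfolding hsq_def L2_set_def .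
        also have "\<dots> \<le> real e * (w / 3)"
          using box sum_bounded_above[of "{..<e}" "\<lambda>j. \<bar>p j - q j\<bar>" "w / 3"] by simp
        finally have "y e \<le> max (p e) (q e) + real e * (w / 3)" using hp(4) by linarith
        moreover have "max (p e) (q e) \<le> p e + w / 3" "p e - w / 3 \<le> min (p e) (q e)" using be w(1) by linarith+
        ultimately have "\<bar>y e - p e\<bar> \<le> real e * w / 3 + w / 3" using hp(3) w(1) ww(1) by linarith
        then show ?thesis unfolding True using w(1) ww by linarith
      qed
    qed
  qed
qed

text \<open>The excess is of order \<epsilon> (w / y e)^2 divided by the leg bound, itself of order
  w / y e, so it is proportional to \<epsilon> times that bound at every height. The height and
  position bounds on s are what \<open>low_leg\<close> needs.\<close>

lemma hyp_net:
  assumes ep: "1 \<le> e" and \<epsilon>: "0 < \<epsilon>" "\<epsilon> \<le> 1" and w: "0 < w"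
  shows "\<exists>S\<subseteq>U. finite S \<and>
     real (card S) \<le> 25 * real (Suc e) * (800 * real (Suc e) ^ 2 / sqrt \<epsilon> + 2) ^ e \<and>
     (\<forall>p\<in>U. \<forall>q\<in>U. in_box (Suc e) o' w p \<longrightarrow> in_box (Suc e) o' w q \<longrightarrow> (\<forall>j<Suc e. \<bar>p j - q j\<bar> \<le> w / 3) \<longrightarrow>
       (\<exists>i<Suc e. w / 6 < \<bar>p i - q i\<bar>) \<longrightarrow>
       (\<exists>s\<in>S. \<delta> p s + \<delta> s q \<le> (1 + \<epsilon> / 4) * \<delta> p q \<and> w / 18 \<le> s e \<and>
          (\<forall>j<Suc e. \<bar>s j - o' j\<bar> \<le> 2 * real (Suc e) * w)))"
proof -
  define d where "d = Suc e"
  have d2: "2 \<le> real d" unfolding d_def using ep by simp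
  define \<theta> where "\<theta> = sqrt \<epsilon> * w / (200 * real d)"
  have \<theta>: "0 < \<theta>" unfolding \<theta>_def using \<epsilon> w d2 by simp
  define Y where "Y ik = {y\<in>U. y (fst ik) = o' (fst ik) + real (snd ik) * w / 24 \<and> w / 18 \<le> y e \<and> (\<forall>j<d. \<bar>y j - o' j\<bar> \<le> 2 * real d * w)}" for ik :: "nat \<times> nat"
  have "\<exists>S\<subseteq>Y ik. finite S \<and> real (card S) \<le> (2 * (2 * real d * w) / \<theta> + 2) ^ card ({..<d} - {fst ik}) \<and>
    (\<forall>y\<in>Y ik. \<exists>s\<in>S. \<forall>j\<in>{..<d} - {fst ik}. \<bar>y j - s j\<bar> \<le> \<theta>)" for ik
    by (rule grid_net[where o' = o']) (use \<theta> w in \<open>auto simp: Y_def\<close>)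
  then obtain Z where Z: "\<And>ik. Z ik \<subseteq> Y ik \<and> finite (Z ik) \<and> real (card (Z ik)) \<le> (2 * (2 * real d * w) / \<theta> + 2) ^ card ({..<d} - {fst ik}) \<and>
    (\<forall>y\<in>Y ik. \<exists>s\<in>Z ik. \<forall>j\<in>{..<d} - {fst ik}. \<bar>y j - s j\<bar> \<le> \<theta>)" by metis
  define I where "I = {..<d} \<times> {..24::nat}"
  define S where "S = (\<Union>ik\<in>I. Z ik)"
  have ratio: "2 * (2 * real d * w) / \<theta> = 800 * real d ^ 2 / sqrt \<epsilon>"
    unfolding \<theta>_def using w d2 \<epsilon> by (simp add: field_simps power2_eq_square)
  have "real (card (Z ik)) \<le> (800 * real d ^ 2 / sqrt \<epsilon> + 2) ^ e" if "ik \<in> I" for ik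
  proof -
    have "card ({..<d} - {fst ik}) = e" using that unfolding I_def d_def by auto
    then show ?thesis using Z[of ik] unfolding ratio by simp
  qed
  then have "real (card S) \<le> (800 * real d ^ 2 / sqrt \<epsilon> + 2) ^ e * real (card I)"
    unfolding S_def by (intro real_card_UN_le) (auto simp: I_def)
  also have "real (card I) = 25 * real d" unfolding I_def by simp
  finally have cS: "real (card S) \<le> 25 * real d * (800 * real d ^ 2 / sqrt \<epsilon> + 2) ^ e"
    by (simp only: mult.commute)
  have main: "\<exists>s\<in>S. \<delta> p s + \<delta> s q \<le> (1 + \<epsilon> / 4) * \<delta> p q \<and> w / 18 \<le> s e \<and> (\<forall>j<d. \<bar>s j - o' j\<bar> \<le> 2 * real d * w)"
    if p: "p \<in> U" "in_box d o' w p" and q: "q \<in> U" "in_box d o' w q" and box: "\<forall>j<d. \<bar>p j - q j\<bar> \<le> w / 3"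
      and i: "i < d" "w / 6 < \<bar>p i - q i\<bar>" for p q i
  proof -
    obtain k u where k: "k \<le> 24" and u: "1 / 3 \<le> u" "u \<le> 2 / 3" "o' i + real k * w / 24 = p i + u * (q i - p i)"
      by (rule wall_between[OF w, of "o' i" "p i" "q i"]) (use p q i in \<open>auto simp: in_box_def\<close>)
    obtain y where y: "y \<in> U" "y i = p i + u * (q i - p i)" "w / 18 \<le> y e"
        "\<forall>j<d. \<bar>y j - p j\<bar> \<le> real d * w" "w / (68 * y e) \<le> \<delta> p q"
      and ex: "\<forall>s\<in>U. \<delta> p s + \<delta> s q \<le> \<delta> p q + (hcosh e y s - 1) * (4 / (w / (68 * y e)))"
      by (rule hyp_wall_point[OF p(1) q(1) i(1)[unfolded d_def] u(1,2) w i(2)])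
        (use box in \<open>auto simp: d_def\<close>)
    have "y \<in> Y (i, k)"
    proof -
      have "\<bar>y j - o' j\<bar> \<le> 2 * real d * w" if j: "j < d" for j
      proof -
        have "\<bar>p j - o' j\<bar> \<le> w" using p(2) j unfolding in_box_def by (smt (verit))
        moreover have "1 * w \<le> real d * w" using d2 w by (intro mult_right_mono) auto
        moreover have "\<bar>y j - p j\<bar> \<le> real d * w" using y(4) j by blast
        ultimately show ?thesis by linarith
      qed
      then show ?thesis unfolding Y_def using y u(3) by simp
    qed
    then obtain s where s: "s \<in> Z (i, k)" "\<forall>j\<in>{..<d} - {i}. \<bar>y j - s j\<bar> \<le> \<theta>" using Z[of "(i, k)"] by auto
    have sY: "s \<in> Y (i, k)" using s(1) Z[of "(i, k)"] by blast
    have sU: "s \<in> U" using sY unfolding Y_def by simp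
    have near: "\<bar>y j - s j\<bar> \<le> \<theta>" if "j < Suc e" for j
      using that s(2) sY \<open>y \<in> Y (i, k)\<close> \<theta> by (cases "j = i") (auto simp: Y_def d_def)
    have pos: "0 < y e" "0 < s e" using y(1) sU halfspace_pos by auto
    let ?D = "\<delta> p q" and ?x = "w / (68 * y e)"
    have se1: "sqrt \<epsilon> \<le> 1" "0 < sqrt \<epsilon>" using \<epsilon> by auto
    have "\<theta> \<le> w / 400"
    proof -
      have "sqrt \<epsilon> * w / (200 * real d) \<le> 1 * w / (200 * 2)" using se1 w d2 by (intro frac_le mult_right_mono) auto
      then show ?thesis unfolding \<theta>_def by simp
    qed
    then have sy: "y e / 2 \<le> s e" using near[of e] y(3) w by simp
    have "hcosh e y s - 1 \<le> real (Suc e) * \<theta>\<^sup>2 / (2 * y e * s e)"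
      by (rule hdist_le_coordinates[OF y(1) sU]) (use \<theta> near in auto)
    also have "\<dots> \<le> real d * \<theta>\<^sup>2 / (2 * y e * (y e / 2))"
      unfolding d_def using sy pos by (intro divide_left_mono mult_left_mono mult_pos_pos mult_nonneg_nonneg) auto
    also have "\<dots> = \<epsilon> * w\<^sup>2 / (40000 * real d * (y e)\<^sup>2)"
      unfolding \<theta>_def using \<epsilon> d2 pos by (simp add: power_mult_distrib power_divide power2_eq_square)
    also have "\<dots> \<le> \<epsilon> * w\<^sup>2 / (40000 * 2 * (y e)\<^sup>2)"
      using \<epsilon> d2 pos by (intro divide_left_mono mult_right_mono mult_pos_pos) auto
    finally have hc: "hcosh e y s - 1 \<le> \<epsilon> * w\<^sup>2 / (80000 * (y e)\<^sup>2)" by simp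
    have "\<delta> p s + \<delta> s q \<le> ?D + (hcosh e y s - 1) * (4 / ?x)" using ex sU by blast
    also have "(hcosh e y s - 1) * (4 / ?x) \<le> \<epsilon> * w\<^sup>2 / (80000 * (y e)\<^sup>2) * (4 / ?x)"
      using hc w pos by (intro mult_right_mono) auto
    also have "\<dots> = \<epsilon> * ?x * (4 * 68 * 68 / 80000)" using w pos by (simp add: field_simps power2_eq_square)
    also have "\<dots> \<le> \<epsilon> * ?x * (1 / 4)" using \<epsilon> w pos by (intro mult_left_mono) auto
    also have "\<dots> \<le> \<epsilon> * ?D * (1 / 4)" using y(5) \<epsilon> by (intro mult_right_mono mult_left_mono) auto
    finally have "\<delta> p s + \<delta> s q \<le> (1 + \<epsilon> / 4) * ?D" by (simp add: distrib_right)
    moreover have "s \<in> S" using s(1) i(1) k unfolding S_def I_def by auto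
    ultimately show ?thesis using sY unfolding Y_def by blast
  qed
  show ?thesis
  proof (intro exI[of _ S] conjI ballI impI)
    show "S \<subseteq> U" using Z unfolding S_def Y_def by blast
    show "finite S" using Z unfolding S_def I_def by blast
    show "real (card S) \<le> 25 * real (Suc e) * (800 * real (Suc e) ^ 2 / sqrt \<epsilon> + 2) ^ e" using cS unfolding d_def .
  qed (use main in \<open>unfold d_def, blast\<close>)
qed

section \<open>Isometry between the half-space and the hyperboloid\<close>

private abbreviation "d \<equiv> Suc e"

text \<open>In light-cone coordinates the time coordinate minus coordinate e is 1 / u e, and their
  sum is u e + |u|^2 / u e with the horizontal norm; hence the inverse divides by that difference.
  The isometry also brings the triangle inequality to \<open>hdist\<close>.\<close>

definition to_hyp :: "(nat \<Rightarrow> real) \<Rightarrow> nat \<Rightarrow> real" where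
  "to_hyp u = (\<lambda>i. if i < e then u i / u e
     else if i = e then (u e + ip e u u / u e - 1 / u e) / 2
     else if i = Suc e then (u e + ip e u u / u e + 1 / u e) / 2 else 0)"

definition from_hyp :: "(nat \<Rightarrow> real) \<Rightarrow> nat \<Rightarrow> real" where
  "from_hyp x = (\<lambda>i. if i < e then x i / (x (Suc e) - x e) else if i = e then 1 / (x (Suc e) - x e) else 0)"

lemma mink_to_hyp:
  assumes "0 < u e" "0 < v e"
  shows "mink (Suc e) (to_hyp u) (to_hyp v) = hcosh e u v"
proof -
  have "ip e (to_hyp u) (to_hyp v) = (\<Sum>i<e. (u i / u e) * (v i / v e))"
    unfolding ip_def by (rule sum.cong) (auto simp: to_hyp_def)
  also have "\<dots> = ip e u v / (u e * v e)" unfolding ip_def sum_divide_distrib by simp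
  finally have i: "ip e (to_hyp u) (to_hyp v) = ip e u v / (u e * v e)" .
  have h: "hsq e u v = ip e u u + ip e v v - 2 * ip e u v"
    unfolding hsq_def ip_def power2_diff by (simp add: sum.distrib sum_subtractf sum_distrib_left power2_eq_square mult.assoc)
  define A B where "A = ip e u u" and "B = ip e v v"
  have "mink (Suc e) (to_hyp u) (to_hyp v)
      = (u e + A / u e + 1 / u e) / 2 * ((v e + B / v e + 1 / v e) / 2)
        - (ip e u v / (u e * v e) + (u e + A / u e - 1 / u e) / 2 * ((v e + B / v e - 1 / v e) / 2))"
    unfolding mink_def i[symmetric] A_def B_def by (simp add: to_hyp_def ip_def[of "Suc e"] ip_def[of e "\<lambda>i. to_hyp u i"])
      (simp add: ip_def to_hyp_def)
  also have "\<dots> = hcosh e u v"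
    unfolding hcosh_def h A_def[symmetric] B_def[symmetric] using assms by (simp add: field_simps power2_eq_square)
  finally show ?thesis .
qed

lemma to_hyp_carrier: "u \<in> U \<Longrightarrow> to_hyp u \<in> model_carrier Hyp (Suc e)"
proof -
  assume u: "u \<in> U"
  have pos: "0 < u e" using u halfspace_pos by auto
  have "0 < to_hyp u (Suc e)" unfolding to_hyp_def using pos ip_self_nonneg[of e u]
    by (simp add: add_pos_nonneg add_pos_pos)
  then show ?thesis unfolding hyp_carrier mink_to_hyp[of u u, OF pos pos] hcosh_self[of u e, OF pos]
    by (simp add: to_hyp_def)
qed

lemma to_hyp_dist: "u \<in> U \<Longrightarrow> v \<in> U \<Longrightarrow> model_dist Hyp (Suc e) (to_hyp u) (to_hyp v) = \<delta> u v"
  unfolding hyp_dist hdist_def using mink_to_hyp[of u v] halfspace_pos by simp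

lemma from_hyp:
  assumes "x \<in> model_carrier Hyp (Suc e)"
  shows "from_hyp x \<in> U" "to_hyp (from_hyp x) = x"
proof -
  have x: "\<And>i. Suc (Suc e) \<le> i \<Longrightarrow> x i = 0" "0 < x (Suc e)" "mink (Suc e) x x = 1"
    using assms unfolding hyp_carrier by auto
  define a where "a = x (Suc e) - x e"
  have m: "x (Suc e) * x (Suc e) - (ip e x x + x e * x e) = 1"
    using x(3) unfolding mink_def ip_def by simp
  have "(x e)\<^sup>2 < (x (Suc e))\<^sup>2" using m ip_self_nonneg[of e x] unfolding power2_eq_square by linarith
  then have "x e < x (Suc e)" by (rule power2_less_imp_less) (use x(2) in simp)
  then have a: "0 < a" unfolding a_def by simp
  show "from_hyp x \<in> U" unfolding halfspace_def from_hyp_def using a unfolding a_def by simp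
  have fe: "from_hyp x e = 1 / a" unfolding from_hyp_def a_def by simp
  have "ip e (from_hyp x) (from_hyp x) = (\<Sum>i<e. (x i / a) * (x i / a))"
    unfolding ip_def by (rule sum.cong) (auto simp: from_hyp_def a_def)
  also have "\<dots> = ip e x x / (a * a)" unfolding ip_def sum_divide_distrib by simp
  finally have ii: "ip e (from_hyp x) (from_hyp x) = ip e x x / (a * a)" .
  have b: "1 / a + ip e x x / (a * a) / (1 / a) = x (Suc e) + x e"
  proof -
    have "(x (Suc e) + x e) * a = 1 + ip e x x" unfolding a_def using m by algebra
    then show ?thesis using a by (simp add: field_simps)
  qed
  show "to_hyp (from_hyp x) = x"
  proof
    fix i
    consider "i < e" | "i = e" | "i = Suc e" | "Suc (Suc e) \<le> i" by linarith
    then show "to_hyp (from_hyp x) i = x i"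
    proof cases
      case 1
      then show ?thesis unfolding to_hyp_def fe using a by (simp add: from_hyp_def a_def)
    next
      case 2
      then show ?thesis unfolding to_hyp_def fe ii b by (simp add: a_def)
    next
      case 3
      then show ?thesis unfolding to_hyp_def fe ii b by (simp add: a_def)
    next
      case 4
      then show ?thesis unfolding to_hyp_def using x(1) by simp
    qed
  qed
qed

lemma hdist_triangle: "x \<in> U \<Longrightarrow> y \<in> U \<Longrightarrow> z \<in> U \<Longrightarrow> \<delta> x z \<le> \<delta> x y + \<delta> y z"
  using hyp_triangle[OF to_hyp_carrier to_hyp_carrier to_hyp_carrier, of x y z]
  by (simp add: to_hyp_dist del: model_dist.simps)

section \<open>Anchors in the half-space\<close>

text \<open>By \<open>hdist_upper\<close> the horizontal offset adds at most 4 / 3 d \<omega>^2.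
  Since the heights differ by a factor 2, the logarithm is at least ln 2 \<ge> 2 / 3, which makes
  the additive error relative and lets hops be added up.\<close>

lemma vertical_hop:
  assumes x: "x \<in> U" and y: "y \<in> U" and le: "2 * y e \<le> x e" and r: "0 \<le> r" "r \<le> \<omega> * x e"
    and close: "\<And>j. j < e \<Longrightarrow> \<bar>x j - y j\<bar> \<le> r"
  shows "\<delta> x y \<le> (1 + 2 * real d * \<omega>\<^sup>2) * ln (x e / y e)"
proof -
  have pos: "0 < x e" "0 < y e" using x y halfspace_pos by auto
  have "hsq e x y \<le> real e * r\<^sup>2" unfolding hsq_def
    using close r(1) sum_bounded_above[of "{..<e}" "\<lambda>j. (x j - y j)\<^sup>2" "r\<^sup>2"]
    by (simp add: abs_le_square_iff[symmetric])
  also have "\<dots> \<le> real d * (\<omega> * x e)\<^sup>2" using r by (intro mult_mono power_mono) auto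
  finally have h: "hsq e x y \<le> real d * \<omega>\<^sup>2 * (x e)\<^sup>2" by (simp add: power_mult_distrib)
  have "(2 * y e)\<^sup>2 \<le> (x e)\<^sup>2" using le pos by (intro power_mono) auto
  then have q: "3 / 4 * (x e)\<^sup>2 \<le> (x e)\<^sup>2 - (y e)\<^sup>2" by (simp add: power_mult_distrib)
  have "hsq e x y / ((x e)\<^sup>2 - (y e)\<^sup>2) \<le> (real d * \<omega>\<^sup>2 * (x e)\<^sup>2) / (3 / 4 * (x e)\<^sup>2)"
    using h q pos hsq_nonneg[of e x y] by (intro frac_le) auto
  also have "\<dots> = 2 * real d * \<omega>\<^sup>2 * (2 / 3)" using pos by simp
  also have "\<dots> \<le> 2 * real d * \<omega>\<^sup>2 * ln (x e / y e)"
  proof (rule mult_left_mono)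
    have "2 / 3 \<le> ln (2 :: real)" by (rule ln2_ge_two_thirds)
    also have "\<dots> \<le> ln (x e / y e)" using le pos by (subst ln_le_cancel_iff) (auto simp: pos_le_divide_eq)
    finally show "2 / 3 \<le> ln (x e / y e)" .
  qed simp
  finally have "hsq e x y / ((x e)\<^sup>2 - (y e)\<^sup>2) \<le> 2 * real d * \<omega>\<^sup>2 * ln (x e / y e)" .
  moreover have "y e < x e" using le pos by linarith
  ultimately show ?thesis using hdist_upper[OF x y] by (simp add: distrib_right)
qed

text \<open>Geodesics from a Steiner point \<open>s\<close> at height of order \<open>w\<close> down to a much lower point \<open>x\<close> become vertical:
  at height \<open>\<omega> w\<close> they pass so close to the anchor \<open>z\<close> that the detour costs only \<open>O(\<omega>\<^sup>2)\<close>.\<close>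

lemma low_leg:
  assumes U: "s \<in> U" "z \<in> U" "x \<in> U" "y \<in> U" and e1: "1 \<le> e" and w: "0 < w"
    and \<epsilon>: "0 < \<epsilon>" "\<epsilon> \<le> 1" and \<omega>: "0 < \<omega>" "4096 * real d ^ 2 * \<omega> \<le> \<epsilon>"
    and s: "w / 18 \<le> s e" "\<And>j. j < e \<Longrightarrow> \<bar>s j - x j\<bar> \<le> 3 * real d * w"
    and x: "x e \<le> 2 * \<omega>\<^sup>2 * w" and z: "z e = \<omega> * w" "\<And>j. j < e \<Longrightarrow> \<bar>z j - x j\<bar> \<le> \<omega>\<^sup>2 * w"
    and xy: "\<bar>x e - y e\<bar> \<le> w / 3" "i \<le> e" "w / 6 < \<bar>x i - y i\<bar>" and sx: "\<delta> s x \<le> 2 * \<delta> x y"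
  shows "\<delta> s z + (1 + 2 * real d * \<omega>\<^sup>2) * ln (z e / x e) \<le> \<delta> s x + \<epsilon> / 4 * \<delta> x y"
proof -
  have pos: "0 < s e" "0 < z e" "0 < x e" "0 < y e" using U halfspace_pos by auto
  have d2: "2 \<le> real d" using e1 by simp
  have d4: "4 \<le> real d ^ 2" using power_mono[OF d2, of 2] by simp
  have "4 * \<omega> \<le> real d ^ 2 * \<omega>" using d4 \<omega> by (intro mult_right_mono) auto
  then have om: "\<omega> \<le> 1 / 16384" using \<omega> \<epsilon> by linarith
  have om1: "\<omega>\<^sup>2 \<le> 1 / 16384" using om \<omega> mult_mono[of \<omega> "1 / 16384" \<omega> 1] by (simp add: power2_eq_square)
  have o2: "\<omega>\<^sup>2 * w \<le> w / 16384" using om1 w mult_right_mono[OF om1, of w] by simp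
  define D where "D = \<delta> x y"
  \<comment> \<open>Both heights are of order at most w while some coordinate differs by w / 6, so
    the distance is bounded below and additive errors may be charged to it.\<close>
  have D: "1 / 12 \<le> D" unfolding D_def
  proof (rule hdist_ge_coordinate[OF U(3,4) xy(2)])
    have "x e \<le> w" "y e \<le> 2 * w" using x xy(1) o2 w by linarith+
    then have "x e * y e \<le> w * (2 * w)" using pos by (intro mult_mono) auto
    moreover have "(w / 6)\<^sup>2 \<le> \<bar>x i - y i\<bar>\<^sup>2" using xy(3) w by (intro power_mono) auto
    ultimately show "(1 / 12)\<^sup>2 * (2 * x e * y e) \<le> (x i - y i)\<^sup>2" by (simp add: power2_eq_square)
  qed auto
  define \<eta> where "\<eta> = real d ^ 2 * \<omega>\<^sup>2"
  have \<eta>: "0 \<le> \<eta>" "\<omega>\<^sup>2 \<le> \<eta>" unfolding \<eta>_def using d4 mult_right_mono[of 1 "real d ^ 2" "\<omega>\<^sup>2"] by auto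
  have "real d ^ 2 * \<omega> * \<omega> \<le> \<epsilon> / 4096 * (1 / 16384)" using \<omega> om \<epsilon> by (intro mult_mono) auto
  then have \<eta>e: "\<eta> \<le> \<epsilon> / 4096 / 16384" unfolding \<eta>_def by (simp add: power2_eq_square)
  have coord: "(s j - z j)\<^sup>2 \<le> (s j - x j)\<^sup>2 + 7 * real d * \<omega>\<^sup>2 * w\<^sup>2" if j: "j < e" for j
  proof -
    let ?A = "\<bar>s j - x j\<bar>" and ?B = "\<bar>z j - x j\<bar>"
    have "(s j - z j)\<^sup>2 = (s j - x j)\<^sup>2 - 2 * ((s j - x j) * (z j - x j)) + (z j - x j)\<^sup>2" by algebra
    also have "\<dots> \<le> (s j - x j)\<^sup>2 + 2 * (?A * ?B) + ?B\<^sup>2"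
      using abs_ge_minus_self[of "(s j - x j) * (z j - x j)"] by (simp add: abs_mult)
    also have "\<dots> \<le> (s j - x j)\<^sup>2 + 2 * (3 * real d * w * (\<omega>\<^sup>2 * w)) + (\<omega>\<^sup>2 * w)\<^sup>2"
    proof -
      have "?A * ?B \<le> 3 * real d * w * (\<omega>\<^sup>2 * w)" using s(2)[OF j] z(2)[OF j] w by (intro mult_mono) auto
      moreover have "?B\<^sup>2 \<le> (\<omega>\<^sup>2 * w)\<^sup>2" using z(2)[OF j] by (intro power_mono) auto
      ultimately show ?thesis by linarith
    qed
    also have "(\<omega>\<^sup>2 * w)\<^sup>2 \<le> (\<omega>\<^sup>2 * w) * (real d * w)"
      unfolding power2_eq_square[of "\<omega>\<^sup>2 * w"] using om1 d2 w by (intro mult_left_mono mult_right_mono) auto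
    finally show ?thesis by (simp add: power2_eq_square algebra_simps)
  qed
  have "hsq e s z \<le> (\<Sum>j<e. (s j - x j)\<^sup>2 + 7 * real d * \<omega>\<^sup>2 * w\<^sup>2)" unfolding hsq_def by (intro sum_mono coord) simp
  also have "\<dots> = hsq e s x + real e * (7 * real d * \<omega>\<^sup>2 * w\<^sup>2)" unfolding hsq_def by (simp add: sum.distrib)
  also have "real e * (7 * real d * \<omega>\<^sup>2 * w\<^sup>2) \<le> real d * (7 * real d * \<omega>\<^sup>2 * w\<^sup>2)" by (intro mult_right_mono) auto
  also have "\<dots> = 7 * \<eta> * w\<^sup>2" unfolding \<eta>_def by (simp add: power2_eq_square)
  finally have hsz: "hsq e s z \<le> hsq e s x + 7 * \<eta> * w\<^sup>2" by simp
  define N0 where "N0 = hsq e s x + (s e)\<^sup>2 + (x e)\<^sup>2"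
  have N0: "(s e)\<^sup>2 \<le> N0" "0 < N0" unfolding N0_def using hsq_nonneg[of e s x] pos by (auto intro: add_nonneg_pos add_pos_nonneg)
  have "(w / 18)\<^sup>2 \<le> (s e)\<^sup>2" using s(1) w by (intro power_mono) auto
  then have wN: "w\<^sup>2 \<le> 324 * N0" using N0(1) by (simp add: power_divide)
  have "(z e)\<^sup>2 \<le> \<eta> * w\<^sup>2" unfolding z(1) power_mult_distrib using \<eta>(2) by (intro mult_right_mono) auto
  then have "hsq e s z + (s e)\<^sup>2 + (z e)\<^sup>2 \<le> N0 + 8 * \<eta> * w\<^sup>2" using hsz zero_le_power2[of "x e"] unfolding N0_def by linarith
  also have "8 * \<eta> * w\<^sup>2 \<le> 8 * \<eta> * (324 * N0)" using wN \<eta>(1) by (intro mult_left_mono) auto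
  finally have num: "hsq e s z + (s e)\<^sup>2 + (z e)\<^sup>2 \<le> N0 * (1 + 2592 * \<eta>)" by (simp add: algebra_simps)
  have num0: "0 < hsq e s z + (s e)\<^sup>2 + (z e)\<^sup>2" using hsq_nonneg[of e s z] pos by (intro add_nonneg_pos add_nonneg_nonneg) auto
  have two: "2 * (A / (2 * b * c)) = A / (b * c)" for A b c :: real by simp
  have g1: "2 * hcosh e s z = (hsq e s z + (s e)\<^sup>2 + (z e)\<^sup>2) / (s e * z e)" unfolding hcosh_def two ..
  have g: "2 * hcosh e s x = N0 / (s e * x e)" unfolding hcosh_def N0_def two ..
  \<comment> \<open>Replacing distances by ln (2 cosh) makes the height of z cancel, so only the
    numerators for z and for x remain to be compared; they differ by the factor 1 + 2592
    \<eta>.\<close>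
  have "\<delta> s z + ln (z e / x e) \<le> ln (2 * hcosh e s z) + ln (z e / x e)" using hdist_le_ln[OF U(1,2)] by simp
  also have "\<dots> = ln ((hsq e s z + (s e)\<^sup>2 + (z e)\<^sup>2) / (s e * x e))"
    unfolding g1 using pos num0 by (subst ln_mult_pos[symmetric]) auto
  also have "\<dots> \<le> ln (N0 * (1 + 2592 * \<eta>) / (s e * x e))"
    using num num0 pos N0 \<eta>(1) by (subst ln_le_cancel_iff) (auto intro!: divide_right_mono divide_pos_pos mult_pos_pos add_pos_nonneg)
  also have "\<dots> = ln (2 * hcosh e s x) + ln (1 + 2592 * \<eta>)"
    unfolding g using pos N0 \<eta>(1) by (subst ln_mult_pos[symmetric]) auto
  also have "ln (1 + 2592 * \<eta>) \<le> 2592 * \<eta>" using \<eta>(1) by (intro ln_add_one_self_le_self) simp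
  also have "ln (2 * hcosh e s x) \<le> \<delta> s x + 1 / (hcosh e s x)\<^sup>2" using hdist_ge_ln[OF U(1,3)] by simp
  \<comment> \<open>Here x being low enters: the height ratio alone forces \<open>hcosh\<close> to
    be at least 1 / (72 \<omega>^2), so ln (2 cosh) is accurate enough.\<close>
  also have "1 / (hcosh e s x)\<^sup>2 \<le> 5184 * \<eta>"
  proof -
    have "w / 18 / (4 * \<omega>\<^sup>2 * w) \<le> s e / (2 * x e)" using s(1) x pos w by (intro frac_le) (auto simp: mult_ac)
    also have "\<dots> = (s e)\<^sup>2 / (2 * s e * x e)" using pos by (simp add: power2_eq_square)
    also have "\<dots> \<le> hcosh e s x" unfolding hcosh_def using hsq_nonneg[of e s x] pos by (intro divide_right_mono) auto
    finally have "1 / (72 * \<omega>\<^sup>2) \<le> hcosh e s x" using w by simp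
    then have "(1 / (72 * \<omega>\<^sup>2))\<^sup>2 \<le> (hcosh e s x)\<^sup>2" using \<omega> by (intro power_mono) auto
    then have "1 / (hcosh e s x)\<^sup>2 \<le> 1 / (1 / (72 * \<omega>\<^sup>2))\<^sup>2"
      using \<omega> hcosh_ge_1[of s e x] pos by (intro divide_left_mono mult_pos_pos zero_less_power) auto
    also have "\<dots> = 5184 * \<omega>\<^sup>2 * \<omega>\<^sup>2" by (simp add: power2_eq_square)
    also have "\<dots> \<le> 5184 * \<omega>\<^sup>2 * 1" using om1 by (intro mult_left_mono) auto
    also have "\<dots> \<le> 5184 * \<eta>" using \<eta> by simp
    finally show ?thesis .
  qed
  finally have main: "\<delta> s z + ln (z e / x e) \<le> \<delta> s x + 7776 * \<eta>" by simp
  have "ln (z e / x e) \<le> ln (s e / x e)"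
  proof -
    have "\<omega> * w \<le> 1 / 18 * w" using om w by (intro mult_right_mono) auto
    then have "z e \<le> s e" using s(1) z(1) by simp
    then show ?thesis using pos by (subst ln_le_cancel_iff) (auto intro!: divide_right_mono)
  qed
  also have "\<dots> \<le> \<delta> s x" by (rule hdist_lower[OF U(1,3)]) (use x s(1) o2 w in linarith)
  also have "\<dots> \<le> 2 * D" using sx unfolding D_def .
  finally have "2 * real d * \<omega>\<^sup>2 * ln (z e / x e) \<le> 2 * real d * \<omega>\<^sup>2 * (2 * D)" by (intro mult_left_mono) auto
  also have "\<dots> \<le> 2 * \<eta> * (2 * D)"
  proof -
    have "real d * \<omega>\<^sup>2 \<le> real d ^ 2 * \<omega>\<^sup>2" using d2 by (intro mult_right_mono) (auto simp: power2_eq_square)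
    then have "2 * real d * \<omega>\<^sup>2 \<le> 2 * \<eta>" unfolding \<eta>_def mult.assoc by (rule mult_left_mono) simp
    then show ?thesis using D by (intro mult_right_mono) auto
  qed
  finally have c1: "2 * real d * \<omega>\<^sup>2 * ln (z e / x e) \<le> 4 * \<eta> * D" by simp
  \<comment> \<open>7776 = 2592 + 5184 collects the two errors above; D \<ge> 1 / 12 turns them into
    a multiple of D.\<close>
  have "7776 * \<eta> + 4 * \<eta> * D \<le> (7776 * 12 + 4) * \<eta> * D"
    using D \<eta>(1) mult_left_mono[of "1 / 12" D "7776 * 12 * \<eta>"] by (simp add: algebra_simps)
  also have "\<dots> \<le> \<epsilon> / 4 * D" using \<eta>e D \<epsilon> by (intro mult_right_mono) auto
  finally have "7776 * \<eta> + 4 * \<eta> * D \<le> \<epsilon> / 4 * D" .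
  then show ?thesis using main c1 unfolding D_def distrib_right mult_1 by linarith
qed

text \<open>Above height \<omega>^2 w, a cell of side \<omega>^4 w has hyperbolic diameter at most 2
  d \<omega>^2 r with r = \<omega>^2 w / x e, while x and y are at least \<omega> r / 12 apart. The
  dependence on the height cancels in the quotient 24 d \<omega>, which is at most \<epsilon> /
  16.\<close>

lemma high_near:
  assumes U: "x \<in> U" "x' \<in> U" "y \<in> U" and e1: "1 \<le> e" and w: "0 < w"
    and \<epsilon>: "0 < \<epsilon>" "\<epsilon> \<le> 1" and \<omega>: "0 < \<omega>" "4096 * real d ^ 2 * \<omega> \<le> \<epsilon>"
    and x: "\<omega>\<^sup>2 * w < x e" and near: "\<And>j. j < d \<Longrightarrow> \<bar>x' j - x j\<bar> \<le> \<omega> ^ 4 * w"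
    and xy: "\<bar>x e - y e\<bar> \<le> w / 3" "i \<le> e" "w / 6 < \<bar>x i - y i\<bar>"
  shows "\<delta> x' x \<le> \<epsilon> / 16 * \<delta> x y" "0 < \<delta> x y"
proof -
  have pos: "0 < x e" "0 < x' e" "0 < y e" using U halfspace_pos by auto
  have d2: "2 \<le> real d" using e1 by simp
  have d4: "4 \<le> real d ^ 2" using power_mono[OF d2, of 2] by simp
  have "4 * \<omega> \<le> real d ^ 2 * \<omega>" using d4 \<omega> by (intro mult_right_mono) auto
  then have om: "\<omega> \<le> 1 / 16384" using \<omega> \<epsilon> by linarith
  have om1: "\<omega>\<^sup>2 \<le> 1 / 16384" using om \<omega> mult_mono[of \<omega> "1 / 16384" \<omega> 1] by (simp add: power2_eq_square)
  define r where "r = \<omega>\<^sup>2 * w / x e"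
  have r: "0 < r" "r \<le> 1" unfolding r_def using \<omega> w pos x by auto
  have rx: "\<omega>\<^sup>2 * w = r * x e" unfolding r_def using pos by simp
  have "\<omega> ^ 4 * w = \<omega>\<^sup>2 * (r * x e)" unfolding rx[symmetric] by (simp add: power2_eq_square power4_eq_xxxx)
  have "\<omega> ^ 4 * w \<le> (1 / 16384) * (1 * x e)"
    unfolding \<open>\<omega> ^ 4 * w = _\<close> using om1 r pos by (intro mult_mono) auto
  then have x': "x e / 2 \<le> x' e" using near[of e] pos by simp
  have "\<delta> x' x \<le> 2 * real d * \<omega>\<^sup>2 * r"
  proof -
    have "hcosh e x' x - 1 \<le> real d * (\<omega> ^ 4 * w)\<^sup>2 / (2 * x' e * x e)"
      by (rule hdist_le_coordinates[OF U(2,1)]) (use near w in auto)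
    also have "\<dots> \<le> real d * (\<omega> ^ 4 * w)\<^sup>2 / (2 * (x e / 2) * x e)"
      using x' pos by (intro divide_left_mono mult_right_mono mult_left_mono mult_pos_pos) auto
    also have "\<dots> = real d * (\<omega>\<^sup>2 * r)\<^sup>2"
      unfolding \<open>\<omega> ^ 4 * w = _\<close> using pos by (simp add: power2_eq_square)
    finally have "(\<delta> x' x)\<^sup>2 \<le> 2 * (real d * (\<omega>\<^sup>2 * r)\<^sup>2)"
      using cosh_ge_quadratic[of "\<delta> x' x"] cosh_hdist[OF U(2,1)] by linarith
    then have "(\<delta> x' x)\<^sup>2 \<le> (2 * real d) * (\<omega>\<^sup>2 * r)\<^sup>2" by (simp only: mult.assoc)
    also have "\<dots> \<le> (2 * real d)\<^sup>2 * (\<omega>\<^sup>2 * r)\<^sup>2" using d2 by (intro mult_right_mono) (auto simp: power2_eq_square)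
    also have "\<dots> = (2 * real d * \<omega>\<^sup>2 * r)\<^sup>2" by (simp add: power_mult_distrib)
    finally show ?thesis by (rule power2_le_imp_le) (use r in simp)
  qed
  also have "\<dots> = 24 * real d * \<omega> * (\<omega> * r / 12)" by (simp add: power2_eq_square)
  also have D: "\<omega> * r / 12 \<le> \<delta> x y"
  proof (rule hdist_ge_coordinate[OF U(1,3) xy(2)])
    have "\<omega> * r \<le> 1 * 1" using om r \<omega> by (intro mult_mono) auto
    then show "\<omega> * r / 12 \<le> 1" by simp
    show "0 \<le> \<omega> * r / 12" using \<omega> r by simp
    have "\<omega>\<^sup>2 * y e \<le> x e"
    proof -
      have "\<omega>\<^sup>2 * y e \<le> \<omega>\<^sup>2 * (x e + w / 3)" by (intro mult_left_mono) (use xy(1) in \<open>linarith, simp\<close>)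
      also have "\<dots> = \<omega>\<^sup>2 * x e + (\<omega>\<^sup>2 * w) / 3" by (simp add: algebra_simps)
      also have "\<dots> \<le> (1 / 16384) * x e + x e / 3" using om1 pos x by (intro add_mono mult_right_mono) auto
      also have "\<dots> \<le> x e" using pos by simp
      finally show ?thesis .
    qed
    have "(\<omega> * r / 12)\<^sup>2 * (2 * x e * y e) = r * (r * x e) * (\<omega>\<^sup>2 * y e) / 72" by (simp add: power2_eq_square)
    also have "\<dots> \<le> r * (r * x e) * x e / 72" using r pos \<open>\<omega>\<^sup>2 * y e \<le> x e\<close> by (intro divide_right_mono mult_left_mono) auto
    also have "\<dots> = (\<omega>\<^sup>2 * w) * (\<omega>\<^sup>2 * w) / 72" unfolding rx by simp
    also have "\<dots> \<le> (1 * w) * (1 * w) / 72" using om1 w by (intro divide_right_mono mult_mono) auto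
    also have "\<dots> \<le> (w / 6)\<^sup>2" by (simp add: power2_eq_square)
    also have "\<dots> \<le> \<bar>x i - y i\<bar>\<^sup>2" using xy(3) w by (intro power_mono) auto
    finally show "(\<omega> * r / 12)\<^sup>2 * (2 * x e * y e) \<le> (x i - y i)\<^sup>2" by simp
  qed
  then have "24 * real d * \<omega> * (\<omega> * r / 12) \<le> 24 * real d * \<omega> * \<delta> x y" using \<omega> by (intro mult_left_mono) auto
  also have "\<dots> \<le> \<epsilon> / 16 * \<delta> x y"
  proof (rule mult_right_mono)
    have "real d * \<omega> \<le> real d ^ 2 * \<omega>" using d2 \<omega> by (intro mult_right_mono) (auto simp: power2_eq_square)
    then show "24 * real d * \<omega> \<le> \<epsilon> / 16" using \<omega>(2) \<epsilon> by linarith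
    show "0 \<le> \<delta> x y" by (rule hdist_nonneg[OF U(1,3)])
  qed
  finally show "\<delta> x' x \<le> \<epsilon> / 16 * \<delta> x y" .
  have "0 < \<omega> * r / 12" using \<omega> r by simp
  then show "0 < \<delta> x y" using D by linarith
qed

end

section \<open>Spanners in hyperbolic space\<close>

lemma halfspace_has_spanners:
  assumes e1: "1 \<le> e" and ep: "0 < \<epsilon>" "\<epsilon> \<le> 1" and n: "4096 * real (Suc e) ^ 2 / \<epsilon> \<le> 2 ^ n"
  shows "has_spanners (halfspace e) (hdist e) (1 + \<epsilon>)
    (2 ^ Suc e * (4 * (25 * real (Suc e) * (800 * real (Suc e) ^ 2 / sqrt \<epsilon> + 2) ^ e) * real (4 * n + 3)))"
  unfolding has_spanners_def
proof (intro allI impI)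
  define d where "d = Suc e"
  define K where "K = 25 * real d * (800 * real d ^ 2 / sqrt \<epsilon> + 2) ^ e"
  define U where "U = halfspace e"
  define \<delta> where "\<delta> = hdist e"
  \<comment> \<open>With \<open>m\<close> = 2 n and \<open>M\<close> = 4 n the subcells have sides
    \<omega>^2 w and \<omega>^4 w, and an anchor 2^n sides above the boundary has height \<omega>
    w.\<close>
  define \<omega> :: real where "\<omega> = 1 / 2 ^ n"
  define c1 where "c1 = 2 * real d * \<omega>\<^sup>2"
  have d1: "1 \<le> real d ^ 2" unfolding d_def by (rule one_le_power) simp
  have \<omega>: "0 < \<omega>" "4096 * real d ^ 2 * \<omega> \<le> \<epsilon>"
    unfolding \<omega>_def d_def using n ep by (simp_all add: field_simps del: of_nat_Suc)
  have n2: "4 \<le> (2::real) ^ n"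
  proof -
    have "4096 * 1 / 1 \<le> 4096 * real (Suc e) ^ 2 / \<epsilon>"
      using d1 ep unfolding d_def by (intro frac_le mult_left_mono) auto
    then show ?thesis using n by linarith
  qed
  have K1: "1 \<le> K"
  proof -
    have "1 \<le> (800 * real d ^ 2 / sqrt \<epsilon> + 2) ^ e" using ep by (intro one_le_power) simp
    moreover have "1 \<le> 25 * real d" unfolding d_def by simp
    ultimately show ?thesis unfolding K_def using mult_mono[of 1 "25 * real d" 1] by simp
  qed
  fix P assume P: "finite P" "P \<subseteq> halfspace e"
  have PU: "P \<subseteq> U" using P(2) unfolding U_def .
  obtain net where net: "\<And>w o'. 0 < w \<Longrightarrow> net w o' \<subseteq> U \<and> finite (net w o') \<and> real (card (net w o')) \<le> K \<and>
     (\<forall>p\<in>U. \<forall>q\<in>U. in_box d o' w p \<longrightarrow> in_box d o' w q \<longrightarrow> (\<forall>j<d. \<bar>p j - q j\<bar> \<le> w / 3) \<longrightarrow>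
       (\<exists>i<d. w / 6 < \<bar>p i - q i\<bar>) \<longrightarrow>
       (\<exists>s\<in>net w o'. \<delta> p s + \<delta> s q \<le> (1 + \<epsilon> / 4) * \<delta> p q \<and> w / 18 \<le> s e \<and>
          (\<forall>j<d. \<bar>s j - o' j\<bar> \<le> 2 * real d * w)))"
    using hyp_net[OF e1 ep, folded d_def, folded K_def U_def \<delta>_def] by metis
  obtain W where W: "0 < W" "\<And>p q i. p \<in> P \<Longrightarrow> q \<in> P \<Longrightarrow> i < d \<Longrightarrow> \<bar>p i - q i\<bar> \<le> W / 3"
    using finite_coordinate_bound[OF P(1)] by blast
  have sepP: "\<exists>i<d. p i \<noteq> q i" if "p \<in> P" "q \<in> P" "p \<noteq> q" for p q
  proof (rule ccontr)
    assume "\<not> ?thesis"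
    moreover have "p \<in> U" "q \<in> U" using that PU by auto
    ultimately have "p i = q i" for i
      unfolding U_def halfspace_def d_def by (cases "i < Suc e") auto
    then show False using that(3) by auto
  qed
  let ?cell = "dyadic_cell d W"
  obtain L where L: "\<And>l \<sigma>. L \<le> l \<Longrightarrow> inj_on (?cell \<sigma> l) P"
    using dyadic_cell_inj[OF W(1) P(1) sepP] by blast
  have wpos: "0 < W / 2 ^ l" for l using W(1) by simp
  define S where "S \<sigma> l c = net (W / 2 ^ l) (corner W \<sigma> l c)" for \<sigma> l c
  \<comment> \<open>One point of \<open>P\<close> at most one side above the boundary suffices; all
    others in the cell are then at most two sides high. In a cell that is not low, all points of
    \<open>P\<close> are higher than its side, as \<open>high_near\<close> requires.\<close>
  define low where "low \<sigma> l c \<longleftrightarrow> (\<exists>p\<in>P. ?cell \<sigma> l p = c \<and> p e \<le> W / 2 ^ l)" for \<sigma> l c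
  define rp where "rp \<sigma> l c = (SOME p. p \<in> P \<and> ?cell \<sigma> l p = c)" for \<sigma> l c
  \<comment> \<open>The anchor stands 2^n sides high over some point of the cell, so every descent
    from it has slope at most \<omega>.\<close>
  define anchor where "anchor \<sigma> l c = (\<lambda>i. if i < e then rp \<sigma> l c i else if i = e then 2 ^ n * (W / 2 ^ l) else 0)" for \<sigma> l c
  \<comment> \<open>The potential is the logarithm of the height with the surcharge 1 + c1 of
    \<open>vertical_hop\<close>.\<close>
  define H where "H l = (1 + c1) * ln (2 ^ n * (W / 2 ^ l))" for l :: nat
  define h where "h p = (1 + c1) * ln (p e)" for p :: "nat \<Rightarrow> real"
  have anchU: "anchor \<sigma> l c \<in> U" for \<sigma> l c
    unfolding U_def halfspace_def anchor_def using W(1) by simp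
  have anche: "anchor \<sigma> l c e = 2 ^ n * (W / 2 ^ l)" for \<sigma> l c unfolding anchor_def by simp
  have rp: "rp \<sigma> l (?cell \<sigma> l p) \<in> P \<and> ?cell \<sigma> l (rp \<sigma> l (?cell \<sigma> l p)) = ?cell \<sigma> l p" if "p \<in> P" for \<sigma> l p
    unfolding rp_def by (rule someI[of _ p]) (use that in simp)
  have Upos: "0 < x e" if "x \<in> U" for x using that halfspace_pos unfolding U_def by blast
  have hop: "\<delta> x y \<le> (1 + c1) * (ln (x e) - ln (y e))"
    if "x \<in> U" "y \<in> U" "2 * y e \<le> x e" "x e = 2 ^ n * r" "0 \<le> r" "\<And>j. j < e \<Longrightarrow> \<bar>x j - y j\<bar> \<le> r" for x y r
  proof -
    have "r \<le> \<omega> * x e" unfolding that(4) \<omega>_def by simp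
    then have "\<delta> x y \<le> (1 + c1) * ln (x e / y e)"
      using vertical_hop[of x e y r \<omega>] that unfolding \<delta>_def U_def c1_def d_def by blast
    then show ?thesis using ln_divide_pos[of "x e" "y e"] Upos that(1,2) by simp
  qed
  have SS: "S \<sigma> l c \<subseteq> U" "finite (S \<sigma> l c)" "real (card (S \<sigma> l c)) \<le> K" for \<sigma> l c
    unfolding S_def using net[OF wpos] by blast+
  have sym: "\<delta> x y = \<delta> y x" for x y unfolding \<delta>_def by (rule hdist_sym)
  have nonneg: "0 \<le> \<delta> x y" if "x \<in> U" "y \<in> U" for x y using that hdist_nonneg unfolding \<delta>_def U_def by blast
  have tri: "\<delta> x z \<le> \<delta> x y + \<delta> y z" if "x \<in> U" "y \<in> U" "z \<in> U" for x y z
    using that hdist_triangle unfolding \<delta>_def U_def by blast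
  have chain: "\<delta> (anchor \<sigma> l (?cell \<sigma> l p)) (anchor \<sigma> l' (?cell \<sigma> l' p)) \<le> H l - H l'"
    if p: "p \<in> P" and l: "l < l'" for \<sigma> l l' p
  proof -
    let ?x = "anchor \<sigma> l (?cell \<sigma> l p)" and ?y = "anchor \<sigma> l' (?cell \<sigma> l' p)"
    have "\<delta> ?x ?y \<le> (1 + c1) * (ln (?x e) - ln (?y e))"
    proof (rule hop[where r = "W / 2 ^ l"])
      have "(2::real) ^ Suc l \<le> 2 ^ l'" using l by (intro power_increasing) auto
      then have "W / 2 ^ l' \<le> W / 2 ^ Suc l" using W(1) by (intro divide_left_mono) auto
      then have "2 * (W / 2 ^ l') \<le> W / 2 ^ l" by simp
      then have "2 ^ n * (2 * (W / 2 ^ l')) \<le> 2 ^ n * (W / 2 ^ l)" by (rule mult_left_mono) simp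
      then show "2 * ?y e \<le> ?x e" unfolding anche by (simp only: mult.left_commute)
      have "?cell \<sigma> l (rp \<sigma> l' (?cell \<sigma> l' p)) = ?cell \<sigma> l p"
        using dyadic_cell_nested[OF less_imp_le[OF l]] rp[OF p, of \<sigma> l'] by blast
      then have eq: "?cell \<sigma> l (rp \<sigma> l (?cell \<sigma> l p)) = ?cell \<sigma> l (rp \<sigma> l' (?cell \<sigma> l' p))" using rp[OF p, of \<sigma> l] by simp
      show "\<bar>?x j - ?y j\<bar> \<le> W / 2 ^ l" if "j < e" for j
        using dyadic_cell_close[OF W(1) _ eq, of j] that unfolding anchor_def d_def by simp
    qed (use anchU anche wpos in \<open>auto intro: less_imp_le\<close>)
    then show ?thesis unfolding anche H_def by (simp add: right_diff_distrib)
  qed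
  have low_height: "p e \<le> 2 * (W / 2 ^ l)" if "low \<sigma> l (?cell \<sigma> l p)" for \<sigma> l p
  proof -
    obtain p0 where "p0 \<in> P" "?cell \<sigma> l p0 = ?cell \<sigma> l p" "p0 e \<le> W / 2 ^ l" using \<open>low _ _ _\<close> unfolding low_def by blast
    then show ?thesis using dyadic_cell_close[OF W(1), of e d \<sigma> l p0 p] unfolding d_def by simp
  qed
  have anchor_close: "\<bar>anchor \<sigma> l (?cell \<sigma> l p) j - p j\<bar> \<le> W / 2 ^ l" if "p \<in> P" "j < e" for \<sigma> l p j
    using dyadic_cell_close[OF W(1), of j d \<sigma> l "rp \<sigma> l (?cell \<sigma> l p)" p] rp[OF that(1), of \<sigma> l] that(2)
    unfolding anchor_def d_def by simp
  have chain_end: "\<delta> (anchor \<sigma> l (?cell \<sigma> l p)) p \<le> H l - h p" if p: "p \<in> P" and lw: "low \<sigma> l (?cell \<sigma> l p)" for \<sigma> l p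
  proof -
    let ?x = "anchor \<sigma> l (?cell \<sigma> l p)"
    have "\<delta> ?x p \<le> (1 + c1) * (ln (?x e) - ln (p e))"
    proof (rule hop[where r = "W / 2 ^ l"])
      have "4 * (W / 2 ^ l) \<le> 2 ^ n * (W / 2 ^ l)" using n2 wpos[of l] by (intro mult_right_mono) auto
      then show "2 * p e \<le> ?x e" unfolding anche using low_height[OF lw] by linarith
      show "\<bar>?x j - p j\<bar> \<le> W / 2 ^ l" if "j < e" for j using anchor_close[OF p that] .
    qed (use anchU anche wpos p PU in \<open>auto intro: less_imp_le\<close>)
    then show ?thesis unfolding anche H_def h_def by (simp add: right_diff_distrib)
  qed
  interpret cell_hierarchy U \<delta> P "Pow {..<d}" ?cell S low anchor H h "2 * n" "4 * n" L K \<epsilon>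
    by (unfold_locales, rule P(1), rule PU, simp, rule sym, erule (1) nonneg, erule (1) dyadic_cell_nested,
        erule L, rule SS, rule SS, rule SS, rule K1, simp, rule less_imp_le[OF ep(1)], rule anchU,
        erule (1) chain, erule (1) chain_end)
  have "conn \<delta> R p q ((1 + \<epsilon>) * \<delta> p q)" if "p \<in> P" "q \<in> P" for p q
  proof (rule conn_pairs[OF _ that])
    fix p q assume pq: "p \<in> P" "q \<in> P" "p \<noteq> q"
    obtain \<sigma> l where \<sigma>: "\<sigma> \<subseteq> {..<d}" "?cell \<sigma> l p = ?cell \<sigma> l q"
      "?cell \<sigma> (l + 3) p \<noteq> ?cell \<sigma> (l + 3) q" and
      close: "\<forall>i<d. \<bar>p i - q i\<bar> \<le> W / 2 ^ l / 3" and far: "\<exists>i<d. W / 2 ^ l / 6 < \<bar>p i - q i\<bar>"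
      using dyadic_pair[OF W(1) sepP[OF pq]] W(2)[OF pq(1,2)] by metis
    define w where "w = W / 2 ^ l"
    define o' where "o' = corner W \<sigma> l (?cell \<sigma> l p)"
    let ?D = "\<delta> p q"
    have w: "0 < w" unfolding w_def by (rule wpos)
    have X: "p \<in> U" "q \<in> U" using pq PU by auto
    have box: "in_box d o' w p" "in_box d o' w q"
      using in_box_corner[OF W(1), of d \<sigma> l p] in_box_corner[OF W(1), of d \<sigma> l q] \<sigma>(2) unfolding o'_def w_def by simp_all
    obtain s where s: "s \<in> S \<sigma> l (?cell \<sigma> l p)" "\<delta> p s + \<delta> s q \<le> (1 + \<epsilon> / 4) * ?D" "w / 18 \<le> s e"
        "\<forall>j<d. \<bar>s j - o' j\<bar> \<le> 2 * real d * w"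
      using net[OF w, of o'] X box close far unfolding S_def w_def[symmetric] o'_def[symmetric] by blast
    have sU: "s \<in> U" using s(1) SS(1) by blast
    obtain i where i: "i < d" "w / 6 < \<bar>p i - q i\<bar>" using far unfolding w_def by blast
    have lvl: "W / 2 ^ (l + 2 * n) = \<omega>\<^sup>2 * w" "W / 2 ^ (l + 4 * n) = \<omega> ^ 4 * w"
      unfolding w_def \<omega>_def by (simp_all add: power_add power_divide mult.commute[of _ n] flip: power_mult)
    have lift: "2 ^ n * (\<omega>\<^sup>2 * w) = \<omega> * w" unfolding \<omega>_def by (simp add: power2_eq_square)
    have leg: "leg \<sigma> l s x ?D (\<delta> s x + \<epsilon> / 4 * ?D)" if x: "x \<in> P" "y \<in> P" "in_box d o' w x" "\<delta> x y = ?D"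
      "\<bar>x e - y e\<bar> \<le> w / 3" "w / 6 < \<bar>x i - y i\<bar>" "\<delta> s x \<le> 2 * \<delta> x y" for x y
    proof -
      have xU: "x \<in> U" "y \<in> U" using x PU by auto
      have ie: "i \<le> e" using i(1) unfolding d_def by simp
      note c = e1 w ep \<omega>[unfolded d_def]
      show ?thesis
      proof (cases "low \<sigma> (l + 2 * n) (?cell \<sigma> (l + 2 * n) x)")
        case True
        let ?z = "anchor \<sigma> (l + 2 * n) (?cell \<sigma> (l + 2 * n) x)"
        have "\<delta> s ?z + (1 + 2 * real (Suc e) * \<omega>\<^sup>2) * ln (?z e / x e) \<le> \<delta> s x + \<epsilon> / 4 * \<delta> x y"
          unfolding \<delta>_def
        proof (rule low_leg[where i = i and x = x and y = y and z = ?z and s = s and e = e, OF _ _ _ _ c s(3) _ _ _ _ x(5) ie x(6)])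
          show "s \<in> halfspace e" "?z \<in> halfspace e" "x \<in> halfspace e" "y \<in> halfspace e"
            using sU anchU xU unfolding U_def by auto
          show "\<bar>s j - x j\<bar> \<le> 3 * real (Suc e) * w" if j: "j < e" for j
          proof -
            have jd: "j < d" using j unfolding d_def by simp
            have "\<bar>s j - o' j\<bar> \<le> 2 * real d * w" using s(4) jd by blast
            moreover have "o' j \<le> x j \<and> x j < o' j + w" using x(3) jd unfolding in_box_def by blast
            moreover have "w \<le> real d * w" using w unfolding d_def by simp
            ultimately have "\<bar>s j - x j\<bar> \<le> 2 * real d * w + real d * w" by linarith
            then show ?thesis unfolding d_def by (simp add: algebra_simps)
          qed
          show "x e \<le> 2 * \<omega>\<^sup>2 * w" using low_height[OF True] unfolding lvl by simp
          show "?z e = \<omega> * w" unfolding anche lvl by (rule lift)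
          show "\<bar>?z j - x j\<bar> \<le> \<omega>\<^sup>2 * w" if "j < e" for j using anchor_close[OF x(1) that, of \<sigma> "l + 2 * n"] unfolding lvl .
          show "hdist e s x \<le> 2 * hdist e x y" using x(7) unfolding \<delta>_def .
        qed
        then have "\<delta> s ?z + (1 + c1) * (ln (?z e) - ln (x e)) \<le> \<delta> s x + \<epsilon> / 4 * ?D"
          unfolding x(4)[symmetric] c1_def d_def using ln_divide_pos[OF Upos[OF anchU] Upos[OF xU(1)]] by simp
        then have "\<delta> s ?z + (H (l + 2 * n) - h x) \<le> \<delta> s x + \<epsilon> / 4 * ?D"
          unfolding anche H_def h_def right_diff_distrib .
        then show ?thesis unfolding leg_def using True by blast
      next
        case False
        then have high: "\<omega>\<^sup>2 * w < x e" using x(1) unfolding low_def lvl by fastforce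
        show ?thesis unfolding leg_def
        proof (intro disjI2 ballI impI)
          fix x' assume x': "x' \<in> P" "?cell \<sigma> (l + 4 * n) x' = ?cell \<sigma> (l + 4 * n) x"
          have x'U: "x' \<in> U" using x' PU by auto
          have near: "\<bar>x' j - x j\<bar> \<le> \<omega> ^ 4 * w" if "j < Suc e" for j
            using dyadic_cell_close[OF W(1) _ x'(2), of j] that unfolding lvl d_def by simp
          note hn = high_near[where i = i and x = x and x' = x' and y = y and e = e, OF xU(1)[unfolded U_def] x'U[unfolded U_def] xU(2)[unfolded U_def] c high near x(5) ie x(6),
              folded \<delta>_def, unfolded x(4)]
          have "\<delta> s x' \<le> \<delta> s x + \<delta> x' x" using tri[OF sU xU(1) x'U] sym[of x x'] by simp
          moreover have "(1 + \<epsilon>) * \<delta> x' x \<le> 2 * \<delta> x' x"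
            using ep nonneg[OF x'U xU(1)] by (intro mult_right_mono) auto
          moreover have "0 \<le> \<epsilon> * ?D" using ep hn(2) by simp
          ultimately have "\<delta> s x' + (1 + \<epsilon>) * \<delta> x' x \<le> \<delta> s x + \<epsilon> / 4 * ?D" using hn(1) by simp
          moreover have "\<epsilon> / 16 * ?D < 1 * ?D" using ep hn(2) by (intro mult_strict_right_mono) auto
          ultimately show "\<delta> s x' + (1 + \<epsilon>) * \<delta> x' x \<le> \<delta> s x + \<epsilon> / 4 * ?D \<and> \<delta> x' x < ?D" using hn(1) by linarith
        qed
      qed
    qed
    have D0: "0 \<le> ?D" using nonneg[OF X] .
    have "(1 + \<epsilon> / 4) * ?D \<le> 2 * ?D" using ep D0 by (intro mult_right_mono) auto
    then have le2: "\<delta> s p \<le> 2 * ?D" "\<delta> s q \<le> 2 * ?D"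
      using s(2) sym[of s p] nonneg[OF X(1) sU] nonneg[OF sU X(2)] by linarith+
    have ce: "\<bar>p e - q e\<bar> \<le> w / 3" using close unfolding w_def d_def by blast
    have lp: "leg \<sigma> l s p ?D (\<delta> s p + \<epsilon> / 4 * ?D)"
      by (rule leg[OF pq(1,2) box(1) refl ce i(2) le2(1)])
    have lq: "leg \<sigma> l s q ?D (\<delta> s q + \<epsilon> / 4 * ?D)"
      by (rule leg[OF pq(2,1) box(2) sym]) (use ce i(2) le2(2) sym[of p q] in \<open>auto simp: abs_minus_commute\<close>)
    \<comment> \<open>Budget: \<epsilon> / 4 for the net point and \<epsilon> / 4 for each
      leg.\<close>
    have "(\<delta> s p + \<epsilon> / 4 * ?D) + (\<delta> s q + \<epsilon> / 4 * ?D) \<le> (1 + 3 * \<epsilon> / 4) * ?D"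
      using s(2) sym[of p s] by (simp add: algebra_simps)
    also have "\<dots> \<le> (1 + \<epsilon>) * ?D" using ep D0 by (intro mult_right_mono) auto
    finally have AB: "(\<delta> s p + \<epsilon> / 4 * ?D) + (\<delta> s q + \<epsilon> / 4 * ?D) \<le> (1 + \<epsilon>) * ?D" .
    show "\<exists>\<sigma>\<in>Pow {..<d}. \<exists>l. \<exists>s\<in>S \<sigma> l (?cell \<sigma> l p). \<exists>A B.
         ?cell \<sigma> l p = ?cell \<sigma> l q \<and> ?cell \<sigma> (l + 3) p \<noteq> ?cell \<sigma> (l + 3) q \<and>
         leg \<sigma> l s p (\<delta> p q) A \<and> leg \<sigma> l s q (\<delta> p q) B \<and> A + B \<le> (1 + \<epsilon>) * \<delta> p q"
      using s(1) \<sigma> lp lq AB by blast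
  qed
  then have "\<exists>R. finite R \<and> R \<subseteq> U \<times> U \<and> real (card R) \<le> 2 ^ d * (4 * K * real (4 * n + 3)) * real (card P) \<and>
      (\<forall>p\<in>P. \<forall>q\<in>P. conn \<delta> R p q ((1 + \<epsilon>) * \<delta> p q))"
    using finite_R card_R R_subset by (intro exI[of _ R]) (simp add: card_Pow mult.assoc)
  then show "\<exists>R. finite R \<and> R \<subseteq> halfspace e \<times> halfspace e \<and>
      real (card R) \<le> 2 ^ Suc e * (4 * (25 * real (Suc e) * (800 * real (Suc e) ^ 2 / sqrt \<epsilon> + 2) ^ e) * real (4 * n + 3)) * real (card P) \<and>
      (\<forall>p\<in>P. \<forall>q\<in>P. conn (hdist e) R p q ((1 + \<epsilon>) * hdist e p q))"
    unfolding \<delta>_def U_def K_def d_def .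
qed

lemma hyp_has_spanners:
  assumes "1 \<le> e" "0 < \<epsilon>" "\<epsilon> \<le> 1" "4096 * real (Suc e) ^ 2 / \<epsilon> \<le> 2 ^ n"
  shows "has_spanners (model_carrier Hyp (Suc e)) (model_dist Hyp (Suc e)) (1 + \<epsilon>)
    (2 ^ Suc e * (4 * (25 * real (Suc e) * (800 * real (Suc e) ^ 2 / sqrt \<epsilon> + 2) ^ e) * real (4 * n + 3)))"
    (is "has_spanners ?X ?\<delta> _ ?B")
  unfolding has_spanners_def
proof (intro allI impI)
  fix P assume P: "finite P" "P \<subseteq> ?X"
  let ?f = "to_hyp e" and ?U = "halfspace e"
  have "finite (from_hyp e ` P)" "from_hyp e ` P \<subseteq> ?U" using P from_hyp(1) by auto
  then obtain R where R: "finite R" "R \<subseteq> ?U \<times> ?U" "real (card R) \<le> ?B * real (card (from_hyp e ` P))"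
    "\<forall>p\<in>from_hyp e ` P. \<forall>q\<in>from_hyp e ` P. conn (hdist e) R p q ((1 + \<epsilon>) * hdist e p q)"
    using halfspace_has_spanners[OF assms, unfolded has_spanners_def, rule_format, of "from_hyp e ` P"] by blast
  have path: "rpath ?\<delta> (map_prod ?f ?f ` R) (?f x) (?f y) r" if "rpath (hdist e) R x y r" for x y r
    using that
  proof (induction rule: rpath.induct)
    case (rpath_step x y z r)
    have "x \<in> ?U" "y \<in> ?U" using rpath_step.hyps(1) R(2) by auto
    then have "?\<delta> (?f x) (?f y) = hdist e x y" by (rule to_hyp_dist)
    moreover have "(?f x, ?f y) \<in> map_prod ?f ?f ` R \<or> (?f y, ?f x) \<in> map_prod ?f ?f ` R"
      using rpath_step.hyps(1) by force
    then have "rpath ?\<delta> (map_prod ?f ?f ` R) (?f x) (?f z) (?\<delta> (?f x) (?f y) + r)"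
      using rpath_step.IH by (rule rpath.rpath_step)
    ultimately show ?case by (simp only:)
  qed (rule rpath_refl)
  show "\<exists>R. finite R \<and> R \<subseteq> ?X \<times> ?X \<and> real (card R) \<le> ?B * real (card P) \<and>
      (\<forall>p\<in>P. \<forall>q\<in>P. conn ?\<delta> R p q ((1 + \<epsilon>) * ?\<delta> p q))"
  proof (intro exI[of _ "map_prod ?f ?f ` R"] conjI ballI)
    show "finite (map_prod ?f ?f ` R)" using R(1) by simp
    show "map_prod ?f ?f ` R \<subseteq> ?X \<times> ?X" using R(2) to_hyp_carrier by auto
    have "real (card (map_prod ?f ?f ` R)) \<le> real (card R)" using card_image_le[OF R(1)] by simp
    also note R(3)
    also have "?B * real (card (from_hyp e ` P)) \<le> ?B * real (card P)"
      using card_image_le[OF P(1)] assms(2) by (intro mult_left_mono) auto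
    finally show "real (card (map_prod ?f ?f ` R)) \<le> ?B * real (card P)" .
    fix p q assume pq: "p \<in> P" "q \<in> P"
    let ?p = "from_hyp e p" and ?q = "from_hyp e q"
    have fp: "?f ?p = p" "?f ?q = q" "?p \<in> ?U" "?q \<in> ?U" using from_hyp pq P(2) by auto
    then have "hdist e ?p ?q = ?\<delta> p q" using to_hyp_dist[of ?p e ?q] by metis
    moreover have "conn (hdist e) R ?p ?q ((1 + \<epsilon>) * hdist e ?p ?q)" using R(4) pq by blast
    ultimately show "conn ?\<delta> (map_prod ?f ?f ` R) p q ((1 + \<epsilon>) * ?\<delta> p q)"
      unfolding conn_def using path[of ?p ?q] fp(1,2) by metis
  qed
qed

section \<open>Passing to the quotient\<close>

lemma model_dist_nonneg:
  assumes "x \<in> model_carrier k d" "y \<in> model_carrier k d"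
  shows "0 \<le> model_dist k d x y"
proof (cases k)
  case Sph
  then show ?thesis using assms sph_dist_bounds(1) by blast
next
  case Euc
  then show ?thesis by (simp add: sum_nonneg)
next
  case Hyp
  then show ?thesis using assms hyp_mink_ge_1 unfolding Hyp hyp_dist by (simp only: arcosh_nonneg_real)
qed

text \<open>Right translation by g is injective on G because g is onto, hence bijective as G is
  finite. This replaces inverses, which \<open>fin_isom_group\<close> does not list.\<close>

lemma orbit_absorb:
  assumes G: "fin_isom_group k d G" and x: "x \<in> model_carrier k d" and g: "g \<in> G"
  shows "orbit G (g x) = orbit G x"
proof -
  let ?X = "model_carrier k d"
  let ?c = "\<lambda>h. compose ?X h g"
  have fin: "finite G" and ext: "G \<subseteq> ?X \<rightarrow>\<^sub>E ?X" and comp: "?c ` G \<subseteq> G" and bij: "bij_betw g ?X ?X"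
    using G g unfolding fin_isom_group_def Let_def by auto
  have "inj_on ?c G"
  proof (rule inj_onI)
    fix h h' assume h: "h \<in> G" "h' \<in> G" "?c h = ?c h'"
    show "h = h'"
    proof (rule PiE_ext[of h ?X "\<lambda>_. ?X" h'])
      show "h \<in> ?X \<rightarrow>\<^sub>E ?X" "h' \<in> ?X \<rightarrow>\<^sub>E ?X" using h ext by auto
      fix y assume "y \<in> ?X"
      then obtain z where z: "z \<in> ?X" "y = g z" using bij unfolding bij_betw_def by blast
      then show "h y = h' y" using fun_cong[OF h(3), of z] by (simp add: compose_def)
    qed
  qed
  then have "?c ` G = G" using endo_inj_surj[OF fin comp] by blast
  have "orbit G (g x) = (\<lambda>f. f x) ` ?c ` G" unfolding orbit_def image_image using x by (simp add: compose_def)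
  also have "\<dots> = orbit G x" unfolding \<open>?c ` G = G\<close> orbit_def ..
  finally show ?thesis .
qed

text \<open>Edges whose ends are identified by \<open>f\<close> would be loops, which
  \<open>steiner_spanner\<close> forbids; they are dropped, and nonnegativity ensures that this does
  not lengthen the walk.\<close>

lemma walk_of_rpath:
  assumes "rpath \<delta> R x y r" and R: "R \<subseteq> X \<times> X"
    and le: "\<And>u v. u \<in> X \<Longrightarrow> v \<in> X \<Longrightarrow> \<delta>' (f u) (f v) \<le> \<delta> u v"
    and nonneg: "\<And>u v. u \<in> X \<Longrightarrow> v \<in> X \<Longrightarrow> 0 \<le> \<delta> u v"
  shows "\<exists>xs. is_walk {{f u, f v} | u v. (u, v) \<in> R \<and> f u \<noteq> f v} xs (f x) (f y) \<and> walk_weight \<delta>' xs \<le> r"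
  using assms(1)
proof (induction rule: rpath.induct)
  case (rpath_refl x)
  have "is_walk {{f u, f v} | u v. (u, v) \<in> R \<and> f u \<noteq> f v} [f x] (f x) (f x)" by (simp add: is_walk_def)
  then show ?case by (intro exI[of _ "[f x]"]) simp
next
  case (rpath_step x y z r)
  let ?E = "{{f u, f v} | u v. (u, v) \<in> R \<and> f u \<noteq> f v}"
  obtain xs where xs: "is_walk ?E xs (f y) (f z)" "walk_weight \<delta>' xs \<le> r" using rpath_step.IH by blast
  have X: "x \<in> X" "y \<in> X" using rpath_step.hyps(1) R by auto
  show ?case
  proof (cases "f x = f y")
    case True
    then show ?thesis using xs nonneg[OF X] by (intro exI[of _ xs]) auto
  next
    case False
    have E: "{f x, f y} \<in> ?E"
    proof -
      consider "(x, y) \<in> R" | "(y, x) \<in> R" using rpath_step.hyps(1) by blast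
      then show ?thesis
      proof cases
        case 1
        then show ?thesis using False by blast
      next
        case 2
        then show ?thesis using False insert_commute[of "f x" "f y" "{}"] by fastforce
      qed
    qed
    obtain ys where ys: "xs = f y # ys" using xs(1) unfolding is_walk_def by (cases xs) auto
    have "is_walk ?E (f x # xs) (f x) (f z)"
      unfolding is_walk_def
    proof (intro conjI allI impI)
      show "last (f x # xs) = f z" using xs(1) unfolding is_walk_def by simp
      fix i assume i: "Suc i < length (f x # xs)"
      show "{(f x # xs) ! i, (f x # xs) ! Suc i} \<in> ?E"
      proof (cases i)
        case 0
        then show ?thesis using E ys by simp
      next
        case (Suc j)
        then have "Suc j < length xs" using i by simp
        then show ?thesis using xs(1) unfolding is_walk_def Suc by simp
      qed
    qed simp_all
    moreover have "walk_weight \<delta>' (f x # xs) \<le> \<delta> x y + r" using xs(2) le[OF X] unfolding ys by simp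
    ultimately show ?thesis by blast
  qed
qed

lemma quotient_spanner:
  assumes G: "fin_isom_group k d G" and P: "finite P" "P \<subseteq> quot_carrier k d G"
    and sp: "has_spanners (model_carrier k d) (model_dist k d) t B" and B: "0 \<le> B"
  shows "\<exists>V E. steiner_spanner (quot_carrier k d G) (quot_dist k d) t P V E \<and>
    real (card E) \<le> B * real (card P) * real (card G)"
proof -
  let ?X = "model_carrier k d" and ?\<delta> = "model_dist k d" and ?\<delta>' = "quot_dist k d"
  have fin: "finite G" and idG: "restrict id ?X \<in> G" and GX: "\<And>g x. g \<in> G \<Longrightarrow> x \<in> ?X \<Longrightarrow> g x \<in> ?X"
    using G unfolding fin_isom_group_def Let_def by (auto simp: PiE_iff)
  have finO: "finite (orbit G x)" "card (orbit G x) \<le> card G" for x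
    unfolding orbit_def using fin by (auto intro: card_image_le)
  have self: "x \<in> orbit G x" if "x \<in> ?X" for x
    unfolding orbit_def using idG that by (intro image_eqI[of _ _ "restrict id ?X"]) auto
  have mem: "x \<in> ?X \<and> orbit G x = A" if A: "A \<in> P" "x \<in> A" for A x
  proof -
    obtain y where y: "y \<in> ?X" "A = orbit G y" using A P(2) unfolding quot_carrier_def by blast
    then obtain g where "g \<in> G" "x = g y" using A(2) unfolding orbit_def by blast
    then show ?thesis using GX orbit_absorb[OF G y(1)] y by simp
  qed
  have finA: "finite A" "card A \<le> card G" "A \<noteq> {}" if "A \<in> P" for A
  proof -
    obtain y where y: "y \<in> ?X" "A = orbit G y" using \<open>A \<in> P\<close> P(2) unfolding quot_carrier_def by blast
    show "finite A" "card A \<le> card G" unfolding y(2) by (rule finO)+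
    show "A \<noteq> {}" using self[OF y(1)] unfolding y(2) by blast
  qed
  have finU: "finite (\<Union>P)" using P(1) finA(1) by (rule finite_Union)
  have subU: "\<Union>P \<subseteq> ?X" using mem by blast
  from sp[unfolded has_spanners_def, THEN spec, THEN mp, THEN mp, OF finU subU]
  obtain R where R: "finite R" "R \<subseteq> ?X \<times> ?X" "real (card R) \<le> B * real (card (\<Union>P))"
    and conn: "\<forall>p\<in>\<Union>P. \<forall>q\<in>\<Union>P. conn ?\<delta> R p q (t * ?\<delta> p q)"
    by (elim exE conjE)
  let ?f = "orbit G"
  define E where "E = {{?f u, ?f v} | u v. (u, v) \<in> R \<and> ?f u \<noteq> ?f v}"
  define V where "V = P \<union> ?f ` (fst ` R \<union> snd ` R)"
  have le: "?\<delta>' (?f u) (?f v) \<le> ?\<delta> u v" if "u \<in> ?X" "v \<in> ?X" for u v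
    unfolding quot_dist_def using finO self[OF that(1)] self[OF that(2)] by (intro Min_le) (auto intro!: image_eqI[of _ _ "(u, v)"])
  have "steiner_spanner (quot_carrier k d G) ?\<delta>' t P V E"
    unfolding steiner_spanner_def
  proof (intro conjI ballI)
    show "finite V" unfolding V_def using P(1) R(1) by simp
    show "P \<subseteq> V" unfolding V_def by blast
    show "V \<subseteq> quot_carrier k d G" unfolding V_def using P(2) R(2) unfolding quot_carrier_def by auto
    show "E \<subseteq> {{u, v} | u v. u \<in> V \<and> v \<in> V \<and> u \<noteq> v}"
    proof
      fix x assume "x \<in> E"
      then obtain u v where uv: "x = {?f u, ?f v}" "(u, v) \<in> R" "?f u \<noteq> ?f v" unfolding E_def by blast
      have "u \<in> fst ` R" "v \<in> snd ` R" using image_eqI[OF _ uv(2), of u fst] image_eqI[OF _ uv(2), of v snd] by simp_all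
      then have "?f u \<in> V" "?f v \<in> V" unfolding V_def by blast+
      then show "x \<in> {{u, v} | u v. u \<in> V \<and> v \<in> V \<and> u \<noteq> v}"
        by (intro CollectI exI[of _ "?f u"] exI[of _ "?f v"] conjI uv)
    qed
    fix p q assume pq: "p \<in> P" "q \<in> P"
    \<comment> \<open>The orbit distance is attained by two lifts, and all lifts belong to the set
      spanned upstairs, so the stretch bound for that very pair projects.\<close>
    have "?\<delta>' p q \<in> (\<lambda>(a, b). ?\<delta> a b) ` (p \<times> q)"
      unfolding quot_dist_def using finA[OF pq(1)] finA[OF pq(2)] by (intro Min_in) auto
    then obtain a b where ab: "a \<in> p" "b \<in> q" "?\<delta>' p q = ?\<delta> a b" by auto
    have "a \<in> \<Union>P" "b \<in> \<Union>P" using ab pq by auto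
    then obtain r where r: "r \<le> t * ?\<delta> a b" "rpath ?\<delta> R a b r" using conn unfolding conn_def by blast
    obtain xs where "is_walk E xs (?f a) (?f b)" "walk_weight ?\<delta>' xs \<le> r"
      using walk_of_rpath[OF r(2) R(2) le model_dist_nonneg] unfolding E_def by blast
    then show "\<exists>xs. is_walk E xs p q \<and> walk_weight ?\<delta>' xs \<le> t * ?\<delta>' p q"
      using mem[OF pq(1) ab(1)] mem[OF pq(2) ab(2)] r(1) ab(3) by force
  qed
  moreover have "real (card E) \<le> B * real (card P) * real (card G)"
  proof -
    have "E \<subseteq> (\<lambda>(u, v). {?f u, ?f v}) ` R" unfolding E_def by auto
    then have "card E \<le> card R" using surj_card_le[OF R(1)] by blast
    moreover have "card (\<Union>P) \<le> card P * card G"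
    proof -
      have "card (\<Union>P) \<le> (\<Sum>A\<in>P. card A)" using card_UN_le[OF P(1), of id] by simp
      also have "\<dots> \<le> (\<Sum>A\<in>P. card G)" by (rule sum_mono) (rule finA(2))
      finally show ?thesis by simp
    qed
    then have "real (card (\<Union>P)) \<le> real (card P) * real (card G)" by (metis of_nat_le_iff of_nat_mult)
    then have "B * real (card (\<Union>P)) \<le> B * (real (card P) * real (card G))" using B by (rule mult_left_mono)
    ultimately show ?thesis using R(3) by (simp add: mult.assoc)
  qed
  ultimately show ?thesis by blast
qed

section \<open>The edge bound\<close>

lemma has_spanners_mono: "has_spanners X \<delta> t B \<Longrightarrow> B \<le> B' \<Longrightarrow> has_spanners X \<delta> t B'"
  unfolding has_spanners_def by (meson mult_right_mono of_nat_0_le_iff order_trans)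

lemma ex_pow2_between:
  fixes a :: real
  assumes "1 \<le> a"
  obtains n :: nat where "a \<le> 2 ^ n" "real n \<le> log 2 a + 1"
proof -
  define n where "n = nat \<lceil>log 2 a\<rceil>"
  have l: "0 \<le> log 2 a" using assms by simp
  have "log 2 a \<le> real n" unfolding n_def using l by linarith
  then have "2 powr (log 2 a) \<le> 2 powr real n" by simp
  then have "a \<le> 2 ^ n" using assms by (simp add: powr_realpow)
  moreover have "real n \<le> log 2 a + 1" unfolding n_def using l by linarith
  ultimately show thesis by (rule that)
qed

text \<open>A common envelope of the three bounds: the sphere dictates the number of shifts and the
  net size, the hyperbolic case the depth \<open>4 * n\<close>.\<close>

definition edge_bound :: "nat \<Rightarrow> real \<Rightarrow> nat \<Rightarrow> real" where
  "edge_bound d \<epsilon> n = 2 ^ Suc d * (4 * (50 * real (Suc d) ^ 2 * (1200 * real (Suc d) ^ 3 / sqrt \<epsilon> + 2) ^ (d - 1)) * real (4 * n + 3))"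

lemma edge_bound_ge:
  assumes "b \<le> Suc d" "0 \<le> K" "K \<le> 50 * real (Suc d) ^ 2" "0 \<le> A" "A \<le> 1200 * real (Suc d) ^ 3" "0 < \<epsilon>" "m \<le> 4 * n"
  shows "2 ^ b * (4 * (K * (A / sqrt \<epsilon> + 2) ^ (d - 1)) * real (m + 3)) \<le> edge_bound d \<epsilon> n"
  unfolding edge_bound_def using assms
  by (intro mult_mono power_mono power_increasing add_mono divide_right_mono order_refl mult_nonneg_nonneg
      zero_le_power add_nonneg_nonneg) (simp_all del: of_nat_Suc)

lemma model_has_spanners:
  assumes d: "2 \<le> d" and e: "0 < \<epsilon>" "\<epsilon> \<le> 1" and n: "4096 * real (Suc d) ^ 2 / \<epsilon> \<le> 2 ^ n"
  shows "has_spanners (model_carrier k d) (model_dist k d) (1 + \<epsilon>) (edge_bound d \<epsilon> n)"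
proof -
  define N where "N = real (Suc d)"
  have N: "1 \<le> N" "real d \<le> N" unfolding N_def by auto
  have N2: "N \<le> N ^ 2" "N \<le> N ^ 3" "N ^ 2 \<le> N ^ 3" using power_increasing[OF _ N(1)] by (auto simp: self_le_power N)
  have dN: "real d ^ 2 \<le> N ^ 2" using N by (intro power_mono) auto
  have dN3: "2 * real d ^ 2 \<le> 3 * N ^ 3" using dN N2 N by linarith
  have n': "c / \<epsilon> \<le> 2 ^ n" if "c \<le> 4096 * N ^ 2" for c
  proof -
    have "c / \<epsilon> \<le> 4096 * N ^ 2 / \<epsilon>" using that e by (intro divide_right_mono) auto
    then show ?thesis using n unfolding N_def by linarith
  qed
  show ?thesis
  proof (cases k)
    case Sph
    have "has_spanners (model_carrier Sph d) (model_dist Sph d) (1 + \<epsilon>)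
      (2 ^ Suc d * (4 * (50 * N ^ 2 * (1200 * N ^ 3 / sqrt \<epsilon> + 2) ^ (d - 1)) * real (n + 3)))"
      unfolding N_def by (rule sph_has_spanners[OF d e]) (use n'[of "192 * N"] N N2 in \<open>simp add: N_def\<close>)
    then show ?thesis unfolding Sph
      by (rule has_spanners_mono) (rule edge_bound_ge, use e N in \<open>simp_all add: N_def del: of_nat_Suc\<close>)
  next
    case Euc
    have "has_spanners (model_carrier Euc d) (model_dist Euc d) (1 + \<epsilon>)
      (2 ^ d * (4 * (25 * real d * (400 * real d / sqrt \<epsilon> + 2) ^ (d - 1)) * real (n + 3)))"
      by (rule euc_has_spanners[OF d e]) (use n'[of "192 * real d"] N N2 in simp)
    then show ?thesis unfolding Euc
      by (rule has_spanners_mono) (rule edge_bound_ge, use e N N2 in \<open>simp_all add: N_def[symmetric] del: of_nat_Suc\<close>)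
  next
    case Hyp
    obtain e' where d': "d = Suc e'" "1 \<le> e'" using d by (cases d) auto
    have "has_spanners (model_carrier Hyp (Suc e')) (model_dist Hyp (Suc e')) (1 + \<epsilon>)
      (2 ^ Suc e' * (4 * (25 * real (Suc e') * (800 * real (Suc e') ^ 2 / sqrt \<epsilon> + 2) ^ e') * real (4 * n + 3)))"
      by (rule hyp_has_spanners[OF d'(2) e]) (use n'[of "4096 * real d ^ 2"] dN in \<open>simp add: d' del: of_nat_Suc\<close>)
    then have "has_spanners (model_carrier Hyp d) (model_dist Hyp d) (1 + \<epsilon>)
      (2 ^ d * (4 * (25 * real d * (800 * real d ^ 2 / sqrt \<epsilon> + 2) ^ (d - 1)) * real (4 * n + 3)))"
      unfolding d'(1) by simp
    then show ?thesis unfolding Hyp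
      by (rule has_spanners_mono) (rule edge_bound_ge, use e N N2 dN3 in \<open>simp_all add: N_def[symmetric] del: of_nat_Suc\<close>)
  qed
qed

text \<open>As d \<ge> 2, numerical constants and powers of d + 1 \<le> d^2 are absorbed into powers
  of d. As \<epsilon> \<le> 1 / 2, the logarithm is at least ln 2 \<ge> 2 / 3, so terms free of it
  are absorbed too.\<close>

lemma edge_bound_le:
  assumes d: "2 \<le> d" and e: "0 < \<epsilon>" "\<epsilon> \<le> 1 / 2" and n: "real n \<le> log 2 (4096 * real (Suc d) ^ 2 / \<epsilon>) + 1"
  shows "edge_bound d \<epsilon> n \<le> real d powr (21 * real d) * \<epsilon> powr ((1 - real d) / 2) * ln (1 / \<epsilon>)"
proof -
  define D N L Q where "D = real d" and "N = real (Suc d)" and "L = ln (1 / \<epsilon>)" and "Q = 1 / sqrt \<epsilon>"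
  have D: "2 \<le> D" "1 \<le> D" unfolding D_def using d by auto
  have N1: "1 \<le> N" unfolding N_def by simp
  have ND: "N \<le> D ^ 2"
  proof -
    have "D * 2 \<le> D * D" using D by (intro mult_left_mono) auto
    moreover have "N = D + 1" unfolding N_def D_def by simp
    ultimately show ?thesis using D(1) unfolding power2_eq_square by linarith
  qed
  have const: "c * N ^ j \<le> D ^ (i + 2 * j)" if "c \<le> 2 ^ i" "0 \<le> c" for c i j
  proof -
    have "c * N ^ j \<le> D ^ i * (D ^ 2) ^ j"
    proof (rule mult_mono)
      have "(2::real) ^ i \<le> D ^ i" using D by (intro power_mono) auto
      then show "c \<le> D ^ i" using that by linarith
      show "N ^ j \<le> (D ^ 2) ^ j" using ND N1 by (intro power_mono) auto
    qed (use D N1 in auto)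
    then show ?thesis by (simp add: power_add power_mult)
  qed
  have "ln 2 \<le> L" unfolding L_def using e by (subst ln_le_cancel_iff) (auto simp: field_simps)
  then have L: "1 \<le> 3 / 2 * L" using ln2_ge_two_thirds by linarith
  have lg: "log 2 (1 / \<epsilon>) \<le> 3 / 2 * L"
  proof -
    have "log 2 (1 / \<epsilon>) = L / ln 2" unfolding log_def L_def ..
    also have "\<dots> \<le> L / (2 / 3)" using L ln2_ge_two_thirds by (intro divide_left_mono) auto
    finally show ?thesis by simp
  qed
  have lN: "log 2 N \<le> N"
  proof -
    have "N \<le> 2 ^ Suc d" unfolding N_def using less_exp[of "Suc d"] by (metis less_imp_le of_nat_le_iff of_nat_numeral of_nat_power)
    then have "log 2 N \<le> log 2 (2 ^ Suc d)" using N1 by (subst log_le_cancel_iff) auto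
    also have "\<dots> = N" unfolding N_def by (subst log_pow_cancel) auto
    finally show ?thesis .
  qed
  have "log 2 (4096 * N ^ 2 / \<epsilon>) = log 2 4096 + 2 * log 2 N + log 2 (1 / \<epsilon>)"
    using N1 e by (simp add: log_mult_pos log_divide_pos log_nat_power)
  also have "log 2 4096 = (12::real)" using log_pow_cancel[of 2 12] by simp
  finally have "real n \<le> 13 + 2 * N + 3 / 2 * L" using n[folded N_def] lN lg by linarith
  then have n4: "real (4 * n + 3) \<le> 55 + 8 * N + 6 * L" by simp
  \<comment> \<open>The coefficient is 55 * 3 / 2 + 8 * 3 / 2 + 6 = 100.5.\<close>
  have "real (4 * n + 3) \<le> 101 * N ^ 1 * L"
  proof -
    have "55 * 1 \<le> 55 * (3 / 2 * (N * L))" "8 * N \<le> 8 * (3 / 2 * (N * L))" "L \<le> N * L"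
    proof -
      have "N * 1 \<le> N * (3 / 2 * L)" using L N1 by (intro mult_left_mono) auto
      then show "8 * N \<le> 8 * (3 / 2 * (N * L))" "55 * 1 \<le> 55 * (3 / 2 * (N * L))" using N1 by linarith+
      show "L \<le> N * L" using L N1 mult_right_mono[of 1 N L] by simp
    qed
    then show ?thesis using n4 unfolding power_one_right mult.assoc by linarith
  qed
  also have "\<dots> \<le> D ^ (7 + 2 * 1) * L" using L by (intro mult_right_mono const) auto
  finally have f4: "real (4 * n + 3) \<le> D ^ 9 * L" by simp
  have f1: "(2::real) ^ Suc d \<le> D ^ (2 * d)"
  proof -
    have "(2::real) ^ Suc d \<le> D ^ Suc d" using D by (intro power_mono) auto
    also have "\<dots> \<le> D ^ (2 * d)" using D d by (intro power_increasing) auto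
    finally show ?thesis .
  qed
  have f2: "200 * N ^ 2 \<le> D ^ 12" using const[of 200 8 2] by simp
  have Q1: "1 \<le> Q" unfolding Q_def using e by simp
  have "1200 * N ^ 3 / sqrt \<epsilon> + 2 \<le> 1202 * N ^ 3 * Q"
  proof -
    have "1 * 1 \<le> N ^ 3 * Q" using N1 Q1 by (intro mult_mono one_le_power) auto
    then show ?thesis unfolding Q_def by simp
  qed
  also have "\<dots> \<le> D ^ (11 + 2 * 3) * Q" using Q1 by (intro mult_right_mono const) auto
  finally have "(1200 * N ^ 3 / sqrt \<epsilon> + 2) ^ (d - 1) \<le> (D ^ 17 * Q) ^ (d - 1)"
    using N1 e by (intro power_mono) auto
  also have "\<dots> = D ^ (17 * (d - 1)) * Q ^ (d - 1)" by (simp add: power_mult_distrib power_mult)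
  finally have f3: "(1200 * N ^ 3 / sqrt \<epsilon> + 2) ^ (d - 1) \<le> D ^ (17 * (d - 1)) * Q ^ (d - 1)" .
  have "edge_bound d \<epsilon> n = 2 ^ Suc d * ((200 * N ^ 2) * (1200 * N ^ 3 / sqrt \<epsilon> + 2) ^ (d - 1) * real (4 * n + 3))"
    unfolding edge_bound_def N_def by (simp del: of_nat_Suc)
  also have "\<dots> \<le> D ^ (2 * d) * (D ^ 12 * (D ^ (17 * (d - 1)) * Q ^ (d - 1)) * (D ^ 9 * L))"
    using D N1 e Q1 L by (intro mult_mono f1 f2 f3 f4 mult_nonneg_nonneg) auto
  also have "\<dots> = D ^ (2 * d + 12 + 17 * (d - 1) + 9) * Q ^ (d - 1) * L" by (simp add: power_add)
  \<comment> \<open>The exponent is 19 d + 4, at most 21 d because d \<ge> 2; hence the constant 21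
    of the theorem.\<close>
  also have "\<dots> \<le> D ^ (21 * d) * Q ^ (d - 1) * L"
    using D Q1 L d by (intro mult_right_mono power_increasing) auto
  also have "D ^ (21 * d) = real d powr (21 * real d)"
    using D powr_realpow[of D "21 * d"] unfolding D_def by simp
  also have "Q ^ (d - 1) = \<epsilon> powr ((1 - real d) / 2)"
  proof -
    have "Q = \<epsilon> powr (- (1 / 2))" unfolding Q_def using e by (simp add: powr_minus_divide powr_half_sqrt)
    then have "Q ^ (d - 1) = \<epsilon> powr (- (1 / 2) * real (d - 1))" using e by (simp add: powr_realpow[symmetric] powr_powr)
    moreover have "- (1 / 2) * real (d - 1) = (1 - real d) / 2" using d by (simp add: of_nat_diff field_simps)
    ultimately show ?thesis by (simp only:)
  qed
  finally show ?thesis unfolding L_def .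
qed

theorem mainTheorem15:
  shows "\<exists>C::real. \<forall>(k::geom) (d::nat) (\<epsilon>::real) G P.
    2 \<le> d \<longrightarrow> 0 < \<epsilon> \<longrightarrow> \<epsilon> \<le> 1/2 \<longrightarrow>
    fin_isom_group k d G \<longrightarrow> acts_freely k d G \<longrightarrow>
    finite P \<longrightarrow> P \<subseteq> quot_carrier k d G \<longrightarrow>
    (\<exists>V E. steiner_spanner (quot_carrier k d G) (quot_dist k d) (1 + \<epsilon>) P V E \<and>
       real (card E) \<le> real d powr (C * real d) * \<epsilon> powr ((1 - real d) / 2) * ln (1 / \<epsilon>)
                         * real (card P) * real (card G))"
proof (intro exI[of _ 21] allI impI)
  fix k :: geom and d :: nat and \<epsilon> :: real and G P
  assume d: "2 \<le> d" and e: "0 < \<epsilon>" "\<epsilon> \<le> 1 / 2" and G: "fin_isom_group k d G"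
    and P: "finite P" "P \<subseteq> quot_carrier k d G"
  let ?B = "real d powr (21 * real d) * \<epsilon> powr ((1 - real d) / 2) * ln (1 / \<epsilon>)"
  have "1 * 1 \<le> 4096 * real (Suc d) ^ 2" by (intro mult_mono one_le_power) auto
  then have "1 \<le> 4096 * real (Suc d) ^ 2 / \<epsilon>" using e by (subst pos_le_divide_eq) auto
  then obtain n where n: "4096 * real (Suc d) ^ 2 / \<epsilon> \<le> 2 ^ n" "real n \<le> log 2 (4096 * real (Suc d) ^ 2 / \<epsilon>) + 1"
    by (rule ex_pow2_between)
  have "has_spanners (model_carrier k d) (model_dist k d) (1 + \<epsilon>) ?B"
    by (rule has_spanners_mono[OF model_has_spanners[OF d e(1) _ n(1)] edge_bound_le[OF d e n(2)]]) (use e(2) in simp)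
  moreover have "0 \<le> ?B" using e by simp
  ultimately show "\<exists>V E. steiner_spanner (quot_carrier k d G) (quot_dist k d) (1 + \<epsilon>) P V E \<and>
      real (card E) \<le> ?B * real (card P) * real (card G)"
    by (rule quotient_spanner[OF G P])
qed

end
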